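(* Let $(\mathtt{C},\otimes,\mathds{1},\tau)$ be an additive symmetric monoidal category whose tensor product is additive in each variable, let $\Sigma$ be an invertible object of $\mathtt{C}$ with inverse $\Sigma^-$ and a fixed isomorphism $\epsilon:\Sigma^-\otimes\Sigma\to\mathds{1}$, let $(A,\mu)$ be an associative monoid in $\mathtt{C}$ and let $M$ be an $A$-bimodule in $\mathtt{C}$. Let $$\rho_M:\Sigma M\otimes\Sigma A\to\Sigma A\otimes A,\qquad \{\!\{-,-\}\!\}_M:\Sigma M\otimes\Sigma M\to\Sigma(M\otimes A\oplus A\otimes M)$$ be morphisms of $\mathtt{C}$, and let $$\rho_{\Sigma M}:\Sigma M\otimes A\to A\otimes A,\qquad \{\!\{-,-\}\!\}_{\Sigma M}:\Sigma M\otimes\Sigma M\to \Sigma M\otimes A\oplus A\otimes\Sigma M$$ be the morphisms corresponding to them by $$\rho_{\Sigma M}=(\epsilon\otimes A\otimes A)\,(\Sigma^-\otimes\rho_M)\,(\tau_{\Sigma M,\Sigma^-}\otimes\Sigma A)\,(\Sigma M\otimes\epsilon^{-1}\otimes A),$$ $$\{\!\{-,-\}\!\}_{\Sigma M}=\big(\mathrm{id}_{\Sigma M\otimes A}\oplus(\tau_{\Sigma,A}\otimes M)\big)\circ\{\!\{-,-\}\!\}_M .$$ Then the following assertions are equivalent: 1. $(A,M,\rho_M,\{\!\{-,-\}\!\}_M)$ is a $\Sigma$-double Lie-Rinehart algebra; 2. $(A,\Sigma M,\rho_{\Sigma M},\{\!\{-,-\}\!\}_{\Sigma M})$ is a $\mathds{1}$-double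 Lie-Rinehart algebra. Under this correspondence ($M\mapsto\Sigma M$, $\varphi\mapsto\Sigma\otimes\varphi$) one has an equivalence of categories $$\Sigma\text{-}\mathtt{DLR}_A\;\cong\;\mathds{1}\text{-}\mathtt{DLR}_A .$$
   Context: Conventions. Associativity and unit isomorphisms of $\otimes$ are suppressed, an object also denotes its identity morphism, and juxtaposition of morphisms is composition. $\tau_{X,Y}:X\otimes Y\to Y\otimes X$ is the symmetry. For an object $X$, $\Sigma X:=\Sigma\otimes X$, and for a morphism $g$, $\Sigma g:=\Sigma\otimes g$. A subscript such as $\tau_{\Sigma M\Sigma,A}$ means the symmetry of $\Sigma\otimes M\otimes\Sigma$ with $A$. Monoid means associative monoid $(A,\mu)$; an $A$-bimodule $M$ has commuting actions ${}_A\mu:A\otimes M\to M$ and $\mu_A:M\otimes A\to M$. For a bimodule $M$, $\Sigma M$ is a bimodule via ${}_A\mu^{\Sigma M}=(\Sigma\,{}_A\mu)(\tau_{A,\Sigma}\otimes M)$ and $\Sigma\mu_A$; likewise $\Sigma A$ has left action ${}_A\mu^{\Sigma A}=(\Sigma\mu)(\tau_{A,\Sigma}\otimes A)$. Bimodule structures on $\Sigma A\otimes A$. External: right action $\mu^e_A=\Sigma A\otimes\mu$, left action ${}_A\mu^e=(\Sigma\mu\otimes A)(\tau_{A,\Sigma}\otimes A\otimes A)$. Internal: right action $\mu^i_A=(\Sigma\mu\otimes A)(\Sigma A\otimes\tau_{A,A})$, left action ${}_A\mu^i=(\Sigma A\otimes\mu)(\tau_{A,\Sigma A}\otimes A)$.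 Definition ($\Sigma$-double Lie-Rinehart algebra over $A$). It is an $A$-bimodule $(M,{}_A\mu,\mu_A)$ together with: (1) a morphism (the anchor) $\rho:\Sigma M\otimes\Sigma A\to\Sigma A\otimes A$ which is an $A$-bimodule morphism, where the source has the bimodule structure induced by that of $M$ (with $A$ moved past $\Sigma$ and $\Sigma A$ by the symmetry) and the target has the internal structure, and which is a derivation in its second input for the external structure: $\rho(\Sigma M\otimes\Sigma\mu)=\mu_A^e(\rho\otimes A)+{}_A\mu^e(A\otimes\rho)(\tau_{\Sigma M\Sigma,A}\otimes A)$ on $\Sigma M\otimes\Sigma A\otimes A$; (2) a morphism $\{\!\{-,-\}\!\}:\Sigma M\otimes\Sigma M\to\Sigma(M\otimes A\oplus A\otimes M)$ with components $\{\!\{-,-\}\!\}_l$ in $\Sigma M\otimes A$ and $\{\!\{-,-\}\!\}_r$ in $\Sigma A\otimes M$, such that (a) (antisymmetry) $\{\!\{-,-\}\!\}\,\tau_{\Sigma M,\Sigma M}=-\Sigma(\tau_{M,A},\tau_{A,M})\{\!\{-,-\}\!\}$, where $(\tau_{M,A},\tau_{A,M})$ is the automorphism of $M\otimes A\oplus A\otimes M$ exchanging the two summands by the symmetry; (b) (derivation property) $\{\!\{-,-\}\!\}(\Sigma M\otimes\Sigma\,{}_A\mu)=\varphi^l$ on $\Sigma M\otimes\Sigma A\otimes M$ and $\{\!\{-,-\}\!\}(\Sigma M\otimes\Sigma\mu_A)=\varphi^r$ on $\Sigma M\otimes\Sigma M\otimes A$, where $\varphi^l=(\Sigma A\otimes{}_A\mu)(\rho\otimes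 M)+({}_A\mu^{\Sigma M}\otimes A\,,\,{}_A\mu^{\Sigma A}\otimes M)(A\otimes\{\!\{-,-\}\!\})(\tau_{\Sigma M\Sigma,A}\otimes M)$, $\varphi^r=(\Sigma M\otimes\mu\,,\,\Sigma A\otimes\mu_A)(\{\!\{-,-\}\!\}\otimes A)+(\Sigma\mu_A\otimes A)(\tau_{M,\Sigma}\otimes A\otimes A)(M\otimes\rho)(\tau_{\Sigma M\Sigma,M}\otimes A)$ (a pair of maps acts summandwise; terms landing in one summand are viewed in the direct sum); (c) with $\rho_\tau:=-(\Sigma\tau_{A,A})\,\rho\,\tau_{\Sigma A,\Sigma M}:\Sigma A\otimes\Sigma M\to\Sigma A\otimes A$, the following vanishes in $\mathrm{Hom}(\Sigma A\otimes(\Sigma M)^{\otimes2},\Sigma A^{\otimes3})$: $(\rho_\tau\otimes A)(\Sigma A\otimes\{\!\{-,-\}\!\}_l)+\Sigma\tau_{A\otimes A,A}(\rho\otimes A)(\Sigma M\otimes\rho)\tau_{\Sigma A,\Sigma M\otimes\Sigma M}+\Sigma\tau_{A,A\otimes A}(\rho\otimes A)(\Sigma M\otimes\rho_\tau)\tau_{\Sigma A\otimes\Sigma M,\Sigma M}=0$; (d) (double Jacobi) the following vanishes in $\mathrm{Hom}((\Sigma M)^{\otimes3},\Sigma M\otimes A^{\otimes2})$: $(\{\!\{-,-\}\!\}_l\otimes A)(\Sigma M\otimes\{\!\{-,-\}\!\}_l)+\Sigma\tau_{A,M\otimes A}(\{\!\{-,-\}\!\}_r\otimes A)(\Sigma M\otimes\{\!\{-,-\}\!\}_l)\tau_{\Sigma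 M\otimes\Sigma M,\Sigma M}+\Sigma\tau_{A\otimes A,M}(\rho\otimes M)(\Sigma M\otimes\{\!\{-,-\}\!\}_r)\tau_{\Sigma M,\Sigma M\otimes\Sigma M}=0.$ A $\mathds{1}$-double Lie-Rinehart algebra is the case $\Sigma=\mathds{1}$. A morphism $\varphi:M\to N$ of $\Sigma$-double Lie-Rinehart algebras over $A$ is an $A$-bimodule morphism with $\Sigma(\varphi\otimes A\,,\,A\otimes\varphi)\circ\{\!\{-,-\}\!\}^M=\{\!\{-,-\}\!\}^N\circ(\Sigma\varphi\otimes\Sigma\varphi)$. $\Sigma\text{-}\mathtt{DLR}_A$ denotes the resulting category. *)

theory Defs
  imports "HOL-Algebra.Group"
begin

record ('o, 'm) category =
  Obj :: "'o set"
  Hom :: "'o \<Rightarrow> 'o \<Rightarrow> 'm set"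
  comp :: "'m \<Rightarrow> 'm \<Rightarrow> 'm"  (infixr "\<cdot>\<index>" 70)
  ident :: "'o \<Rightarrow> 'm"  ("\<langle>_\<rangle>\<index>")

text \<open>Hom-sets need not be disjoint, so the source and target of an arrow are not functions of
  the arrow. This is why functors, inverses and negatives below carry objects as arguments.\<close>

locale category =
  fixes C :: "('o, 'm, 'z) category_scheme" (structure)
  assumes ident_in: "X \<in> Obj C \<Longrightarrow> \<langle>X\<rangle> \<in> Hom C X X"
    and comp_in: "\<lbrakk>X \<in> Obj C; Y \<in> Obj C; Z \<in> Obj C; g \<in> Hom C Y Z; f \<in> Hom C X Y\<rbrakk>
      \<Longrightarrow> g \<cdot> f \<in> Hom C X Z"
    and comp_ident: "\<lbrakk>X \<in> Obj C; Y \<in> Obj C; f \<in> Hom C X Y\<rbrakk> \<Longrightarrow> f \<cdot> \<langle>X\<rangle> = f"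
    and ident_comp: "\<lbrakk>X \<in> Obj C; Y \<in> Obj C; f \<in> Hom C X Y\<rbrakk> \<Longrightarrow> \<langle>Y\<rangle> \<cdot> f = f"
    and comp_assoc: "\<lbrakk>W \<in> Obj C; X \<in> Obj C; Y \<in> Obj C; Z \<in> Obj C;
        h \<in> Hom C Y Z; g \<in> Hom C X Y; f \<in> Hom C W X\<rbrakk>
      \<Longrightarrow> (h \<cdot> g) \<cdot> f = h \<cdot> (g \<cdot> f)"

definition inverse_arrows ::
  "('o, 'm, 'z) category_scheme \<Rightarrow> 'o \<Rightarrow> 'o \<Rightarrow> 'm \<Rightarrow> 'm \<Rightarrow> bool" where
  "inverse_arrows C X Y f g \<longleftrightarrow> f \<in> Hom C X Y \<and> g \<in> Hom C Y X \<and>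
     g \<cdot>\<^bsub>C\<^esub> f = \<langle>X\<rangle>\<^bsub>C\<^esub> \<and> f \<cdot>\<^bsub>C\<^esub> g = \<langle>Y\<rangle>\<^bsub>C\<^esub>"

definition iso_arrow :: "('o, 'm, 'z) category_scheme \<Rightarrow> 'o \<Rightarrow> 'o \<Rightarrow> 'm \<Rightarrow> bool" where
  "iso_arrow C X Y f \<longleftrightarrow> (\<exists>g. inverse_arrows C X Y f g)"

definition inv_arrow :: "('o, 'm, 'z) category_scheme \<Rightarrow> 'o \<Rightarrow> 'o \<Rightarrow> 'm \<Rightarrow> 'm" where
  "inv_arrow C X Y f = (THE g. inverse_arrows C X Y f g)"

locale category_functor = source: category C + target: category D
  for C :: "('o, 'm, 'y) category_scheme" and D :: "('p, 'n, 'z) category_scheme" +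
  fixes F :: "'o \<Rightarrow> 'p" and Fm :: "'o \<Rightarrow> 'o \<Rightarrow> 'm \<Rightarrow> 'n"
  assumes map_obj: "X \<in> Obj C \<Longrightarrow> F X \<in> Obj D"
    and map_in: "\<lbrakk>X \<in> Obj C; Y \<in> Obj C; f \<in> Hom C X Y\<rbrakk> \<Longrightarrow> Fm X Y f \<in> Hom D (F X) (F Y)"
    and map_ident: "X \<in> Obj C \<Longrightarrow> Fm X X \<langle>X\<rangle>\<^bsub>C\<^esub> = \<langle>F X\<rangle>\<^bsub>D\<^esub>"
    and map_comp: "\<lbrakk>X \<in> Obj C; Y \<in> Obj C; Z \<in> Obj C; g \<in> Hom C Y Z; f \<in> Hom C X Y\<rbrakk>
      \<Longrightarrow> Fm X Z (g \<cdot>\<^bsub>C\<^esub> f) = Fm Y Z g \<cdot>\<^bsub>D\<^esub> Fm X Y f"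

definition natural_iso ::
  "('o, 'm, 'y) category_scheme \<Rightarrow> ('p, 'n, 'z) category_scheme \<Rightarrow>
   ('o \<Rightarrow> 'p) \<Rightarrow> ('o \<Rightarrow> 'o \<Rightarrow> 'm \<Rightarrow> 'n) \<Rightarrow> ('o \<Rightarrow> 'p) \<Rightarrow> ('o \<Rightarrow> 'o \<Rightarrow> 'm \<Rightarrow> 'n) \<Rightarrow>
   ('o \<Rightarrow> 'n) \<Rightarrow> bool" where
  "natural_iso C D F Fm G Gm \<eta> \<longleftrightarrow>
     (\<forall>X \<in> Obj C. iso_arrow D (F X) (G X) (\<eta> X)) \<and>
     (\<forall>X \<in> Obj C. \<forall>Y \<in> Obj C. \<forall>f \<in> Hom C X Y.
        \<eta> Y \<cdot>\<^bsub>D\<^esub> Fm X Y f = Gm X Y f \<cdot>\<^bsub>D\<^esub> \<eta> X)"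

definition equivalence_of_categories ::
  "('o, 'm, 'y) category_scheme \<Rightarrow> ('p, 'n, 'z) category_scheme \<Rightarrow>
   ('o \<Rightarrow> 'p) \<Rightarrow> ('o \<Rightarrow> 'o \<Rightarrow> 'm \<Rightarrow> 'n) \<Rightarrow> bool" where
  "equivalence_of_categories C D F Fm \<longleftrightarrow>
     category_functor C D F Fm \<and>
     (\<exists>G Gm \<eta> \<theta>. category_functor D C G Gm \<and>
        natural_iso C C (\<lambda>X. X) (\<lambda>X Y f. f) (\<lambda>X. G (F X)) (\<lambda>X Y f. Gm (F X) (F Y) (Fm X Y f)) \<eta> \<and>
        natural_iso D D (\<lambda>X. F (G X)) (\<lambda>X Y f. Fm (G X) (G Y) (Gm X Y f)) (\<lambda>X. X) (\<lambda>X Y f. f) \<theta>)"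

record ('o, 'm) additive_category = "('o, 'm) category" +
  addm :: "'m \<Rightarrow> 'm \<Rightarrow> 'm"  (infixl "\<oplus>\<^sub>m\<index>" 65)
  zerom :: "'o \<Rightarrow> 'o \<Rightarrow> 'm"
  dsum :: "'o \<Rightarrow> 'o \<Rightarrow> 'o"  (infixr "\<oplus>\<^sub>o\<index>" 70)
  in1 :: "'o \<Rightarrow> 'o \<Rightarrow> 'm"
  in2 :: "'o \<Rightarrow> 'o \<Rightarrow> 'm"
  pr1 :: "'o \<Rightarrow> 'o \<Rightarrow> 'm"
  pr2 :: "'o \<Rightarrow> 'o \<Rightarrow> 'm"

definition hom_group ::
  "('o, 'm, 'z) additive_category_scheme \<Rightarrow> 'o \<Rightarrow> 'o \<Rightarrow> 'm monoid" where
  "hom_group C X Y = \<lparr>carrier = Hom C X Y, mult = addm C, one = zerom C X Y\<rparr>"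

definition neg :: "('o, 'm, 'z) additive_category_scheme \<Rightarrow> 'o \<Rightarrow> 'o \<Rightarrow> 'm \<Rightarrow> 'm" where
  "neg C X Y f = inv\<^bsub>hom_group C X Y\<^esub> f"

locale additive_category = category C
  for C :: "('o, 'm, 'z) additive_category_scheme" (structure) +
  assumes hom_comm_group: "\<lbrakk>X \<in> Obj C; Y \<in> Obj C\<rbrakk> \<Longrightarrow> comm_group (hom_group C X Y)"
    and comp_add_left: "\<lbrakk>X \<in> Obj C; Y \<in> Obj C; Z \<in> Obj C;
        g \<in> Hom C Y Z; h \<in> Hom C Y Z; f \<in> Hom C X Y\<rbrakk>
      \<Longrightarrow> (g \<oplus>\<^sub>m h) \<cdot> f = (g \<cdot> f) \<oplus>\<^sub>m (h \<cdot> f)"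
    and comp_add_right: "\<lbrakk>X \<in> Obj C; Y \<in> Obj C; Z \<in> Obj C;
        g \<in> Hom C Y Z; f \<in> Hom C X Y; h \<in> Hom C X Y\<rbrakk>
      \<Longrightarrow> g \<cdot> (f \<oplus>\<^sub>m h) = (g \<cdot> f) \<oplus>\<^sub>m (g \<cdot> h)"
    and zero_object: "\<exists>Z \<in> Obj C. \<langle>Z\<rangle> = zerom C Z Z"
    and dsum_obj: "\<lbrakk>X \<in> Obj C; Y \<in> Obj C\<rbrakk> \<Longrightarrow> X \<oplus>\<^sub>o Y \<in> Obj C"
    and in1_in: "\<lbrakk>X \<in> Obj C; Y \<in> Obj C\<rbrakk> \<Longrightarrow> in1 C X Y \<in> Hom C X (X \<oplus>\<^sub>o Y)"
    and in2_in: "\<lbrakk>X \<in> Obj C; Y \<in> Obj C\<rbrakk> \<Longrightarrow> in2 C X Y \<in> Hom C Y (X \<oplus>\<^sub>o Y)"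
    and pr1_in: "\<lbrakk>X \<in> Obj C; Y \<in> Obj C\<rbrakk> \<Longrightarrow> pr1 C X Y \<in> Hom C (X \<oplus>\<^sub>o Y) X"
    and pr2_in: "\<lbrakk>X \<in> Obj C; Y \<in> Obj C\<rbrakk> \<Longrightarrow> pr2 C X Y \<in> Hom C (X \<oplus>\<^sub>o Y) Y"
    and pr1_in1: "\<lbrakk>X \<in> Obj C; Y \<in> Obj C\<rbrakk> \<Longrightarrow> pr1 C X Y \<cdot> in1 C X Y = \<langle>X\<rangle>"
    and pr2_in2: "\<lbrakk>X \<in> Obj C; Y \<in> Obj C\<rbrakk> \<Longrightarrow> pr2 C X Y \<cdot> in2 C X Y = \<langle>Y\<rangle>"
    and pr1_in2: "\<lbrakk>X \<in> Obj C; Y \<in> Obj C\<rbrakk> \<Longrightarrow> pr1 C X Y \<cdot> in2 C X Y = zerom C Y X"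
    and pr2_in1: "\<lbrakk>X \<in> Obj C; Y \<in> Obj C\<rbrakk> \<Longrightarrow> pr2 C X Y \<cdot> in1 C X Y = zerom C X Y"
    and dsum_ident: "\<lbrakk>X \<in> Obj C; Y \<in> Obj C\<rbrakk>
      \<Longrightarrow> (in1 C X Y \<cdot> pr1 C X Y) \<oplus>\<^sub>m (in2 C X Y \<cdot> pr2 C X Y) = \<langle>X \<oplus>\<^sub>o Y\<rangle>"

record ('o, 'm) asm_category = "('o, 'm) additive_category" +
  unit_obj :: "'o"  ("\<I>\<index>")
  tensor :: "'o \<Rightarrow> 'o \<Rightarrow> 'o"  (infixr "\<otimes>\<^sub>o\<index>" 75)
  tensorm :: "'m \<Rightarrow> 'm \<Rightarrow> 'm"  (infixr "\<otimes>\<^sub>m\<index>" 75)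
  assoc :: "'o \<Rightarrow> 'o \<Rightarrow> 'o \<Rightarrow> 'm"  ("\<alpha>\<index>")
  lunit :: "'o \<Rightarrow> 'm"  ("\<ll>\<index>")
  runit :: "'o \<Rightarrow> 'm"  ("\<rr>\<index>")
  symm :: "'o \<Rightarrow> 'o \<Rightarrow> 'm"  ("\<tau>\<index>")

locale additive_symmetric_monoidal_category = additive_category C
  for C :: "('o, 'm, 'z) asm_category_scheme" (structure) +
  assumes unit_obj: "\<I> \<in> Obj C"
    and tensor_obj: "\<lbrakk>X \<in> Obj C; Y \<in> Obj C\<rbrakk> \<Longrightarrow> X \<otimes>\<^sub>o Y \<in> Obj C"
    and tensor_in: "\<lbrakk>X \<in> Obj C; Y \<in> Obj C; X' \<in> Obj C; Y' \<in> Obj C;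
        f \<in> Hom C X Y; g \<in> Hom C X' Y'\<rbrakk>
      \<Longrightarrow> f \<otimes>\<^sub>m g \<in> Hom C (X \<otimes>\<^sub>o X') (Y \<otimes>\<^sub>o Y')"
    and tensor_ident: "\<lbrakk>X \<in> Obj C; Y \<in> Obj C\<rbrakk> \<Longrightarrow> \<langle>X\<rangle> \<otimes>\<^sub>m \<langle>Y\<rangle> = \<langle>X \<otimes>\<^sub>o Y\<rangle>"
    and tensor_comp: "\<lbrakk>X \<in> Obj C; Y \<in> Obj C; Z \<in> Obj C; X' \<in> Obj C; Y' \<in> Obj C; Z' \<in> Obj C;
        g \<in> Hom C Y Z; f \<in> Hom C X Y; g' \<in> Hom C Y' Z'; f' \<in> Hom C X' Y'\<rbrakk>
      \<Longrightarrow> (g \<cdot> f) \<otimes>\<^sub>m (g' \<cdot> f') = (g \<otimes>\<^sub>m g') \<cdot> (f \<otimes>\<^sub>m f')"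
    and tensor_add_left: "\<lbrakk>X \<in> Obj C; Y \<in> Obj C; X' \<in> Obj C; Y' \<in> Obj C;
        f \<in> Hom C X Y; g \<in> Hom C X Y; h \<in> Hom C X' Y'\<rbrakk>
      \<Longrightarrow> (f \<oplus>\<^sub>m g) \<otimes>\<^sub>m h = (f \<otimes>\<^sub>m h) \<oplus>\<^sub>m (g \<otimes>\<^sub>m h)"
    and tensor_add_right: "\<lbrakk>X \<in> Obj C; Y \<in> Obj C; X' \<in> Obj C; Y' \<in> Obj C;
        h \<in> Hom C X Y; f \<in> Hom C X' Y'; g \<in> Hom C X' Y'\<rbrakk>
      \<Longrightarrow> h \<otimes>\<^sub>m (f \<oplus>\<^sub>m g) = (h \<otimes>\<^sub>m f) \<oplus>\<^sub>m (h \<otimes>\<^sub>m g)"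
    and assoc_iso: "\<lbrakk>X \<in> Obj C; Y \<in> Obj C; Z \<in> Obj C\<rbrakk>
      \<Longrightarrow> iso_arrow C ((X \<otimes>\<^sub>o Y) \<otimes>\<^sub>o Z) (X \<otimes>\<^sub>o (Y \<otimes>\<^sub>o Z)) (\<alpha> X Y Z)"
    and assoc_natural: "\<lbrakk>X \<in> Obj C; Y \<in> Obj C; Z \<in> Obj C; X' \<in> Obj C; Y' \<in> Obj C; Z' \<in> Obj C;
        f \<in> Hom C X X'; g \<in> Hom C Y Y'; h \<in> Hom C Z Z'\<rbrakk>
      \<Longrightarrow> \<alpha> X' Y' Z' \<cdot> ((f \<otimes>\<^sub>m g) \<otimes>\<^sub>m h) = (f \<otimes>\<^sub>m (g \<otimes>\<^sub>m h)) \<cdot> \<alpha> X Y Z"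
    and lunit_iso: "X \<in> Obj C \<Longrightarrow> iso_arrow C (\<I> \<otimes>\<^sub>o X) X (\<ll> X)"
    and lunit_natural: "\<lbrakk>X \<in> Obj C; Y \<in> Obj C; f \<in> Hom C X Y\<rbrakk>
      \<Longrightarrow> \<ll> Y \<cdot> (\<langle>\<I>\<rangle> \<otimes>\<^sub>m f) = f \<cdot> \<ll> X"
    and runit_iso: "X \<in> Obj C \<Longrightarrow> iso_arrow C (X \<otimes>\<^sub>o \<I>) X (\<rr> X)"
    and runit_natural: "\<lbrakk>X \<in> Obj C; Y \<in> Obj C; f \<in> Hom C X Y\<rbrakk>
      \<Longrightarrow> \<rr> Y \<cdot> (f \<otimes>\<^sub>m \<langle>\<I>\<rangle>) = f \<cdot> \<rr> X"
    and triangle: "\<lbrakk>X \<in> Obj C; Y \<in> Obj C\<rbrakk>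
      \<Longrightarrow> (\<langle>X\<rangle> \<otimes>\<^sub>m \<ll> Y) \<cdot> \<alpha> X \<I> Y = \<rr> X \<otimes>\<^sub>m \<langle>Y\<rangle>"
    and pentagon: "\<lbrakk>W \<in> Obj C; X \<in> Obj C; Y \<in> Obj C; Z \<in> Obj C\<rbrakk>
      \<Longrightarrow> \<alpha> W X (Y \<otimes>\<^sub>o Z) \<cdot> \<alpha> (W \<otimes>\<^sub>o X) Y Z
        = (\<langle>W\<rangle> \<otimes>\<^sub>m \<alpha> X Y Z) \<cdot> \<alpha> W (X \<otimes>\<^sub>o Y) Z \<cdot> (\<alpha> W X Y \<otimes>\<^sub>m \<langle>Z\<rangle>)"
    and symm_in: "\<lbrakk>X \<in> Obj C; Y \<in> Obj C\<rbrakk> \<Longrightarrow> \<tau> X Y \<in> Hom C (X \<otimes>\<^sub>o Y) (Y \<otimes>\<^sub>o X)"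
    and symm_natural: "\<lbrakk>X \<in> Obj C; Y \<in> Obj C; X' \<in> Obj C; Y' \<in> Obj C;
        f \<in> Hom C X X'; g \<in> Hom C Y Y'\<rbrakk>
      \<Longrightarrow> \<tau> X' Y' \<cdot> (f \<otimes>\<^sub>m g) = (g \<otimes>\<^sub>m f) \<cdot> \<tau> X Y"
    and symm_symm: "\<lbrakk>X \<in> Obj C; Y \<in> Obj C\<rbrakk> \<Longrightarrow> \<tau> Y X \<cdot> \<tau> X Y = \<langle>X \<otimes>\<^sub>o Y\<rangle>"
    and hexagon: "\<lbrakk>X \<in> Obj C; Y \<in> Obj C; Z \<in> Obj C\<rbrakk>
      \<Longrightarrow> \<alpha> Y Z X \<cdot> \<tau> X (Y \<otimes>\<^sub>o Z) \<cdot> \<alpha> X Y Z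
        = (\<langle>Y\<rangle> \<otimes>\<^sub>m \<tau> X Z) \<cdot> \<alpha> Y X Z \<cdot> (\<tau> X Y \<otimes>\<^sub>m \<langle>Z\<rangle>)"

record ('o, 'm) dlr =
  und :: "'o"
  lact :: "'m"
  ract :: "'m"
  anchor :: "'m"
  bracket :: "'m"

context
  fixes C :: "('o, 'm, 'z) asm_category_scheme" (structure)
begin

definition assoc_inv :: "'o \<Rightarrow> 'o \<Rightarrow> 'o \<Rightarrow> 'm" where
  "assoc_inv X Y Z = inv_arrow C ((X \<otimes>\<^sub>o Y) \<otimes>\<^sub>o Z) (X \<otimes>\<^sub>o (Y \<otimes>\<^sub>o Z)) (\<alpha> X Y Z)"

notation assoc_inv ("\<alpha>\<^sup>-")

definition lunit_inv :: "'o \<Rightarrow> 'm" where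
  "lunit_inv X = inv_arrow C (\<I> \<otimes>\<^sub>o X) X (\<ll> X)"

notation lunit_inv ("\<ll>\<^sup>-")

text \<open>Neither the monoid nor its bimodules are required to be unital: only the multiplication
  and the two actions are part of the data.\<close>

definition assoc_monoid :: "'o \<Rightarrow> 'm \<Rightarrow> bool" where
  "assoc_monoid A \<mu> \<longleftrightarrow> A \<in> Obj C \<and> \<mu> \<in> Hom C (A \<otimes>\<^sub>o A) A \<and>
     \<mu> \<cdot> (\<mu> \<otimes>\<^sub>m \<langle>A\<rangle>) = \<mu> \<cdot> (\<langle>A\<rangle> \<otimes>\<^sub>m \<mu>) \<cdot> \<alpha> A A A"

definition bimodule :: "'o \<Rightarrow> 'm \<Rightarrow> 'o \<Rightarrow> 'm \<Rightarrow> 'm \<Rightarrow> bool" where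
  "bimodule A \<mu> M l r \<longleftrightarrow> M \<in> Obj C \<and> l \<in> Hom C (A \<otimes>\<^sub>o M) M \<and> r \<in> Hom C (M \<otimes>\<^sub>o A) M \<and>
     l \<cdot> (\<mu> \<otimes>\<^sub>m \<langle>M\<rangle>) = l \<cdot> (\<langle>A\<rangle> \<otimes>\<^sub>m l) \<cdot> \<alpha> A A M \<and>
     r \<cdot> (r \<otimes>\<^sub>m \<langle>A\<rangle>) = r \<cdot> (\<langle>M\<rangle> \<otimes>\<^sub>m \<mu>) \<cdot> \<alpha> M A A \<and>
     r \<cdot> (l \<otimes>\<^sub>m \<langle>A\<rangle>) = l \<cdot> (\<langle>A\<rangle> \<otimes>\<^sub>m r) \<cdot> \<alpha> A M A"

definition bimodule_hom :: "'o \<Rightarrow> 'o \<Rightarrow> 'm \<Rightarrow> 'm \<Rightarrow> 'o \<Rightarrow> 'm \<Rightarrow> 'm \<Rightarrow> 'm \<Rightarrow> bool" where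
  "bimodule_hom A M l r N l' r' f \<longleftrightarrow> f \<in> Hom C M N \<and>
     f \<cdot> l = l' \<cdot> (\<langle>A\<rangle> \<otimes>\<^sub>m f) \<and> f \<cdot> r = r' \<cdot> (f \<otimes>\<^sub>m \<langle>A\<rangle>)"

text \<open>The actions on \<open>\<Sigma> \<otimes> M\<close>; with \<open>M = A\<close> and \<open>l = r = \<mu>\<close> also those on \<open>\<Sigma> \<otimes> A\<close>.\<close>

definition susp_lact :: "'o \<Rightarrow> 'o \<Rightarrow> 'o \<Rightarrow> 'm \<Rightarrow> 'm" where
  "susp_lact \<Sigma> A M l =
     (\<langle>\<Sigma>\<rangle> \<otimes>\<^sub>m l) \<cdot> \<alpha> \<Sigma> A M \<cdot> (\<tau> A \<Sigma> \<otimes>\<^sub>m \<langle>M\<rangle>) \<cdot> \<alpha>\<^sup>- A \<Sigma> M"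

definition susp_ract :: "'o \<Rightarrow> 'o \<Rightarrow> 'o \<Rightarrow> 'm \<Rightarrow> 'm" where
  "susp_ract \<Sigma> A M r = (\<langle>\<Sigma>\<rangle> \<otimes>\<^sub>m r) \<cdot> \<alpha> \<Sigma> M A"

text \<open>External (\<open>ext\<close>) and internal (\<open>int\<close>) actions on \<open>(\<Sigma> \<otimes> A) \<otimes> A\<close>.\<close>

definition ext_lact :: "'o \<Rightarrow> 'o \<Rightarrow> 'm \<Rightarrow> 'm" where
  "ext_lact \<Sigma> A \<mu> = (susp_lact \<Sigma> A A \<mu> \<otimes>\<^sub>m \<langle>A\<rangle>) \<cdot> \<alpha>\<^sup>- A (\<Sigma> \<otimes>\<^sub>o A) A"

definition ext_ract :: "'o \<Rightarrow> 'o \<Rightarrow> 'm \<Rightarrow> 'm" where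
  "ext_ract \<Sigma> A \<mu> = (\<langle>\<Sigma> \<otimes>\<^sub>o A\<rangle> \<otimes>\<^sub>m \<mu>) \<cdot> \<alpha> (\<Sigma> \<otimes>\<^sub>o A) A A"

definition int_lact :: "'o \<Rightarrow> 'o \<Rightarrow> 'm \<Rightarrow> 'm" where
  "int_lact \<Sigma> A \<mu> =
     (\<langle>\<Sigma> \<otimes>\<^sub>o A\<rangle> \<otimes>\<^sub>m \<mu>) \<cdot> \<alpha> (\<Sigma> \<otimes>\<^sub>o A) A A \<cdot>
     (\<tau> A (\<Sigma> \<otimes>\<^sub>o A) \<otimes>\<^sub>m \<langle>A\<rangle>) \<cdot> \<alpha>\<^sup>- A (\<Sigma> \<otimes>\<^sub>o A) A"

definition int_ract :: "'o \<Rightarrow> 'o \<Rightarrow> 'm \<Rightarrow> 'm" where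
  "int_ract \<Sigma> A \<mu> =
     (susp_ract \<Sigma> A A \<mu> \<otimes>\<^sub>m \<langle>A\<rangle>) \<cdot> \<alpha>\<^sup>- (\<Sigma> \<otimes>\<^sub>o A) A A \<cdot>
     (\<langle>\<Sigma> \<otimes>\<^sub>o A\<rangle> \<otimes>\<^sub>m \<tau> A A) \<cdot> \<alpha> (\<Sigma> \<otimes>\<^sub>o A) A A"

text \<open>Actions on the source \<open>(\<Sigma> \<otimes> M) \<otimes> (\<Sigma> \<otimes> A)\<close> of the anchor, through those of \<open>M\<close>:
  the left one moves \<open>A\<close> past \<open>\<Sigma>\<close>, the right one moves \<open>A\<close> past \<open>\<Sigma> \<otimes> A\<close>.\<close>

definition src_lact :: "'o \<Rightarrow> 'o \<Rightarrow> 'o \<Rightarrow> 'm \<Rightarrow> 'm" where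
  "src_lact \<Sigma> A M l =
     (susp_lact \<Sigma> A M l \<otimes>\<^sub>m \<langle>\<Sigma> \<otimes>\<^sub>o A\<rangle>) \<cdot> \<alpha>\<^sup>- A (\<Sigma> \<otimes>\<^sub>o M) (\<Sigma> \<otimes>\<^sub>o A)"

definition src_ract :: "'o \<Rightarrow> 'o \<Rightarrow> 'o \<Rightarrow> 'm \<Rightarrow> 'm" where
  "src_ract \<Sigma> A M r =
     (susp_ract \<Sigma> A M r \<otimes>\<^sub>m \<langle>\<Sigma> \<otimes>\<^sub>o A\<rangle>) \<cdot> \<alpha>\<^sup>- (\<Sigma> \<otimes>\<^sub>o M) A (\<Sigma> \<otimes>\<^sub>o A) \<cdot>
     (\<langle>\<Sigma> \<otimes>\<^sub>o M\<rangle> \<otimes>\<^sub>m \<tau> (\<Sigma> \<otimes>\<^sub>o A) A) \<cdot> \<alpha> (\<Sigma> \<otimes>\<^sub>o M) (\<Sigma> \<otimes>\<^sub>o A) A"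

text \<open>\<open>swap_past \<Sigma> X Y Z : (X \<otimes> (\<Sigma> \<otimes> Y)) \<otimes> Z \<rightarrow> Y \<otimes> (X \<otimes> (\<Sigma> \<otimes> Z))\<close> is
  \<open>\<tau>\<^bsub>X \<otimes> \<Sigma>, Y\<^esub> \<otimes> Z\<close> up to associators, and
  \<open>flatten \<Sigma> X Y Z : ((\<Sigma> \<otimes> X) \<otimes> Y) \<otimes> Z \<rightarrow> \<Sigma> \<otimes> (X \<otimes> (Y \<otimes> Z))\<close>.\<close>

definition swap_past :: "'o \<Rightarrow> 'o \<Rightarrow> 'o \<Rightarrow> 'o \<Rightarrow> 'm" where
  "swap_past \<Sigma> X Y Z =
     (\<langle>Y\<rangle> \<otimes>\<^sub>m \<alpha> X \<Sigma> Z) \<cdot> \<alpha> Y (X \<otimes>\<^sub>o \<Sigma>) Z \<cdot>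
     (\<tau> (X \<otimes>\<^sub>o \<Sigma>) Y \<otimes>\<^sub>m \<langle>Z\<rangle>) \<cdot> (\<alpha>\<^sup>- X \<Sigma> Y \<otimes>\<^sub>m \<langle>Z\<rangle>)"

definition flatten :: "'o \<Rightarrow> 'o \<Rightarrow> 'o \<Rightarrow> 'o \<Rightarrow> 'm" where
  "flatten \<Sigma> X Y Z = \<alpha> \<Sigma> X (Y \<otimes>\<^sub>o Z) \<cdot> \<alpha> (\<Sigma> \<otimes>\<^sub>o X) Y Z"

definition dsumm :: "'o \<Rightarrow> 'o \<Rightarrow> 'o \<Rightarrow> 'o \<Rightarrow> 'm \<Rightarrow> 'm \<Rightarrow> 'm" where
  "dsumm X Y X' Y' f g =
     (in1 C X' Y' \<cdot> f \<cdot> pr1 C X Y) \<oplus>\<^sub>m (in2 C X' Y' \<cdot> g \<cdot> pr2 C X Y)"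

definition brk_sum :: "'o \<Rightarrow> 'o \<Rightarrow> 'o" where
  "brk_sum A M = (M \<otimes>\<^sub>o A) \<oplus>\<^sub>o (A \<otimes>\<^sub>o M)"

text \<open>Projections of \<open>\<Sigma> \<otimes> (M \<otimes> A \<oplus> A \<otimes> M)\<close> onto \<open>(\<Sigma> \<otimes> M) \<otimes> A\<close> and
  \<open>(\<Sigma> \<otimes> A) \<otimes> M\<close>, and the corresponding inclusions.\<close>

definition proj_l :: "'o \<Rightarrow> 'o \<Rightarrow> 'o \<Rightarrow> 'm" where
  "proj_l \<Sigma> A M = \<alpha>\<^sup>- \<Sigma> M A \<cdot> (\<langle>\<Sigma>\<rangle> \<otimes>\<^sub>m pr1 C (M \<otimes>\<^sub>o A) (A \<otimes>\<^sub>o M))"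

definition proj_r :: "'o \<Rightarrow> 'o \<Rightarrow> 'o \<Rightarrow> 'm" where
  "proj_r \<Sigma> A M = \<alpha>\<^sup>- \<Sigma> A M \<cdot> (\<langle>\<Sigma>\<rangle> \<otimes>\<^sub>m pr2 C (M \<otimes>\<^sub>o A) (A \<otimes>\<^sub>o M))"

definition incl_l :: "'o \<Rightarrow> 'o \<Rightarrow> 'o \<Rightarrow> 'm" where
  "incl_l \<Sigma> A M = (\<langle>\<Sigma>\<rangle> \<otimes>\<^sub>m in1 C (M \<otimes>\<^sub>o A) (A \<otimes>\<^sub>o M)) \<cdot> \<alpha> \<Sigma> M A"

definition incl_r :: "'o \<Rightarrow> 'o \<Rightarrow> 'o \<Rightarrow> 'm" where
  "incl_r \<Sigma> A M = (\<langle>\<Sigma>\<rangle> \<otimes>\<^sub>m in2 C (M \<otimes>\<^sub>o A) (A \<otimes>\<^sub>o M)) \<cdot> \<alpha> \<Sigma> A M"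

definition anchor_bimodule_hom :: "'o \<Rightarrow> 'o \<Rightarrow> 'm \<Rightarrow> 'o \<Rightarrow> 'm \<Rightarrow> 'm \<Rightarrow> 'm \<Rightarrow> bool" where
  "anchor_bimodule_hom \<Sigma> A \<mu> M l r \<rho> \<longleftrightarrow>
     bimodule_hom A
       ((\<Sigma> \<otimes>\<^sub>o M) \<otimes>\<^sub>o (\<Sigma> \<otimes>\<^sub>o A)) (src_lact \<Sigma> A M l) (src_ract \<Sigma> A M r)
       ((\<Sigma> \<otimes>\<^sub>o A) \<otimes>\<^sub>o A) (int_lact \<Sigma> A \<mu>) (int_ract \<Sigma> A \<mu>) \<rho>"

text \<open>An equation on \<open>\<Sigma>M \<otimes> \<Sigma>A \<otimes> A\<close>, bracketed as
  \<open>((\<Sigma> \<otimes> M) \<otimes> (\<Sigma> \<otimes> A)) \<otimes> A\<close>.\<close>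

definition anchor_derivation :: "'o \<Rightarrow> 'o \<Rightarrow> 'm \<Rightarrow> 'o \<Rightarrow> 'm \<Rightarrow> bool" where
  "anchor_derivation \<Sigma> A \<mu> M \<rho> \<longleftrightarrow>
     \<rho> \<cdot> (\<langle>\<Sigma> \<otimes>\<^sub>o M\<rangle> \<otimes>\<^sub>m ((\<langle>\<Sigma>\<rangle> \<otimes>\<^sub>m \<mu>) \<cdot> \<alpha> \<Sigma> A A)) \<cdot> \<alpha> (\<Sigma> \<otimes>\<^sub>o M) (\<Sigma> \<otimes>\<^sub>o A) A
     = (ext_ract \<Sigma> A \<mu> \<cdot> (\<rho> \<otimes>\<^sub>m \<langle>A\<rangle>))
       \<oplus>\<^sub>m (ext_lact \<Sigma> A \<mu> \<cdot> (\<langle>A\<rangle> \<otimes>\<^sub>m \<rho>) \<cdot> swap_past \<Sigma> (\<Sigma> \<otimes>\<^sub>o M) A A)"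

definition bracket_antisym :: "'o \<Rightarrow> 'o \<Rightarrow> 'o \<Rightarrow> 'm \<Rightarrow> bool" where
  "bracket_antisym \<Sigma> A M b \<longleftrightarrow>
     b \<cdot> \<tau> (\<Sigma> \<otimes>\<^sub>o M) (\<Sigma> \<otimes>\<^sub>o M)
     = neg C ((\<Sigma> \<otimes>\<^sub>o M) \<otimes>\<^sub>o (\<Sigma> \<otimes>\<^sub>o M)) (\<Sigma> \<otimes>\<^sub>o brk_sum A M)
         ((\<langle>\<Sigma>\<rangle> \<otimes>\<^sub>m
             ((in2 C (M \<otimes>\<^sub>o A) (A \<otimes>\<^sub>o M) \<cdot> \<tau> M A \<cdot> pr1 C (M \<otimes>\<^sub>o A) (A \<otimes>\<^sub>o M))
              \<oplus>\<^sub>m (in1 C (M \<otimes>\<^sub>o A) (A \<otimes>\<^sub>o M) \<cdot> \<tau> A M \<cdot> pr2 C (M \<otimes>\<^sub>o A) (A \<otimes>\<^sub>o M)))) \<cdot> b)"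

definition phi_l :: "'o \<Rightarrow> 'o \<Rightarrow> 'm \<Rightarrow> 'o \<Rightarrow> 'm \<Rightarrow> 'm \<Rightarrow> 'm \<Rightarrow> 'm" where
  "phi_l \<Sigma> A \<mu> M l \<rho> b =
     (incl_r \<Sigma> A M \<cdot> (\<langle>\<Sigma> \<otimes>\<^sub>o A\<rangle> \<otimes>\<^sub>m l) \<cdot> \<alpha> (\<Sigma> \<otimes>\<^sub>o A) A M \<cdot> (\<rho> \<otimes>\<^sub>m \<langle>M\<rangle>))
     \<oplus>\<^sub>m
     (((incl_l \<Sigma> A M \<cdot> (susp_lact \<Sigma> A M l \<otimes>\<^sub>m \<langle>A\<rangle>) \<cdot> \<alpha>\<^sup>- A (\<Sigma> \<otimes>\<^sub>o M) A \<cdot> (\<langle>A\<rangle> \<otimes>\<^sub>m proj_l \<Sigma> A M))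
       \<oplus>\<^sub>m
       (incl_r \<Sigma> A M \<cdot> (susp_lact \<Sigma> A A \<mu> \<otimes>\<^sub>m \<langle>M\<rangle>) \<cdot> \<alpha>\<^sup>- A (\<Sigma> \<otimes>\<^sub>o A) M \<cdot> (\<langle>A\<rangle> \<otimes>\<^sub>m proj_r \<Sigma> A M)))
      \<cdot> (\<langle>A\<rangle> \<otimes>\<^sub>m b) \<cdot> swap_past \<Sigma> (\<Sigma> \<otimes>\<^sub>o M) A M)"

definition phi_r :: "'o \<Rightarrow> 'o \<Rightarrow> 'm \<Rightarrow> 'o \<Rightarrow> 'm \<Rightarrow> 'm \<Rightarrow> 'm \<Rightarrow> 'm" where
  "phi_r \<Sigma> A \<mu> M r \<rho> b =
     (((incl_l \<Sigma> A M \<cdot> (\<langle>\<Sigma> \<otimes>\<^sub>o M\<rangle> \<otimes>\<^sub>m \<mu>) \<cdot> \<alpha> (\<Sigma> \<otimes>\<^sub>o M) A A \<cdot> (proj_l \<Sigma> A M \<otimes>\<^sub>m \<langle>A\<rangle>))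
       \<oplus>\<^sub>m
       (incl_r \<Sigma> A M \<cdot> (\<langle>\<Sigma> \<otimes>\<^sub>o A\<rangle> \<otimes>\<^sub>m r) \<cdot> \<alpha> (\<Sigma> \<otimes>\<^sub>o A) M A \<cdot> (proj_r \<Sigma> A M \<otimes>\<^sub>m \<langle>A\<rangle>)))
      \<cdot> (b \<otimes>\<^sub>m \<langle>A\<rangle>))
     \<oplus>\<^sub>m
     (incl_l \<Sigma> A M \<cdot> (susp_ract \<Sigma> A M r \<otimes>\<^sub>m \<langle>A\<rangle>) \<cdot>
      (((\<tau> M \<Sigma> \<otimes>\<^sub>m \<langle>A\<rangle>) \<cdot> \<alpha>\<^sup>- M \<Sigma> A) \<otimes>\<^sub>m \<langle>A\<rangle>) \<cdot> \<alpha>\<^sup>- M (\<Sigma> \<otimes>\<^sub>o A) A \<cdot>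
      (\<langle>M\<rangle> \<otimes>\<^sub>m \<rho>) \<cdot> swap_past \<Sigma> (\<Sigma> \<otimes>\<^sub>o M) M A)"

definition bracket_derivation :: "'o \<Rightarrow> 'o \<Rightarrow> 'm \<Rightarrow> 'o \<Rightarrow> 'm \<Rightarrow> 'm \<Rightarrow> 'm \<Rightarrow> 'm \<Rightarrow> bool" where
  "bracket_derivation \<Sigma> A \<mu> M l r \<rho> b \<longleftrightarrow>
     b \<cdot> (\<langle>\<Sigma> \<otimes>\<^sub>o M\<rangle> \<otimes>\<^sub>m ((\<langle>\<Sigma>\<rangle> \<otimes>\<^sub>m l) \<cdot> \<alpha> \<Sigma> A M)) \<cdot> \<alpha> (\<Sigma> \<otimes>\<^sub>o M) (\<Sigma> \<otimes>\<^sub>o A) M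
       = phi_l \<Sigma> A \<mu> M l \<rho> b \<and>
     b \<cdot> (\<langle>\<Sigma> \<otimes>\<^sub>o M\<rangle> \<otimes>\<^sub>m ((\<langle>\<Sigma>\<rangle> \<otimes>\<^sub>m r) \<cdot> \<alpha> \<Sigma> M A)) \<cdot> \<alpha> (\<Sigma> \<otimes>\<^sub>o M) (\<Sigma> \<otimes>\<^sub>o M) A
       = phi_r \<Sigma> A \<mu> M r \<rho> b"

definition anchor_tau :: "'o \<Rightarrow> 'o \<Rightarrow> 'o \<Rightarrow> 'm \<Rightarrow> 'm" where
  "anchor_tau \<Sigma> A M \<rho> =
     neg C ((\<Sigma> \<otimes>\<^sub>o A) \<otimes>\<^sub>o (\<Sigma> \<otimes>\<^sub>o M)) ((\<Sigma> \<otimes>\<^sub>o A) \<otimes>\<^sub>o A)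
       (\<alpha>\<^sup>- \<Sigma> A A \<cdot> (\<langle>\<Sigma>\<rangle> \<otimes>\<^sub>m \<tau> A A) \<cdot> \<alpha> \<Sigma> A A \<cdot> \<rho> \<cdot> \<tau> (\<Sigma> \<otimes>\<^sub>o A) (\<Sigma> \<otimes>\<^sub>o M))"

text \<open>An equation of arrows
  \<open>(\<Sigma> \<otimes> A) \<otimes> ((\<Sigma> \<otimes> M) \<otimes> (\<Sigma> \<otimes> M)) \<rightarrow> \<Sigma> \<otimes> (A \<otimes> (A \<otimes> A))\<close>.\<close>

definition anchor_bracket_compat :: "'o \<Rightarrow> 'o \<Rightarrow> 'o \<Rightarrow> 'm \<Rightarrow> 'm \<Rightarrow> bool" where
  "anchor_bracket_compat \<Sigma> A M \<rho> b \<longleftrightarrow>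
     (let SM = \<Sigma> \<otimes>\<^sub>o M; SA = \<Sigma> \<otimes>\<^sub>o A; \<rho>' = anchor_tau \<Sigma> A M \<rho>; bl = proj_l \<Sigma> A M \<cdot> b in
      (flatten \<Sigma> A A A \<cdot> (\<rho>' \<otimes>\<^sub>m \<langle>A\<rangle>) \<cdot> \<alpha>\<^sup>- SA SM A \<cdot> (\<langle>SA\<rangle> \<otimes>\<^sub>m bl))
      \<oplus>\<^sub>m
      ((\<langle>\<Sigma>\<rangle> \<otimes>\<^sub>m (\<tau> (A \<otimes>\<^sub>o A) A \<cdot> \<alpha>\<^sup>- A A A)) \<cdot> flatten \<Sigma> A A A \<cdot>
       (\<rho> \<otimes>\<^sub>m \<langle>A\<rangle>) \<cdot> \<alpha>\<^sup>- SM SA A \<cdot> (\<langle>SM\<rangle> \<otimes>\<^sub>m \<rho>) \<cdot>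
       \<alpha> SM SM SA \<cdot> \<tau> SA (SM \<otimes>\<^sub>o SM))
      \<oplus>\<^sub>m
      ((\<langle>\<Sigma>\<rangle> \<otimes>\<^sub>m (\<alpha> A A A \<cdot> \<tau> A (A \<otimes>\<^sub>o A))) \<cdot> flatten \<Sigma> A A A \<cdot>
       (\<rho> \<otimes>\<^sub>m \<langle>A\<rangle>) \<cdot> \<alpha>\<^sup>- SM SA A \<cdot> (\<langle>SM\<rangle> \<otimes>\<^sub>m \<rho>') \<cdot>
       \<tau> (SA \<otimes>\<^sub>o SM) SM \<cdot> \<alpha>\<^sup>- SA SM SM)
      = zerom C (SA \<otimes>\<^sub>o (SM \<otimes>\<^sub>o SM)) (\<Sigma> \<otimes>\<^sub>o (A \<otimes>\<^sub>o (A \<otimes>\<^sub>o A))))"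

text \<open>An equation of arrows
  \<open>(\<Sigma> \<otimes> M) \<otimes> ((\<Sigma> \<otimes> M) \<otimes> (\<Sigma> \<otimes> M)) \<rightarrow> \<Sigma> \<otimes> (M \<otimes> (A \<otimes> A))\<close>.\<close>

definition double_jacobi :: "'o \<Rightarrow> 'o \<Rightarrow> 'o \<Rightarrow> 'm \<Rightarrow> 'm \<Rightarrow> bool" where
  "double_jacobi \<Sigma> A M \<rho> b \<longleftrightarrow>
     (let SM = \<Sigma> \<otimes>\<^sub>o M; SA = \<Sigma> \<otimes>\<^sub>o A;
          bl = proj_l \<Sigma> A M \<cdot> b; br = proj_r \<Sigma> A M \<cdot> b in
      (flatten \<Sigma> M A A \<cdot> (bl \<otimes>\<^sub>m \<langle>A\<rangle>) \<cdot> \<alpha>\<^sup>- SM SM A \<cdot> (\<langle>SM\<rangle> \<otimes>\<^sub>m bl))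
      \<oplus>\<^sub>m
      ((\<langle>\<Sigma>\<rangle> \<otimes>\<^sub>m (\<alpha> M A A \<cdot> \<tau> A (M \<otimes>\<^sub>o A))) \<cdot> flatten \<Sigma> A M A \<cdot>
       (br \<otimes>\<^sub>m \<langle>A\<rangle>) \<cdot> \<alpha>\<^sup>- SM SM A \<cdot> (\<langle>SM\<rangle> \<otimes>\<^sub>m bl) \<cdot>
       \<tau> (SM \<otimes>\<^sub>o SM) SM \<cdot> \<alpha>\<^sup>- SM SM SM)
      \<oplus>\<^sub>m
      ((\<langle>\<Sigma>\<rangle> \<otimes>\<^sub>m (\<tau> (A \<otimes>\<^sub>o A) M \<cdot> \<alpha>\<^sup>- A A M)) \<cdot> flatten \<Sigma> A A M \<cdot>
       (\<rho> \<otimes>\<^sub>m \<langle>M\<rangle>) \<cdot> \<alpha>\<^sup>- SM SA M \<cdot> (\<langle>SM\<rangle> \<otimes>\<^sub>m br) \<cdot>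
       \<alpha> SM SM SM \<cdot> \<tau> SM (SM \<otimes>\<^sub>o SM))
      = zerom C (SM \<otimes>\<^sub>o (SM \<otimes>\<^sub>o SM)) (\<Sigma> \<otimes>\<^sub>o (M \<otimes>\<^sub>o (A \<otimes>\<^sub>o A))))"

definition double_lie_rinehart :: "'o \<Rightarrow> 'o \<Rightarrow> 'm \<Rightarrow> ('o, 'm) dlr \<Rightarrow> bool" where
  "double_lie_rinehart \<Sigma> A \<mu> d \<longleftrightarrow>
     (let M = und d; l = lact d; r = ract d; \<rho> = anchor d; b = bracket d in
      bimodule A \<mu> M l r \<and>
      \<rho> \<in> Hom C ((\<Sigma> \<otimes>\<^sub>o M) \<otimes>\<^sub>o (\<Sigma> \<otimes>\<^sub>o A)) ((\<Sigma> \<otimes>\<^sub>o A) \<otimes>\<^sub>o A) \<and>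
      anchor_bimodule_hom \<Sigma> A \<mu> M l r \<rho> \<and>
      anchor_derivation \<Sigma> A \<mu> M \<rho> \<and>
      b \<in> Hom C ((\<Sigma> \<otimes>\<^sub>o M) \<otimes>\<^sub>o (\<Sigma> \<otimes>\<^sub>o M)) (\<Sigma> \<otimes>\<^sub>o brk_sum A M) \<and>
      bracket_antisym \<Sigma> A M b \<and>
      bracket_derivation \<Sigma> A \<mu> M l r \<rho> b \<and>
      anchor_bracket_compat \<Sigma> A M \<rho> b \<and>
      double_jacobi \<Sigma> A M \<rho> b)"

definition dlr_hom :: "'o \<Rightarrow> 'o \<Rightarrow> ('o, 'm) dlr \<Rightarrow> ('o, 'm) dlr \<Rightarrow> 'm \<Rightarrow> bool" where
  "dlr_hom \<Sigma> A d e \<phi> \<longleftrightarrow>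
     bimodule_hom A (und d) (lact d) (ract d) (und e) (lact e) (ract e) \<phi> \<and>
     (\<langle>\<Sigma>\<rangle> \<otimes>\<^sub>m dsumm (und d \<otimes>\<^sub>o A) (A \<otimes>\<^sub>o und d) (und e \<otimes>\<^sub>o A) (A \<otimes>\<^sub>o und e)
              (\<phi> \<otimes>\<^sub>m \<langle>A\<rangle>) (\<langle>A\<rangle> \<otimes>\<^sub>m \<phi>)) \<cdot> bracket d
     = bracket e \<cdot> ((\<langle>\<Sigma>\<rangle> \<otimes>\<^sub>m \<phi>) \<otimes>\<^sub>m (\<langle>\<Sigma>\<rangle> \<otimes>\<^sub>m \<phi>))"

definition DLR :: "'o \<Rightarrow> 'o \<Rightarrow> 'm \<Rightarrow> (('o, 'm) dlr, 'm) category" where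
  "DLR \<Sigma> A \<mu> =
     \<lparr>Obj = {d. double_lie_rinehart \<Sigma> A \<mu> d},
      Hom = (\<lambda>d e. {\<phi>. dlr_hom \<Sigma> A d e \<phi>}),
      comp = comp C,
      ident = (\<lambda>d. \<langle>und d\<rangle>)\<rparr>"

text \<open>\<open>T\<close> is the inverse object of \<open>\<Sigma>\<close>, with \<open>\<epsilon> : T \<otimes> \<Sigma> \<rightarrow> \<I>\<close>. Read from right to left:
  insert \<open>\<epsilon>\<inverse>\<close> between \<open>\<Sigma>M\<close> and \<open>A\<close>, move \<open>T\<close> to the front, apply \<open>\<rho>\<close>, cancel
  with \<open>\<epsilon>\<close>. The result is an arrow \<open>(\<Sigma> \<otimes> M) \<otimes> A \<rightarrow> A \<otimes> A\<close>.\<close>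

definition shift_anchor :: "'o \<Rightarrow> 'o \<Rightarrow> 'm \<Rightarrow> 'o \<Rightarrow> 'o \<Rightarrow> 'm \<Rightarrow> 'm" where
  "shift_anchor \<Sigma> T \<epsilon> A M \<rho> =
     (let SM = \<Sigma> \<otimes>\<^sub>o M; SA = \<Sigma> \<otimes>\<^sub>o A in
      (\<ll> A \<otimes>\<^sub>m \<langle>A\<rangle>) \<cdot> ((\<epsilon> \<otimes>\<^sub>m \<langle>A\<rangle>) \<otimes>\<^sub>m \<langle>A\<rangle>) \<cdot> (\<alpha>\<^sup>- T \<Sigma> A \<otimes>\<^sub>m \<langle>A\<rangle>) \<cdot> \<alpha>\<^sup>- T SA A \<cdot>
      (\<langle>T\<rangle> \<otimes>\<^sub>m \<rho>) \<cdot>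
      \<alpha> T SM SA \<cdot> (\<tau> SM T \<otimes>\<^sub>m \<langle>SA\<rangle>) \<cdot> \<alpha>\<^sup>- SM T SA \<cdot>
      (\<langle>SM\<rangle> \<otimes>\<^sub>m (\<alpha> T \<Sigma> A \<cdot> (inv_arrow C (T \<otimes>\<^sub>o \<Sigma>) \<I> \<epsilon> \<otimes>\<^sub>m \<langle>A\<rangle>) \<cdot> \<ll>\<^sup>- A)))"

text \<open>\<open>distrib\<close> is the canonical isomorphism
  \<open>\<Sigma> \<otimes> (M \<otimes> A \<oplus> A \<otimes> M) \<rightarrow> (\<Sigma> \<otimes> M) \<otimes> A \<oplus> (\<Sigma> \<otimes> A) \<otimes> M\<close>, and
  \<open>shift_bracket \<Sigma> A M b\<close> is an arrow
  \<open>(\<Sigma> \<otimes> M) \<otimes> (\<Sigma> \<otimes> M) \<rightarrow> (\<Sigma> \<otimes> M) \<otimes> A \<oplus> A \<otimes> (\<Sigma> \<otimes> M)\<close>.\<close>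

definition distrib :: "'o \<Rightarrow> 'o \<Rightarrow> 'o \<Rightarrow> 'm" where
  "distrib \<Sigma> A M =
     (in1 C ((\<Sigma> \<otimes>\<^sub>o M) \<otimes>\<^sub>o A) ((\<Sigma> \<otimes>\<^sub>o A) \<otimes>\<^sub>o M) \<cdot> proj_l \<Sigma> A M)
     \<oplus>\<^sub>m (in2 C ((\<Sigma> \<otimes>\<^sub>o M) \<otimes>\<^sub>o A) ((\<Sigma> \<otimes>\<^sub>o A) \<otimes>\<^sub>o M) \<cdot> proj_r \<Sigma> A M)"

definition shift_bracket :: "'o \<Rightarrow> 'o \<Rightarrow> 'o \<Rightarrow> 'm \<Rightarrow> 'm" where
  "shift_bracket \<Sigma> A M b =
     dsumm ((\<Sigma> \<otimes>\<^sub>o M) \<otimes>\<^sub>o A) ((\<Sigma> \<otimes>\<^sub>o A) \<otimes>\<^sub>o M) ((\<Sigma> \<otimes>\<^sub>o M) \<otimes>\<^sub>o A) (A \<otimes>\<^sub>o (\<Sigma> \<otimes>\<^sub>o M))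
       \<langle>(\<Sigma> \<otimes>\<^sub>o M) \<otimes>\<^sub>o A\<rangle> (\<alpha> A \<Sigma> M \<cdot> (\<tau> \<Sigma> A \<otimes>\<^sub>m \<langle>M\<rangle>)) \<cdot>
     distrib \<Sigma> A M \<cdot> b"

text \<open>An anchor \<open>N \<otimes> A \<rightarrow> A \<otimes> A\<close> and a bracket \<open>N \<otimes> N \<rightarrow> N \<otimes> A \<oplus> A \<otimes> N\<close> turned by the
  unit isomorphisms into the shape required for \<open>\<Sigma> = \<I>\<close>.\<close>

definition unit_anchor :: "'o \<Rightarrow> 'o \<Rightarrow> 'm \<Rightarrow> 'm" where
  "unit_anchor A N \<rho> = (\<ll>\<^sup>- A \<otimes>\<^sub>m \<langle>A\<rangle>) \<cdot> \<rho> \<cdot> (\<ll> N \<otimes>\<^sub>m \<ll> A)"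

definition unit_bracket :: "'o \<Rightarrow> 'o \<Rightarrow> 'm \<Rightarrow> 'm" where
  "unit_bracket A N b = \<ll>\<^sup>- (brk_sum A N) \<cdot> b \<cdot> (\<ll> N \<otimes>\<^sub>m \<ll> N)"

definition shift_dlr :: "'o \<Rightarrow> 'o \<Rightarrow> 'm \<Rightarrow> 'o \<Rightarrow> ('o, 'm) dlr \<Rightarrow> ('o, 'm) dlr" where
  "shift_dlr \<Sigma> T \<epsilon> A d =
     (let M = und d in
      \<lparr>und = \<Sigma> \<otimes>\<^sub>o M,
       lact = susp_lact \<Sigma> A M (lact d),
       ract = susp_ract \<Sigma> A M (ract d),
       anchor = unit_anchor A (\<Sigma> \<otimes>\<^sub>o M) (shift_anchor \<Sigma> T \<epsilon> A M (anchor d)),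
       bracket = unit_bracket A (\<Sigma> \<otimes>\<^sub>o M) (shift_bracket \<Sigma> A M (bracket d))\<rparr>)"

end

end

theory Submission
  imports Defs
begin

text \<open>Tensoring with the invertible object \<open>\<Sigma>\<close> is fully faithful, so an anchor \<open>\<rho>\<^bsub>M\<^esub>\<close> can be written
  uniquely as \<open>\<Sigma> \<otimes> \<rho>\<^bsub>\<Sigma>M\<^esub>\<close> preceded by the symmetry that moves the factor \<open>\<Sigma>\<close> of \<open>\<Sigma>A\<close> to the front, and
  \<open>\<rho>\<^bsub>\<Sigma>M\<^esub>\<close> is the shifted anchor. In string diagrams this \<open>\<Sigma>\<close> is a wire that passes transparently
  through all other arrows. Hence each axiom for \<open>\<Sigma>\<close> is the axiom for \<open>\<I>\<close> with such a wire added, and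
  the wire can be removed because \<open>\<Sigma> \<otimes> -\<close> is faithful. The diagrams are drawn in a strict
  category whose objects are lists of objects of \<open>C\<close>. A chart \<open>X \<cong> x\<^sub>1 \<otimes> \<dots> \<otimes> x\<^sub>n\<close> translates the
  arrows of \<open>C\<close> into it, turning associators and unit isomorphisms into identities. For
  essential surjectivity an object \<open>N\<close> is repr by the list of \<open>\<Sigma>\<close> and \<open>\<Sigma>\<^sup>- \<otimes> N\<close>, so that a
  structure on \<open>N\<close> is literally the shift of one on \<open>\<Sigma>\<^sup>- \<otimes> N\<close>.\<close>

section \<open>Strict symmetric monoidal calculus\<close>

text \<open>The obstacle is bookkeeping: the axioms mix several copies of \<Sigma>, associators,
  units and direct sums, while the argument follows a single strand. All equations are therefore
  gathered in one predicate \<open>dlr_axioms\<close> whose suspension \<open>S\<close> is a list;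
  the case of \<I> is \<open>S = []\<close>, not a second set of axioms. Shifting only regroups the
  source \<open>S @ M @ S @ M\<close> of the bracket. What changes is the source of the anchor,
  which loses the \<open>S\<close> in front of \<open>A\<close>, and the right component of the
  bracket, whose output \<open>S @ A @ M\<close> becomes \<open>A @ S @ M\<close>. In the bimodule
  laws, the anchor axioms and the compatibility of anchor and bracket, one of the two forms has an
  additional \<open>S\<close>, which faithfulness removes. The bracket axioms and the double Jacobi
  identity agree up to an invertible crossing. Fullness has a separate role: it supplies
  \<open>p0\<close> for a given anchor, and preimages of structures and morphisms. No coherence
  theorem for arbitrary bracketings is invoked, since objects are multiplied by concatenation and
  only the isomorphism \<open>app\<close> has to be shown associative and unital.\<close>

locale strict_smc =
  fixes obj :: "'x list \<Rightarrow> bool" and arr :: "'a \<Rightarrow> bool" and dom cod :: "'a \<Rightarrow> 'x list"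
    and cmp :: "'a \<Rightarrow> 'a \<Rightarrow> 'a" (infixr "\<star>" 70)
    and ten :: "'a \<Rightarrow> 'a \<Rightarrow> 'a" (infixr "\<box>" 75)
    and one :: "'x list \<Rightarrow> 'a" and sw :: "'x list \<Rightarrow> 'x list \<Rightarrow> 'a"
    and add :: "'a \<Rightarrow> 'a \<Rightarrow> 'a" (infixl "\<boxplus>" 65)
    and neg :: "'a \<Rightarrow> 'a" and zero :: "'x list \<Rightarrow> 'x list \<Rightarrow> 'a"
  assumes obj_Nil [simp]: "obj []"
    and obj_append [simp]: "obj (xs @ ys) \<longleftrightarrow> obj xs \<and> obj ys"
    and obj_dom [simp]: "arr F \<Longrightarrow> obj (dom F)"
    and obj_cod [simp]: "arr F \<Longrightarrow> obj (cod F)"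
    and dom_cmp [simp]: "dom (G \<star> F) = dom F"
    and cod_cmp [simp]: "cod (G \<star> F) = cod G"
    and dom_ten [simp]: "dom (F \<box> G) = dom F @ dom G"
    and cod_ten [simp]: "cod (F \<box> G) = cod F @ cod G"
    and dom_one [simp]: "dom (one xs) = xs"
    and cod_one [simp]: "cod (one xs) = xs"
    and dom_sw [simp]: "dom (sw xs ys) = xs @ ys"
    and cod_sw [simp]: "cod (sw xs ys) = ys @ xs"
    and dom_add [simp]: "dom (F \<boxplus> G) = dom F"
    and cod_add [simp]: "cod (F \<boxplus> G) = cod F"
    and dom_neg [simp]: "dom (neg F) = dom F"
    and cod_neg [simp]: "cod (neg F) = cod F"
    and dom_zero [simp]: "dom (zero xs ys) = xs"
    and cod_zero [simp]: "cod (zero xs ys) = ys"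
    and arr_cmp [simp]: "\<lbrakk>arr F; arr G; dom G = cod F\<rbrakk> \<Longrightarrow> arr (G \<star> F)"
    and arr_ten [simp]: "\<lbrakk>arr F; arr G\<rbrakk> \<Longrightarrow> arr (F \<box> G)"
    and arr_one [simp]: "obj xs \<Longrightarrow> arr (one xs)"
    and arr_sw [simp]: "\<lbrakk>obj xs; obj ys\<rbrakk> \<Longrightarrow> arr (sw xs ys)"
    and arr_add [simp]: "\<lbrakk>arr F; arr G; dom F = dom G; cod F = cod G\<rbrakk> \<Longrightarrow> arr (F \<boxplus> G)"
    and arr_neg [simp]: "arr F \<Longrightarrow> arr (neg F)"
    and arr_zero [simp]: "\<lbrakk>obj xs; obj ys\<rbrakk> \<Longrightarrow> arr (zero xs ys)"
    and cmp_assoc [simp]: "\<lbrakk>arr F; arr G; arr H; dom H = cod G; dom G = cod F\<rbrakk>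
      \<Longrightarrow> (H \<star> G) \<star> F = H \<star> (G \<star> F)"
    and cmp_one [simp]: "\<lbrakk>arr F; dom F = xs\<rbrakk> \<Longrightarrow> F \<star> one xs = F"
    and one_cmp [simp]: "\<lbrakk>arr F; cod F = xs\<rbrakk> \<Longrightarrow> one xs \<star> F = F"
    and ten_assoc [simp]: "\<lbrakk>arr F; arr G; arr H\<rbrakk> \<Longrightarrow> (F \<box> G) \<box> H = F \<box> (G \<box> H)"
    and one_ten_one [simp]: "\<lbrakk>obj xs; obj ys\<rbrakk> \<Longrightarrow> one xs \<box> one ys = one (xs @ ys)"
    and one_Nil_ten [simp]: "arr F \<Longrightarrow> one [] \<box> F = F"
    and ten_one_Nil [simp]: "arr F \<Longrightarrow> F \<box> one [] = F"
    and interchange: "\<lbrakk>arr F; arr G; arr F'; arr G'; dom G = cod F; dom G' = cod F'\<rbrakk>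
      \<Longrightarrow> (G \<box> G') \<star> (F \<box> F') = (G \<star> F) \<box> (G' \<star> F')"
    and sw_natural: "\<lbrakk>arr F; arr G; cod F = xs; cod G = ys\<rbrakk>
      \<Longrightarrow> sw xs ys \<star> (F \<box> G) = (G \<box> F) \<star> sw (dom F) (dom G)"
    and sw_sw [simp]: "\<lbrakk>obj xs; obj ys\<rbrakk> \<Longrightarrow> sw ys xs \<star> sw xs ys = one (xs @ ys)"
    and sw_append_right: "\<lbrakk>obj xs; obj ys; obj zs\<rbrakk>
      \<Longrightarrow> sw xs (ys @ zs) = (one ys \<box> sw xs zs) \<star> (sw xs ys \<box> one zs)"
    and sw_Nil_right [simp]: "obj xs \<Longrightarrow> sw xs [] = one xs"
    and cmp_add: "\<lbrakk>arr F; arr G; arr H; dom F = dom G; cod F = cod G; dom H = cod F\<rbrakk>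
      \<Longrightarrow> H \<star> (F \<boxplus> G) = (H \<star> F) \<boxplus> (H \<star> G)"
    and add_cmp: "\<lbrakk>arr F; arr G; arr H; dom F = dom G; cod F = cod G; dom F = cod H\<rbrakk>
      \<Longrightarrow> (F \<boxplus> G) \<star> H = (F \<star> H) \<boxplus> (G \<star> H)"
    and ten_add: "\<lbrakk>arr F; arr G; arr H; dom F = dom G; cod F = cod G\<rbrakk>
      \<Longrightarrow> H \<box> (F \<boxplus> G) = (H \<box> F) \<boxplus> (H \<box> G)"
    and cmp_neg: "\<lbrakk>arr F; arr H; dom H = cod F\<rbrakk> \<Longrightarrow> H \<star> neg F = neg (H \<star> F)"
    and neg_cmp: "\<lbrakk>arr F; arr H; dom F = cod H\<rbrakk> \<Longrightarrow> neg F \<star> H = neg (F \<star> H)"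
    and ten_neg: "\<lbrakk>arr F; arr H\<rbrakk> \<Longrightarrow> H \<box> neg F = neg (H \<box> F)"
    and cmp_zero [simp]: "\<lbrakk>arr F; obj xs; dom F = ys\<rbrakk> \<Longrightarrow> F \<star> zero xs ys = zero xs (cod F)"
    and zero_cmp [simp]: "\<lbrakk>arr F; obj ys; cod F = xs\<rbrakk> \<Longrightarrow> zero xs ys \<star> F = zero (dom F) ys"
    and add_zero [simp]: "\<lbrakk>arr F; dom F = xs; cod F = ys\<rbrakk> \<Longrightarrow> F \<boxplus> zero xs ys = F"
    and zero_add [simp]: "\<lbrakk>arr F; dom F = xs; cod F = ys\<rbrakk> \<Longrightarrow> zero xs ys \<boxplus> F = F"
    and ten_zero: "\<lbrakk>obj xs; obj ys; obj zs\<rbrakk> \<Longrightarrow> one zs \<box> zero xs ys = zero (zs @ xs) (zs @ ys)"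
begin

lemma sw_cancel [simp]:
  "\<lbrakk>arr H; obj xs; obj ys; cod H = xs @ ys\<rbrakk> \<Longrightarrow> sw ys xs \<star> (sw xs ys \<star> H) = H"
  by (simp flip: cmp_assoc)

lemma one_ten_one_ten [simp]:
  "\<lbrakk>obj xs; obj ys; arr F\<rbrakk> \<Longrightarrow> one xs \<box> one ys \<box> F = one (xs @ ys) \<box> F"
  by (simp flip: ten_assoc)

lemma iso_cancel_left:
  assumes "arr H" "arr H'" "arr F" "arr G" "cod F = dom H" "cod G = dom H" "dom H' = cod H"
    "H' \<star> H = one (dom H)"
  shows "H \<star> F = H \<star> G \<longleftrightarrow> F = G"
  using assms by (metis cmp_assoc one_cmp)

lemma iso_cancel_right:
  assumes "arr H" "arr H'" "arr F" "arr G" "dom F = cod H" "dom G = cod H" "cod H' = dom H"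
    "H \<star> H' = one (cod H)"
  shows "F \<star> H = G \<star> H \<longleftrightarrow> F = G"
  using assms by (metis cmp_assoc cmp_one)

lemma sw_Nil_left [simp]: "obj xs \<Longrightarrow> sw [] xs = one xs"
  using sw_sw[of xs "[]"] by simp

lemma ten_one_cmp:
  "\<lbrakk>arr F; arr G; obj xs; dom G = cod F\<rbrakk> \<Longrightarrow> (G \<box> one xs) \<star> (F \<box> one xs) = (G \<star> F) \<box> one xs"
  "\<lbrakk>arr F; arr G; obj xs; dom G = cod F\<rbrakk> \<Longrightarrow> (one xs \<box> G) \<star> (one xs \<box> F) = one xs \<box> (G \<star> F)"
  by (simp_all add: interchange)

text \<open>Only the hexagon for a split second argument is assumed. Its mirror image follows since
  both sides are inverse to \<open>sw zs (xs @ ys)\<close>.\<close>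

lemma sw_append_left:
  assumes [simp]: "obj xs" "obj ys" "obj zs"
  shows "sw (xs @ ys) zs = (sw xs zs \<box> one ys) \<star> (one xs \<box> sw ys zs)"
proof -
  let ?f = "(sw xs zs \<box> one ys) \<star> (one xs \<box> sw ys zs)"
  have inv: "?f \<star> sw zs (xs @ ys) = one (zs @ xs @ ys)"
    by (simp add: sw_append_right flip: cmp_assoc)
       (simp add: ten_one_cmp)
  have "sw (xs @ ys) zs = (?f \<star> sw zs (xs @ ys)) \<star> sw (xs @ ys) zs"
    by (subst inv) simp
  also have "\<dots> = ?f"
    by (subst cmp_assoc) simp_all
  finally show ?thesis .
qed

section \<open>A wire passing through a diagram\<close>

text \<open>\<open>F : as @ bs \<rightarrow> cs @ ds\<close> with an additional wire \<open>S\<close> that enters between \<open>as\<close> and \<open>bs\<close>,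
  crosses \<open>F\<close> and leaves between \<open>cs\<close> and \<open>ds\<close>.\<close>

definition ghost :: "'x list \<Rightarrow> 'x list \<Rightarrow> 'x list \<Rightarrow> 'x list \<Rightarrow> 'x list \<Rightarrow> 'a \<Rightarrow> 'a" where
  "ghost S as bs cs ds F = (sw S cs \<box> one ds) \<star> (one S \<box> F) \<star> (sw as S \<box> one bs)"

lemma dom_ghost [simp]: "dom (ghost S as bs cs ds F) = as @ S @ bs"
  and cod_ghost [simp]: "cod (ghost S as bs cs ds F) = cs @ S @ ds"
  and arr_ghost [simp]: "\<lbrakk>obj S; arr F; dom F = as @ bs; cod F = cs @ ds\<rbrakk> \<Longrightarrow> arr (ghost S as bs cs ds F)"
proof -
  assume "obj S" "arr F" "dom F = as @ bs" "cod F = cs @ ds"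
  moreover from this have "obj (as @ bs)" "obj (cs @ ds)"
    by (metis obj_dom, metis obj_cod)
  ultimately show "arr (ghost S as bs cs ds F)"
    by (simp add: ghost_def)
qed (simp_all add: ghost_def)

lemma sw_one_cancel:
  "\<lbrakk>arr H; obj xs; obj ys; obj zs; cod H = xs @ ys @ zs\<rbrakk>
    \<Longrightarrow> (sw ys xs \<box> one zs) \<star> ((sw xs ys \<box> one zs) \<star> H) = H"
  by (simp add: interchange flip: cmp_assoc)

text \<open>The crossing by which the wire leaves \<open>F\<close> cancels the one by which it
  enters \<open>G\<close>. Both must cut the middle list at the same place, which is why
  \<open>ghost\<close> carries the splittings of source and target as arguments.\<close>

lemma ghost_cmp:
  assumes [simp]: "obj S" "arr F" "dom F = as @ bs" "cod F = cs @ ds"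
    "arr G" "dom G = cs @ ds" "cod G = es @ fs"
  shows "ghost S cs ds es fs G \<star> ghost S as bs cs ds F = ghost S as bs es fs (G \<star> F)"
proof -
  have [simp]: "obj as" "obj bs" "obj cs" "obj ds" "obj es" "obj fs"
    using obj_dom[of F] obj_dom[of G] obj_cod[of G] by simp_all
  show ?thesis
    unfolding ghost_def by (simp add: sw_one_cancel flip: ten_one_cmp)
qed

lemma ghost_cmp_cmp:
  assumes "obj S" "arr F" "dom F = as @ bs" "cod F = cs @ ds"
    "arr G" "dom G = cs @ ds" "cod G = es @ fs" "arr H" "cod H = as @ S @ bs"
  shows "ghost S cs ds es fs G \<star> (ghost S as bs cs ds F \<star> H) = ghost S as bs es fs (G \<star> F) \<star> H"
  using assms by (simp flip: cmp_assoc add: ghost_cmp)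

lemma ghost_ten_one:
  assumes [simp]: "obj S" "arr F" "dom F = as @ bs" "cod F = cs @ ds" "obj ys"
  shows "ghost S as bs cs ds F \<box> one ys = ghost S as (bs @ ys) cs (ds @ ys) (F \<box> one ys)"
proof -
  have [simp]: "obj as" "obj bs" "obj cs" "obj ds"
    using obj_dom[of F] obj_cod[of F] by simp_all
  show ?thesis
    unfolding ghost_def by (simp flip: ten_one_cmp)
qed

lemma one_ten_ghost:
  assumes [simp]: "obj S" "arr F" "dom F = as @ bs" "cod F = cs @ ds" "obj xs"
  shows "one xs \<box> ghost S as bs cs ds F = ghost S (xs @ as) bs (xs @ cs) ds (one xs \<box> F)"
proof -
  have [simp]: "obj as" "obj bs" "obj cs" "obj ds"
    using obj_dom[of F] obj_cod[of F] by simp_all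
  \<comment> \<open>The wire crosses the idle strands \<open>xs\<close> on its way in and again on
    its way out; by interchange the two crossings meet and cancel.\<close>
  have "(sw S xs \<box> one (cs @ ds)) \<star> (one (S @ xs) \<box> F) \<star> (sw xs S \<box> one (as @ bs))
      = one (xs @ S) \<box> F"
    by (simp add: interchange)
  then have *: "(sw S xs \<box> one (cs @ ds)) \<star> (one (S @ xs) \<box> F) \<star> (sw xs S \<box> one (as @ bs)) \<star> H
      = (one (xs @ S) \<box> F) \<star> H" if "arr H" "cod H = xs @ S @ as @ bs" for H
    using that by (simp flip: cmp_assoc)
  show ?thesis
    unfolding ghost_def
    by (simp add: sw_append_left sw_append_right * flip: ten_one_cmp)
qed

lemma one_ten_eq_ghost:
  "\<lbrakk>obj S; arr F; dom F = bs; cod F = ds\<rbrakk> \<Longrightarrow> one S \<box> F = ghost S [] bs [] ds F"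
  unfolding ghost_def using obj_dom[of F] obj_cod[of F] by simp

text \<open>Naturality of the symmetry slides \<open>F\<close> through the wire, so a strand running
  straight between two boxes also passes through their product.\<close>

lemma ten_one_ten_eq_ghost:
  assumes [simp]: "obj S" "arr F" "dom F = as" "cod F = cs" "arr G" "dom G = bs" "cod G = ds"
  shows "F \<box> one S \<box> G = ghost S as bs cs ds (F \<box> G)"
proof -
  have [simp]: "obj as" "obj bs" "obj cs" "obj ds"
    using obj_dom[of F] obj_cod[of F] obj_dom[of G] obj_cod[of G] by simp_all
  have "(sw S cs \<box> one ds) \<star> ((one S \<box> F) \<box> G) = (F \<box> one S \<box> G) \<star> (sw S as \<box> one bs)"
    by (simp only: interchange obj_dom obj_cod arr_ten arr_one arr_sw assms dom_one cod_one dom_sw cod_sw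
      dom_ten cod_ten \<open>obj as\<close> \<open>obj bs\<close> \<open>obj cs\<close> \<open>obj ds\<close> sw_natural one_cmp cmp_one flip: ten_assoc)
  moreover have "ghost S as bs cs ds (F \<box> G)
      = ((sw S cs \<box> one ds) \<star> ((one S \<box> F) \<box> G)) \<star> (sw as S \<box> one bs)"
    unfolding ghost_def by simp
  ultimately show ?thesis
    by (simp add: interchange)
qed

text \<open>A bare crossing is a wire passing through an identity, with entry and exit on different
  sides of \<open>xs\<close>.\<close>

lemma sw_ten_one_eq_ghost:
  "\<lbrakk>obj S; obj xs; obj ys\<rbrakk> \<Longrightarrow> sw S xs \<box> one ys = ghost S [] (xs @ ys) xs ys (one (xs @ ys))"
  "\<lbrakk>obj S; obj xs; obj ys\<rbrakk> \<Longrightarrow> sw xs S \<box> one ys = ghost S xs ys [] (xs @ ys) (one (xs @ ys))"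
  unfolding ghost_def by simp_all

lemma ghost_add:
  assumes [simp]: "obj S" "arr F" "dom F = as @ bs" "cod F = cs @ ds" "arr G" "dom G = as @ bs" "cod G = cs @ ds"
  shows "ghost S as bs cs ds (F \<boxplus> G) = ghost S as bs cs ds F \<boxplus> ghost S as bs cs ds G"
proof -
  have [simp]: "obj as" "obj bs" "obj cs" "obj ds"
    using obj_dom[of F] obj_cod[of F] by simp_all
  show ?thesis
    unfolding ghost_def by (simp add: ten_add cmp_add add_cmp)
qed

text \<open>The hexagons cut the block at \<open>S\<close>. Each of the three resulting crossings is
  a \<open>ghost\<close>, and the diagrams inside compose to the symmetry of the block without
  \<open>S\<close>.\<close>

lemma sw_eq_ghost:
  assumes [simp]: "obj S" "obj xs" "obj ys" "obj zs"
  shows "sw xs (ys @ S @ zs) = ghost S (xs @ ys) zs ys (zs @ xs) (sw xs (ys @ zs))" (is ?r)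
    and "sw (ys @ S @ zs) xs = ghost S ys (zs @ xs) (xs @ ys) zs (sw (ys @ zs) xs)" (is ?l)
proof -
  have "sw xs (ys @ S @ zs) = (one (ys @ S) \<box> sw xs zs) \<star> (one ys \<box> sw xs S \<box> one zs) \<star> (sw xs ys \<box> one (S @ zs))"
    by (simp add: sw_append_right flip: ten_one_cmp)
  also have "\<dots> = (one ys \<box> one S \<box> sw xs zs) \<star> (one ys \<box> sw xs S \<box> one zs) \<star> (sw xs ys \<box> one S \<box> one zs)"
    by simp
  also have "\<dots> = ghost S (xs @ ys) zs ys (zs @ xs) (sw xs (ys @ zs))"
    by (subst sw_ten_one_eq_ghost, simp_all del: one_ten_one one_ten_one_ten
      add: ten_one_ten_eq_ghost[where as="xs @ ys" and cs = "ys @ xs"] ten_one_ten_eq_ghost[where as="ys" and cs = "ys"] one_ten_ghost ghost_cmp)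
     (simp add: sw_append_right ghost_cmp)
  finally show ?r .
  have "sw (ys @ S @ zs) xs = (sw ys xs \<box> one (S @ zs)) \<star> (one ys \<box> sw S xs \<box> one zs) \<star> (one (ys @ S) \<box> sw zs xs)"
    by (simp add: sw_append_left flip: ten_one_cmp)
  also have "\<dots> = (sw ys xs \<box> one S \<box> one zs) \<star> (one ys \<box> sw S xs \<box> one zs) \<star> (one ys \<box> one S \<box> sw zs xs)"
    by simp
  also have "\<dots> = ghost S ys (zs @ xs) (xs @ ys) zs (sw (ys @ zs) xs)"
    by (subst sw_ten_one_eq_ghost, simp_all del: one_ten_one one_ten_one_ten
      add: ten_one_ten_eq_ghost[where cs="xs @ ys" and as = "ys @ xs"] ten_one_ten_eq_ghost[where as="ys" and cs = "ys"] one_ten_ghost ghost_cmp)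
     (simp add: sw_append_left ghost_cmp)
  finally show ?l .
qed

definition faithful :: "'x list \<Rightarrow> bool" where
  "faithful S \<longleftrightarrow> (\<forall>F G. arr F \<longrightarrow> arr G \<longrightarrow> dom F = dom G \<longrightarrow> cod F = cod G \<longrightarrow>
     one S \<box> F = one S \<box> G \<longrightarrow> F = G)"

text \<open>The crossings at both ends are invertible, so only \<open>one S \<box> F\<close> and
  \<open>one S \<box> G\<close> have to be compared, and there faithfulness applies. This is the
  step that removes a wire from an equation.\<close>

lemma ghost_eq_iff:
  assumes "faithful S" and [simp]: "obj S" "arr F" "dom F = as @ bs" "cod F = cs @ ds"
    "arr G" "dom G = as @ bs" "cod G = cs @ ds"
  shows "ghost S as bs cs ds F = ghost S as bs cs ds G \<longleftrightarrow> F = G"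
proof -
  have [simp]: "obj as" "obj bs" "obj cs" "obj ds"
    using obj_dom[of F] obj_cod[of F] by simp_all
  have "ghost S as bs cs ds F = ghost S as bs cs ds G \<longleftrightarrow>
      (one S \<box> F) \<star> (sw as S \<box> one bs) = (one S \<box> G) \<star> (sw as S \<box> one bs)"
    unfolding ghost_def
    by (rule iso_cancel_left[where H' = "sw cs S \<box> one ds"]) (simp_all add: interchange)
  also have "\<dots> \<longleftrightarrow> one S \<box> F = one S \<box> G"
    by (rule iso_cancel_right[where H' = "sw S as \<box> one bs"]) (simp_all add: interchange)
  also have "\<dots> \<longleftrightarrow> F = G"
    using assms(1) by (auto simp: faithful_def)
  finally show ?thesis .
qed

text \<open>The bracket enters through its two components, so antisymmetry and each derivation rule
  become a pair of equations and direct sums disappear. The bimodule laws are included, since they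
  are shifted too.\<close>

definition dlr_axioms ::
  "'x list \<Rightarrow> 'x list \<Rightarrow> 'x list \<Rightarrow> 'a \<Rightarrow> 'a \<Rightarrow> 'a \<Rightarrow> 'a \<Rightarrow> 'a \<Rightarrow> 'a \<Rightarrow> bool" where
  "dlr_axioms S M A m l r p bl br \<longleftrightarrow>
     (let SM = S @ M; SA = S @ A;
          lM = (one S \<box> l) \<star> (sw A S \<box> one M); lA = (one S \<box> m) \<star> (sw A S \<box> one A);
          pt = neg ((one S \<box> sw A A) \<star> p \<star> sw SA SM) in
     (l \<star> (m \<box> one M) = l \<star> (one A \<box> l)) \<and>
     (r \<star> (r \<box> one A) = r \<star> (one M \<box> m)) \<and>
     (r \<star> (l \<box> one A) = l \<star> (one A \<box> r)) \<and>
     (p \<star> (lM \<box> one SA) = (one SA \<box> m) \<star> (sw A SA \<box> one A) \<star> (one A \<box> p)) \<and>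
     (p \<star> (one S \<box> r \<box> one SA) \<star> (one SM \<box> sw SA A)
        = (one S \<box> m \<box> one A) \<star> (one SA \<box> sw A A) \<star> (p \<box> one A)) \<and>
     (p \<star> (one (SM @ S) \<box> m) = ((one SA \<box> m) \<star> (p \<box> one A))
        \<boxplus> ((lA \<box> one A) \<star> (one A \<box> p) \<star> (sw (SM @ S) A \<box> one A))) \<and>
     (bl \<star> sw SM SM = neg ((one S \<box> sw A M) \<star> br)) \<and>
     (br \<star> sw SM SM = neg ((one S \<box> sw M A) \<star> bl)) \<and>
     (bl \<star> (one (SM @ S) \<box> l) = (lM \<box> one A) \<star> (one A \<box> bl) \<star> (sw (SM @ S) A \<box> one M)) \<and>
     (br \<star> (one (SM @ S) \<box> l) = ((one SA \<box> l) \<star> (p \<box> one M))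
        \<boxplus> ((lA \<box> one M) \<star> (one A \<box> br) \<star> (sw (SM @ S) A \<box> one M))) \<and>
     (bl \<star> (one (SM @ S) \<box> r) = ((one SM \<box> m) \<star> (bl \<box> one A))
        \<boxplus> ((one S \<box> r \<box> one A) \<star> (sw M S \<box> one (A @ A)) \<star> (one M \<box> p) \<star> (sw (SM @ S) M \<box> one A))) \<and>
     (br \<star> (one (SM @ S) \<box> r) = (one SA \<box> r) \<star> (br \<box> one A)) \<and>
     (((pt \<box> one A) \<star> (one SA \<box> bl))
        \<boxplus> ((one S \<box> sw (A @ A) A) \<star> (p \<box> one A) \<star> (one SM \<box> p) \<star> sw SA (SM @ SM))
        \<boxplus> ((one S \<box> sw A (A @ A)) \<star> (p \<box> one A) \<star> (one SM \<box> pt) \<star> sw (SA @ SM) SM)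
        = zero (SA @ SM @ SM) (SA @ A @ A)) \<and>
     (((bl \<box> one A) \<star> (one SM \<box> bl))
        \<boxplus> ((one S \<box> sw A (M @ A)) \<star> (br \<box> one A) \<star> (one SM \<box> bl) \<star> sw (SM @ SM) SM)
        \<boxplus> ((one S \<box> sw (A @ A) M) \<star> (p \<box> one M) \<star> (one SM \<box> br) \<star> sw SM (SM @ SM))
        = zero (SM @ SM @ SM) (SM @ A @ A)))"

end

section \<open>Comparing the axioms before and after the shift, one equation at a time\<close>

locale strict_dlr = strict_smc +
  fixes S M A and m l r p0 bl br
  assumes obj_SMA [simp]: "obj S" "obj M" "obj A"
    and faith: "faithful S"
    and arrs [simp]: "arr m" "arr l" "arr r" "arr p0" "arr bl" "arr br"
    and doms [simp]: "dom m = A @ A" "dom l = A @ M" "dom r = M @ A" "dom p0 = S @ M @ A"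
      "dom bl = S @ M @ S @ M" "dom br = S @ M @ S @ M"
    and cods [simp]: "cod m = A" "cod l = M" "cod r = M" "cod p0 = A @ A"
      "cod bl = S @ M @ A" "cod br = S @ A @ M"
begin

text \<open>The anchor is built from its shift \<open>p0\<close>, not conversely, so that its
  \<Sigma> is visible as a wire. For invertible \<open>S\<close> every arrow of this type has this
  form, by \<open>anchor_shift\<close>.\<close>

definition p where
  "p = (one S \<box> p0) \<star> (sw (S @ M) S \<box> one A)"

lemma arr_p [simp]: "arr p" "dom p = S @ M @ S @ A" "cod p = S @ A @ A"
  unfolding p_def by simp_all

text \<open>The wire is the second \<open>S\<close> of the source \<open>S @ M @ S @ A\<close>; it
  enters behind \<open>S @ M\<close> and leaves at the front. The first \<open>S\<close> is an input
  of \<open>p0\<close>.\<close>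

lemma p_eq: "p = ghost S (S @ M) A [] (A @ A) p0"
  unfolding p_def ghost_def by simp

definition br0 where
  "br0 = (sw S A \<box> one M) \<star> br"

lemma arr_br0 [simp]: "arr br0" "dom br0 = S @ M @ S @ M" "cod br0 = A @ S @ M"
  unfolding br0_def by simp_all

definition lS where
  "lS = (one S \<box> l) \<star> (sw A S \<box> one M)"

lemma arr_lS [simp]: "arr lS" "dom lS = A @ S @ M" "cod lS = S @ M"
  unfolding lS_def by simp_all

lemma lS_eq: "lS = ghost S A M [] M l"
  unfolding lS_def ghost_def by simp

definition rS where
  "rS = one S \<box> r"

lemma arr_rS [simp]: "arr rS" "dom rS = S @ M @ A" "cod rS = S @ M"
  unfolding rS_def by simp_all

lemma rS_eq: "rS = ghost S [] (M @ A) [] M r"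
  unfolding rS_def by (simp add: one_ten_eq_ghost)

lemma lA_eq: "(one S \<box> m) \<star> (sw A S \<box> one A) = ghost S A A [] A m"
  unfolding ghost_def by simp

text \<open>The method of the lemmas below: write every box as a \<open>ghost\<close> with matching
  entry and exit points, merge each side into a single \<open>ghost\<close> by
  \<open>ghost_simps\<close>, and strip it with \<open>ghost_iff\<close>.\<close>

lemmas ghost_simps = ghost_cmp ghost_cmp_cmp ghost_ten_one one_ten_ghost
lemmas ghost_iff = ghost_eq_iff[OF faith]

text \<open>In the bimodule laws it is the shifted form that carries the additional wire, namely the
  \<open>S\<close> of the module \<open>S @ M\<close>.\<close>

lemma bimodule_lS: "lS \<star> (m \<box> one (S @ M)) = lS \<star> (one A \<box> lS) \<longleftrightarrow> l \<star> (m \<box> one M) = l \<star> (one A \<box> l)"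
proof -
  have "m \<box> one (S @ M) = ghost S (A @ A) M A M (m \<box> one M)"
    using ten_one_ten_eq_ghost[of S m "A @ A" A "one M" M M] by simp
  then show ?thesis
    unfolding lS_eq by (simp add: ghost_simps ghost_iff)
qed

lemma bimodule_rS: "rS \<star> (rS \<box> one A) = rS \<star> (one (S @ M) \<box> m) \<longleftrightarrow> r \<star> (r \<box> one A) = r \<star> (one M \<box> m)"
proof -
  have "one (S @ M) \<box> m = ghost S [] (M @ A @ A) [] (M @ A) (one M \<box> m)"
    using one_ten_eq_ghost[of S "one M \<box> m"] by simp
  then show ?thesis
    unfolding rS_eq by (simp add: ghost_simps ghost_iff)
qed

lemma bimodule_lS_rS: "rS \<star> (lS \<box> one A) = lS \<star> (one A \<box> rS) \<longleftrightarrow> r \<star> (l \<box> one A) = l \<star> (one A \<box> r)"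
  unfolding lS_eq rS_eq by (simp add: ghost_simps ghost_iff)

text \<open>In the anchor axioms the wire to be removed is the \<open>S\<close> in front of the
  second input \<open>A\<close>; the one in front of \<open>M\<close> stays, inside
  \<open>lS\<close> and \<open>rS\<close>. Thus the symmetry past \<open>S @ A\<close>, here and in
  the right action, leaves only \<open>sw A A\<close>.\<close>

lemma anchor_left_linear:
  "p \<star> (lS \<box> one (S @ A)) = (one (S @ A) \<box> m) \<star> (sw A (S @ A) \<box> one A) \<star> (one A \<box> p) \<longleftrightarrow>
   p0 \<star> (lS \<box> one A) = (one A \<box> m) \<star> (sw A A \<box> one A) \<star> (one A \<box> p0)"
proof -
  have 1: "lS \<box> one (S @ A) = ghost S (A @ S @ M) A (S @ M) A (lS \<box> one A)"
    using ten_one_ten_eq_ghost[of S lS "A @ S @ M" "S @ M" "one A" A A] by simp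
  have 2: "one (S @ A) \<box> m = ghost S [] (A @ A @ A) [] (A @ A) (one A \<box> m)"
    using one_ten_eq_ghost[of S "one A \<box> m"] by simp
  have 3: "sw A (S @ A) = ghost S A A [] (A @ A) (sw A A)"
    using sw_eq_ghost(1)[of S A "[]" A] by simp
  show ?thesis
    unfolding 1 2 3 p_eq by (simp add: ghost_simps ghost_iff)
qed

lemma anchor_right_linear:
  "p \<star> (rS \<box> one (S @ A)) \<star> (one (S @ M) \<box> sw (S @ A) A)
     = (one S \<box> m \<box> one A) \<star> (one (S @ A) \<box> sw A A) \<star> (p \<box> one A) \<longleftrightarrow>
   p0 \<star> (rS \<box> one A) \<star> (one (S @ M) \<box> sw A A)
     = (m \<box> one A) \<star> (one A \<box> sw A A) \<star> (p0 \<box> one A)"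
proof -
  have 1: "rS \<box> one (S @ A) = ghost S (S @ M @ A) A (S @ M) A (rS \<box> one A)"
    using ten_one_ten_eq_ghost[of S rS "S @ M @ A" "S @ M" "one A" A A] by simp
  have 2: "one (S @ A) \<box> sw A A = ghost S [] (A @ A @ A) [] (A @ A @ A) (one A \<box> sw A A)"
    using one_ten_eq_ghost[of S "one A \<box> sw A A"] by simp
  have 3: "sw (S @ A) A = ghost S [] (A @ A) A A (sw A A)"
    using sw_eq_ghost(2)[of S A "[]" A] by simp
  have 4: "one S \<box> m \<box> one A = ghost S [] (A @ A @ A) [] (A @ A) (m \<box> one A)"
    using one_ten_eq_ghost[of S "m \<box> one A"] by simp
  show ?thesis
    unfolding 1 2 3 4 p_eq by (simp add: ghost_simps ghost_iff)
qed

text \<open>All summands have the wire enter behind \<open>S @ M\<close> and leave at the front, so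
  by \<open>ghost_add\<close> the sum is again one \<open>ghost\<close>.\<close>

lemma anchor_derivation:
  "p \<star> (one (S @ M @ S) \<box> m) = ((one (S @ A) \<box> m) \<star> (p \<box> one A))
     \<boxplus> ((((one S \<box> m) \<star> (sw A S \<box> one A)) \<box> one A) \<star> (one A \<box> p) \<star> (sw (S @ M @ S) A \<box> one A)) \<longleftrightarrow>
   p0 \<star> (one (S @ M) \<box> m) = ((one A \<box> m) \<star> (p0 \<box> one A))
     \<boxplus> ((m \<box> one A) \<star> (one A \<box> p0) \<star> (sw (S @ M) A \<box> one A))"
proof -
  have 1: "one (S @ M @ S) \<box> m = ghost S (S @ M) (A @ A) (S @ M) A (one (S @ M) \<box> m)"
    using ten_one_ten_eq_ghost[of S "one (S @ M)" "S @ M" "S @ M" m "A @ A" A] by simp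
  have 2: "one (S @ A) \<box> m = ghost S [] (A @ A @ A) [] (A @ A) (one A \<box> m)"
    using one_ten_eq_ghost[of S "one A \<box> m"] by simp
  have 3: "sw (S @ M @ S) A = ghost S (S @ M) A (A @ S @ M) [] (sw (S @ M) A)"
    using sw_eq_ghost(2)[of S A "S @ M" "[]"] by simp
  show ?thesis
    unfolding 1 2 3 p_eq lA_eq by (simp add: ghost_simps ghost_iff flip: ghost_add)
qed

text \<open>Carrying \<open>A\<close> past \<open>S @ M\<close> begins by undoing the crossing built
  into \<open>br0\<close>; what remains is the symmetry of \<open>A\<close> and \<open>M\<close>
  behind \<open>S\<close>.\<close>

lemma swap_br: "sw A (S @ M) \<star> br0 = (one S \<box> sw A M) \<star> br"
  unfolding br0_def by (simp add: sw_append_right sw_one_cancel)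

lemma bracket_antisym_l:
  "bl \<star> sw (S @ M) (S @ M) = neg ((one S \<box> sw A M) \<star> br) \<longleftrightarrow>
   bl \<star> sw (S @ M) (S @ M) = neg (sw A (S @ M) \<star> br0)"
  by (simp add: swap_br)

lemma br_cancel:
  assumes "arr F" "arr G" "cod F = S @ A @ M" "cod G = S @ A @ M"
  shows "(sw S A \<box> one M) \<star> F = (sw S A \<box> one M) \<star> G \<longleftrightarrow> F = G"
  by (rule iso_cancel_left[where H' = "sw A S \<box> one M"]) (simp_all add: assms interchange)

lemma bracket_antisym_r:
  "br \<star> sw (S @ M) (S @ M) = neg ((one S \<box> sw M A) \<star> bl) \<longleftrightarrow>
   br0 \<star> sw (S @ M) (S @ M) = neg (sw (S @ M) A \<star> bl)"
proof -
  have "br0 \<star> sw (S @ M) (S @ M) = (sw S A \<box> one M) \<star> (br \<star> sw (S @ M) (S @ M))"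
    unfolding br0_def by simp
  moreover have "neg (sw (S @ M) A \<star> bl) = (sw S A \<box> one M) \<star> neg ((one S \<box> sw M A) \<star> bl)"
    by (simp add: sw_append_left cmp_neg)
  ultimately show ?thesis
    by (simp add: br_cancel)
qed

text \<open>The left derivation rule lives on \<open>S @ M @ S @ A @ M\<close> before the shift and
  on \<open>S @ M @ A @ S @ M\<close> after it. This crossing identifies the two sources.\<close>

lemma shuffle_eq_ghost:
  "one (S @ M) \<box> sw S A \<box> one M = ghost S (S @ M) (A @ M) (S @ M @ A) M (one (S @ M @ A @ M))"
  using one_ten_ghost[of S "one (A @ M)" "[]" "A @ M" A M "S @ M"] by (simp add: sw_ten_one_eq_ghost)

lemma shuffle_cancel:
  assumes "arr F" "arr G" "dom F = S @ M @ A @ S @ M" "dom G = S @ M @ A @ S @ M"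
  shows "F \<star> (one (S @ M) \<box> sw S A \<box> one M) = G \<star> (one (S @ M) \<box> sw S A \<box> one M) \<longleftrightarrow> F = G"
  by (rule iso_cancel_right[where H' = "one (S @ M) \<box> sw A S \<box> one M"])
    (simp_all add: assms interchange)

lemma lS_shuffle: "(one (S @ M) \<box> lS) \<star> (one (S @ M) \<box> sw S A \<box> one M) = one (S @ M @ S) \<box> l"
proof -
  have "lS \<star> (sw S A \<box> one M) = one S \<box> l"
    unfolding lS_def by (simp add: interchange)
  then show ?thesis
    by (simp add: ten_one_cmp flip: one_ten_one_ten)
qed

lemma swap_shuffle:
  "(sw (S @ M) A \<box> one (S @ M)) \<star> (one (S @ M) \<box> sw S A \<box> one M) = sw (S @ M @ S) A \<box> one M"
  using sw_append_left[of "S @ M" S A] by (simp flip: ten_one_cmp)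

lemma bracket_left_l:
  "bl \<star> (one (S @ M @ S) \<box> l) = (lS \<box> one A) \<star> (one A \<box> bl) \<star> (sw (S @ M @ S) A \<box> one M) \<longleftrightarrow>
   bl \<star> (one (S @ M) \<box> lS) = (lS \<box> one A) \<star> (one A \<box> bl) \<star> (sw (S @ M) A \<box> one (S @ M))"
proof -
  have "bl \<star> (one (S @ M @ S) \<box> l) = (bl \<star> (one (S @ M) \<box> lS)) \<star> (one (S @ M) \<box> sw S A \<box> one M)"
    by (simp add: lS_shuffle)
  moreover have "(lS \<box> one A) \<star> (one A \<box> bl) \<star> (sw (S @ M @ S) A \<box> one M)
      = ((lS \<box> one A) \<star> (one A \<box> bl) \<star> (sw (S @ M) A \<box> one (S @ M))) \<star> (one (S @ M) \<box> sw S A \<box> one M)"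
    by (simp add: swap_shuffle)
  ultimately show ?thesis
    by (simp only:) (rule shuffle_cancel; simp)
qed

text \<open>Both ends change here: the source by the shuffle \<open>?H\<close>, the target by the
  crossing \<open>?K\<close> inside \<open>br0\<close>. Each shifted term after \<open>?H\<close>
  equals \<open>?K\<close> after the corresponding original term, and both crossings are
  invertible.\<close>

lemma bracket_left_r:
  "br \<star> (one (S @ M @ S) \<box> l) = ((one (S @ A) \<box> l) \<star> (p \<box> one M))
     \<boxplus> ((((one S \<box> m) \<star> (sw A S \<box> one A)) \<box> one M) \<star> (one A \<box> br) \<star> (sw (S @ M @ S) A \<box> one M)) \<longleftrightarrow>
   br0 \<star> (one (S @ M) \<box> lS) = ((one A \<box> lS) \<star> (p0 \<box> one (S @ M)))
     \<boxplus> ((m \<box> one (S @ M)) \<star> (one A \<box> br0) \<star> (sw (S @ M) A \<box> one (S @ M)))"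
  (is "?L = ?T1 \<boxplus> ?T2 \<longleftrightarrow> ?N = ?U1 \<boxplus> ?U2")
proof -
  let ?H = "one (S @ M) \<box> sw S A \<box> one M" and ?K = "sw S A \<box> one M"
  have L: "?N \<star> ?H = ?K \<star> ?L"
    by (simp add: lS_shuffle) (simp add: br0_def)
  have 1: "p0 \<box> one (S @ M) = ghost S (S @ M @ A) M (A @ A) M (p0 \<box> one M)"
    using ten_one_ten_eq_ghost[of S p0 "S @ M @ A" "A @ A" "one M" M M] by simp
  have 2: "one (S @ A) \<box> l = ghost S [] (A @ A @ M) [] (A @ M) (one A \<box> l)"
    using one_ten_eq_ghost[of S "one A \<box> l"] by simp
  have T1: "?U1 \<star> ?H = ?K \<star> ?T1"
    unfolding 1 2 p_eq lS_eq shuffle_eq_ghost sw_ten_one_eq_ghost(1)[OF obj_SMA(1,3,2)]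
    by (simp add: ghost_simps)
  have 3: "m \<box> one (S @ M) = ghost S (A @ A) M A M (m \<box> one M)"
    using ten_one_ten_eq_ghost[of S m "A @ A" A "one M" M M] by simp
  \<comment> \<open>The \<open>S\<close> that \<open>br0\<close> has moved behind \<open>A\<close>
    may be brought to the front after the multiplication instead of before it; the latter is the
    suspended left action on \<open>S @ A\<close>.\<close>
  have "(m \<box> one (S @ M)) \<star> (one A \<box> ?K) = ?K \<star> (((one S \<box> m) \<star> (sw A S \<box> one A)) \<box> one M)"
    unfolding 3 lA_eq sw_ten_one_eq_ghost(1)[OF obj_SMA(1,3,2)]
    by (simp add: ghost_simps)
  then have 4: "(m \<box> one (S @ M)) \<star> (one A \<box> ?K) \<star> F = ?K \<star> (((one S \<box> m) \<star> (sw A S \<box> one A)) \<box> one M) \<star> F"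
    if "arr F" "cod F = A @ S @ A @ M" for F
    using that by (simp flip: cmp_assoc)
  have 5: "one A \<box> br0 = (one A \<box> ?K) \<star> (one A \<box> br)"
    unfolding br0_def by (simp add: interchange)
  have T2: "?U2 \<star> ?H = ?K \<star> ?T2"
    by (simp add: swap_shuffle 5 4)
  have "?L = ?T1 \<boxplus> ?T2 \<longleftrightarrow> ?K \<star> ?L = ?K \<star> (?T1 \<boxplus> ?T2)"
    by (rule br_cancel[symmetric]) simp_all
  also have "?K \<star> (?T1 \<boxplus> ?T2) = (?U1 \<boxplus> ?U2) \<star> ?H"
    by (subst cmp_add) (simp_all add: T1 T2 add_cmp del: cmp_assoc)
  also have "?K \<star> ?L = (?U1 \<boxplus> ?U2) \<star> ?H \<longleftrightarrow> ?N = ?U1 \<boxplus> ?U2"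
    unfolding L[symmetric] by (rule shuffle_cancel) simp_all
  finally show ?thesis .
qed

text \<open>Only the anchor term differs. The wire of \<open>p\<close> is the \<open>S\<close> of
  the second input, and it ends in front of the strand \<open>M\<close> of that input. So the two
  travel together as \<open>S @ M\<close>, past the first input, and \<open>p0\<close> acts beside
  them.\<close>

lemma bracket_right_l:
  "bl \<star> (one (S @ M @ S) \<box> r) = ((one (S @ M) \<box> m) \<star> (bl \<box> one A))
     \<boxplus> ((rS \<box> one A) \<star> (sw M S \<box> one (A @ A)) \<star> (one M \<box> p) \<star> (sw (S @ M @ S) M \<box> one A)) \<longleftrightarrow>
   bl \<star> (one (S @ M) \<box> rS) = ((one (S @ M) \<box> m) \<star> (bl \<box> one A))
     \<boxplus> ((rS \<box> one A) \<star> (one (S @ M) \<box> p0) \<star> (sw (S @ M) (S @ M) \<box> one A))"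
proof -
  have 1: "sw (S @ M @ S) M = ghost S (S @ M) M (M @ S @ M) [] (sw (S @ M) M)"
    using sw_eq_ghost(2)[of S M "S @ M" "[]"] by simp
  have 2: "one (S @ M) \<box> p0 = ghost S [] (M @ S @ M @ A) [] (M @ A @ A) (one M \<box> p0)"
    using one_ten_eq_ghost[of S "one M \<box> p0"] by simp
  have 3: "sw (S @ M) (S @ M) = ghost S (S @ M) M [] (M @ S @ M) (sw (S @ M) M)"
    using sw_eq_ghost(1)[of S "S @ M" "[]" M] by simp
  have "(sw M S \<box> one (A @ A)) \<star> (one M \<box> p) \<star> (sw (S @ M @ S) M \<box> one A)
      = (one (S @ M) \<box> p0) \<star> (sw (S @ M) (S @ M) \<box> one A)"
    unfolding 1 2 3 p_eq by (subst sw_ten_one_eq_ghost(2)) (simp_all add: ghost_simps)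
  then show ?thesis
    by (simp add: rS_def)
qed

lemma bracket_right_r:
  "br \<star> (one (S @ M @ S) \<box> r) = (one (S @ A) \<box> r) \<star> (br \<box> one A) \<longleftrightarrow>
   br0 \<star> (one (S @ M) \<box> rS) = (one A \<box> rS) \<star> (br0 \<box> one A)"
proof -
  have 1: "(one A \<box> rS) \<star> (sw S A \<box> one (M @ A)) = (sw S A \<box> one M) \<star> (one (S @ A) \<box> r)"
    by (simp add: rS_def interchange)
  have "(one A \<box> rS) \<star> (br0 \<box> one A) = ((one A \<box> rS) \<star> (sw S A \<box> one (M @ A))) \<star> (br \<box> one A)"
    unfolding br0_def by (simp flip: ten_one_cmp)
  also have "\<dots> = (sw S A \<box> one M) \<star> ((one (S @ A) \<box> r) \<star> (br \<box> one A))"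
    unfolding 1 by simp
  finally have "(one A \<box> rS) \<star> (br0 \<box> one A) = (sw S A \<box> one M) \<star> ((one (S @ A) \<box> r) \<star> (br \<box> one A))" .
  moreover have "br0 \<star> (one (S @ M) \<box> rS) = (sw S A \<box> one M) \<star> (br \<star> (one (S @ M @ S) \<box> r))"
    unfolding br0_def rS_def by simp
  ultimately show ?thesis
    by (simp add: br_cancel)
qed

definition pt0 where
  "pt0 = neg (sw A A \<star> p0 \<star> sw A (S @ M))"

lemma arr_pt0 [simp]: "arr pt0" "dom pt0 = A @ S @ M" "cod pt0 = A @ A"
  unfolding pt0_def by simp_all

text \<open>With its arguments exchanged, the anchor has the wire in front at both ends, so no
  crossing with \<open>S\<close> remains.\<close>

lemma pt_eq: "neg ((one S \<box> sw A A) \<star> p \<star> sw (S @ A) (S @ M)) = one S \<box> pt0"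
proof -
  have 1: "sw (S @ A) (S @ M) = ghost S [] (A @ S @ M) (S @ M) A (sw A (S @ M))"
    using sw_eq_ghost(2)[of S "S @ M" "[]" A] by simp
  have "(one S \<box> sw A A) \<star> p \<star> sw (S @ A) (S @ M) = one S \<box> (sw A A \<star> p0 \<star> sw A (S @ M))"
    unfolding 1 p_eq by (simp add: one_ten_eq_ghost[of S] ghost_simps)
  then show ?thesis
    by (simp add: pt0_def ten_neg)
qed

lemma one_ten_eq_zero_iff:
  assumes "arr F" "dom F = xs" "cod F = ys" "obj xs" "obj ys"
  shows "one S \<box> F = zero (S @ xs) (S @ ys) \<longleftrightarrow> F = zero xs ys"
  using faith[unfolded faithful_def, rule_format, of F "zero xs ys"] assms ten_zero[of xs ys S]
  by fastforce

text \<open>In all three terms the \<open>S\<close> of the first input, which stands in front, ends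
  in front of the output. Hence the sum is \<open>one S\<close> tensored with the shifted sum, and
  faithfulness compares it with zero.\<close>

lemma anchor_bracket_compat:
  "(((one S \<box> pt0) \<box> one A) \<star> (one (S @ A) \<box> bl))
     \<boxplus> ((one S \<box> sw (A @ A) A) \<star> (p \<box> one A) \<star> (one (S @ M) \<box> p) \<star> sw (S @ A) (S @ M @ S @ M))
     \<boxplus> ((one S \<box> sw A (A @ A)) \<star> (p \<box> one A) \<star> (one (S @ M) \<box> one S \<box> pt0) \<star> sw (S @ A @ S @ M) (S @ M))
     = zero (S @ A @ S @ M @ S @ M) (S @ A @ A @ A) \<longleftrightarrow>
   ((pt0 \<box> one A) \<star> (one A \<box> bl))
     \<boxplus> (sw (A @ A) A \<star> (p0 \<box> one A) \<star> (one (S @ M) \<box> p0) \<star> sw A (S @ M @ S @ M))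
     \<boxplus> (sw A (A @ A) \<star> (p0 \<box> one A) \<star> (one (S @ M) \<box> pt0) \<star> sw (A @ S @ M) (S @ M))
     = zero (A @ S @ M @ S @ M) (A @ A @ A)"
  (is "?T1 \<boxplus> ?T2 \<boxplus> ?T3 = _ \<longleftrightarrow> ?U1 \<boxplus> ?U2 \<boxplus> ?U3 = _")
proof -
  have 1: "?T1 = one S \<box> ?U1"
    by (simp flip: ten_one_cmp)
  have 2: "sw (S @ A) (S @ M @ S @ M) = ghost S [] (A @ S @ M @ S @ M) (S @ M @ S @ M) A (sw A (S @ M @ S @ M))"
    using sw_eq_ghost(2)[of S "S @ M @ S @ M" "[]" A] by simp
  have 3: "sw (S @ A @ S @ M) (S @ M) = ghost S [] (A @ S @ M @ S @ M) (S @ M) (A @ S @ M) (sw (A @ S @ M) (S @ M))"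
    using sw_eq_ghost(2)[of S "S @ M" "[]" "A @ S @ M"] by simp
  have 4: "one (S @ M) \<box> one S \<box> pt0 = ghost S (S @ M) (A @ S @ M) (S @ M) (A @ A) (one (S @ M) \<box> pt0)"
    using ten_one_ten_eq_ghost[of S "one (S @ M)" "S @ M" "S @ M" pt0] by simp
  have 5: "?T2 = one S \<box> ?U2"
    unfolding 2 p_eq by (simp add: one_ten_eq_ghost[of S] ghost_simps)
  have 6: "?T3 = one S \<box> ?U3"
    unfolding 3 4 p_eq by (simp add: one_ten_eq_ghost[of S] ghost_simps)
  have "?T1 \<boxplus> ?T2 \<boxplus> ?T3 = one S \<box> (?U1 \<boxplus> ?U2 \<boxplus> ?U3)"
    unfolding 1 5 6 by (simp add: ten_add)
  then show ?thesis
    by (simp only:) (rule one_ten_eq_zero_iff; simp)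
qed

text \<open>No wire is removed: the sources \<open>S @ M @ S @ M @ S @ M\<close> and targets
  \<open>S @ M @ A @ A\<close> are the same, and the two expressions agree term by term.\<close>

lemma double_jacobi:
  "((bl \<box> one A) \<star> (one (S @ M) \<box> bl))
     \<boxplus> ((one S \<box> sw A (M @ A)) \<star> (br \<box> one A) \<star> (one (S @ M) \<box> bl) \<star> sw (S @ M @ S @ M) (S @ M))
     \<boxplus> ((one S \<box> sw (A @ A) M) \<star> (p \<box> one M) \<star> (one (S @ M) \<box> br) \<star> sw (S @ M) (S @ M @ S @ M))
   = ((bl \<box> one A) \<star> (one (S @ M) \<box> bl))
     \<boxplus> (sw A (S @ M @ A) \<star> (br0 \<box> one A) \<star> (one (S @ M) \<box> bl) \<star> sw (S @ M @ S @ M) (S @ M))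
     \<boxplus> (sw (A @ A) (S @ M) \<star> (p0 \<box> one (S @ M)) \<star> (one (S @ M) \<box> br0) \<star> sw (S @ M) (S @ M @ S @ M))"
proof -
  have "sw A (S @ M @ A) \<star> (br0 \<box> one A) = (one S \<box> sw A (M @ A)) \<star> (br \<box> one A)"
    using sw_append_right[of A S "M @ A"]
    by (simp add: br0_def sw_one_cancel flip: ten_one_cmp)
  then have 1: "sw A (S @ M @ A) \<star> (br0 \<box> one A) \<star> F = (one S \<box> sw A (M @ A)) \<star> (br \<box> one A) \<star> F"
    if "arr F" "cod F = S @ M @ S @ M @ A" for F
    using that by (simp flip: cmp_assoc)
  have 2: "p0 \<box> one (S @ M) = ghost S (S @ M @ A) M (A @ A) M (p0 \<box> one M)"
    using ten_one_ten_eq_ghost[of S p0 "S @ M @ A" "A @ A" "one M" M M] by simp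
  have 3: "sw (A @ A) (S @ M) = ghost S (A @ A) M [] (M @ A @ A) (sw (A @ A) M)"
    using sw_eq_ghost(1)[of S "A @ A" "[]" M] by simp
  \<comment> \<open>The crossing contributed by \<open>br0\<close> moves the \<open>S\<close> of its
    output behind the input of \<open>p0\<close>; the last symmetry returns it to the front.
    Together they make it the wire of \<open>p\<close>.\<close>
  have "sw (A @ A) (S @ M) \<star> (p0 \<box> one (S @ M)) \<star> (one (S @ M) \<box> sw S A \<box> one M)
      = (one S \<box> sw (A @ A) M) \<star> (p \<box> one M)"
    unfolding 2 3 p_eq shuffle_eq_ghost by (simp add: one_ten_eq_ghost[of S] ghost_simps)
  then have 4: "sw (A @ A) (S @ M) \<star> (p0 \<box> one (S @ M)) \<star> (one (S @ M) \<box> sw S A \<box> one M) \<star> F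
      = (one S \<box> sw (A @ A) M) \<star> (p \<box> one M) \<star> F" if "arr F" "cod F = S @ M @ S @ A @ M" for F
    using that by (simp flip: cmp_assoc)
  have 5: "one (S @ M) \<box> br0 = (one (S @ M) \<box> sw S A \<box> one M) \<star> (one (S @ M) \<box> br)"
    unfolding br0_def by (simp flip: ten_one_cmp)
  show ?thesis
    by (simp add: 1 4 5)
qed

text \<open>The conjuncts correspond one to one. With \<open>[]\<close> as suspension the crossings
  with it are identities and simplify away.\<close>

theorem dlr_axioms_shift:
  "dlr_axioms S M A m l r p bl br \<longleftrightarrow> dlr_axioms [] (S @ M) A m lS rS p0 bl br0"
  unfolding dlr_axioms_def Let_def
  apply (intro arg_cong2[where f = "(\<and>)"])
  subgoal using bimodule_lS by simp
  subgoal using bimodule_rS by simp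
  subgoal using bimodule_lS_rS by simp
  subgoal using anchor_left_linear by (simp flip: lS_def)
  subgoal using anchor_right_linear by (simp add: rS_def)
  subgoal using anchor_derivation by simp
  subgoal using bracket_antisym_l by simp
  subgoal using bracket_antisym_r by simp
  subgoal using bracket_left_l by (simp flip: lS_def)
  subgoal using bracket_left_r by simp
  subgoal using bracket_right_l by (simp add: rS_def)
  subgoal using bracket_right_r by simp
  subgoal using anchor_bracket_compat by (simp add: pt_eq flip: pt0_def)
  subgoal using double_jacobi by simp
  done

end

section \<open>Arrows into a suspended direct sum\<close>

locale strict_biproduct = strict_smc +
  fixes S X Y P and i1 i2 p1 p2
  assumes objs [simp]: "obj S" "obj X" "obj Y" "obj P"
    and arrs [simp]: "arr i1" "arr i2" "arr p1" "arr p2"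
    and doms [simp]: "dom i1 = X" "dom i2 = Y" "dom p1 = P" "dom p2 = P"
    and cods [simp]: "cod i1 = P" "cod i2 = P" "cod p1 = X" "cod p2 = Y"
    and p_i: "p1 \<star> i1 = one X" "p2 \<star> i2 = one Y" "p1 \<star> i2 = zero Y X" "p2 \<star> i1 = zero X Y"
    and i_p: "(i1 \<star> p1) \<boxplus> (i2 \<star> p2) = one P"
begin

lemma p_i_cmp [simp]:
  "\<lbrakk>arr F; cod F = X\<rbrakk> \<Longrightarrow> p1 \<star> i1 \<star> F = F"
  "\<lbrakk>arr F; cod F = Y\<rbrakk> \<Longrightarrow> p2 \<star> i2 \<star> F = F"
  "\<lbrakk>arr F; cod F = Y\<rbrakk> \<Longrightarrow> p1 \<star> i2 \<star> F = zero (dom F) X"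
  "\<lbrakk>arr F; cod F = X\<rbrakk> \<Longrightarrow> p2 \<star> i1 \<star> F = zero (dom F) Y"
  by (simp_all add: p_i flip: cmp_assoc)

lemma Sp_Si [simp]:
  "(one S \<box> p1) \<star> (one S \<box> i1) = one (S @ X)"
  "(one S \<box> p2) \<star> (one S \<box> i2) = one (S @ Y)"
  "(one S \<box> p1) \<star> (one S \<box> i2) = zero (S @ Y) (S @ X)"
  "(one S \<box> p2) \<star> (one S \<box> i1) = zero (S @ X) (S @ Y)"
  by (simp_all add: ten_one_cmp p_i ten_zero)

lemma Sp_Si_cmp [simp]:
  "\<lbrakk>arr F; cod F = S @ X\<rbrakk> \<Longrightarrow> (one S \<box> p1) \<star> (one S \<box> i1) \<star> F = F"
  "\<lbrakk>arr F; cod F = S @ Y\<rbrakk> \<Longrightarrow> (one S \<box> p2) \<star> (one S \<box> i2) \<star> F = F"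
  "\<lbrakk>arr F; cod F = S @ Y\<rbrakk> \<Longrightarrow> (one S \<box> p1) \<star> (one S \<box> i2) \<star> F = zero (dom F) (S @ X)"
  "\<lbrakk>arr F; cod F = S @ X\<rbrakk> \<Longrightarrow> (one S \<box> p2) \<star> (one S \<box> i1) \<star> F = zero (dom F) (S @ Y)"
  by (simp_all flip: cmp_assoc)

lemma sum_decompose:
  assumes [simp]: "arr F" "cod F = S @ P"
  shows "F = ((one S \<box> i1) \<star> (one S \<box> p1) \<star> F) \<boxplus> ((one S \<box> i2) \<star> (one S \<box> p2) \<star> F)"
proof -
  have "F = (one S \<box> ((i1 \<star> p1) \<boxplus> (i2 \<star> p2))) \<star> F"
    by (simp add: i_p)
  then show ?thesis
    by (simp add: ten_add add_cmp flip: ten_one_cmp)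
qed

text \<open>An arrow into \<open>S @ P\<close> is the sum of its two components, because tensoring
  with \<open>S\<close> preserves the biproduct relation \<open>i_p\<close>.\<close>

lemma sum_eq_iff:
  assumes "arr F" "arr G" "cod F = S @ P" "cod G = S @ P"
  shows "F = G \<longleftrightarrow> (one S \<box> p1) \<star> F = (one S \<box> p1) \<star> G \<and> (one S \<box> p2) \<star> F = (one S \<box> p2) \<star> G"
  using sum_decompose[of F] sum_decompose[of G] assms by metis

end

locale strict_bracket = strict_biproduct obj arr dom cod cmp ten one sw add neg zero
    S "M @ A" "A @ M" P i1 i2 p1 p2
  for obj :: "'x list \<Rightarrow> bool" and arr :: "'a \<Rightarrow> bool" and dom cod :: "'a \<Rightarrow> 'x list"
    and cmp (infixr "\<star>" 70) and ten (infixr "\<box>" 75) and one sw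
    and add (infixl "\<boxplus>" 65) and neg zero S M A P i1 i2 p1 p2 +
  fixes m l r p b :: 'a
  assumes arrs' [simp]: "arr m" "arr l" "arr r" "arr p" "arr b"
    and doms' [simp]: "dom m = A @ A" "dom l = A @ M" "dom r = M @ A" "dom p = S @ M @ S @ A"
      "dom b = S @ M @ S @ M"
    and cods' [simp]: "cod m = A" "cod l = M" "cod r = M" "cod p = S @ A @ A" "cod b = S @ P"
begin

lemma objs' [simp]: "obj M" "obj A"
  using objs(2) by simp_all

text \<open>The single equations of this and the next two lemmas are the form in which the bracket
  axioms arrive from \<open>C\<close>; the components on the right are the paired conjuncts of
  \<open>dlr_axioms\<close>.\<close>

lemma antisym_iff:
  "b \<star> sw (S @ M) (S @ M) = neg ((one S \<box> ((i2 \<star> sw M A \<star> p1) \<boxplus> (i1 \<star> sw A M \<star> p2))) \<star> b) \<longleftrightarrow>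
   ((one S \<box> p1) \<star> b) \<star> sw (S @ M) (S @ M) = neg ((one S \<box> sw A M) \<star> (one S \<box> p2) \<star> b) \<and>
   ((one S \<box> p2) \<star> b) \<star> sw (S @ M) (S @ M) = neg ((one S \<box> sw M A) \<star> (one S \<box> p1) \<star> b)"
  by (subst sum_eq_iff) (simp_all add: ten_add cmp_add add_cmp cmp_neg flip: ten_one_cmp)

lemma derivation_left_iff:
  "b \<star> (one (S @ M @ S) \<box> l) = ((one S \<box> i2) \<star> (one (S @ A) \<box> l) \<star> (p \<box> one M))
     \<boxplus> ((((one S \<box> i1) \<star> (((one S \<box> l) \<star> (sw A S \<box> one M)) \<box> one A) \<star> (one (A @ S) \<box> p1))
         \<boxplus> ((one S \<box> i2) \<star> (((one S \<box> m) \<star> (sw A S \<box> one A)) \<box> one M) \<star> (one (A @ S) \<box> p2)))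
        \<star> (one A \<box> b) \<star> (sw (S @ M @ S) A \<box> one M)) \<longleftrightarrow>
   ((one S \<box> p1) \<star> b) \<star> (one (S @ M @ S) \<box> l)
     = (((one S \<box> l) \<star> (sw A S \<box> one M)) \<box> one A) \<star> (one A \<box> ((one S \<box> p1) \<star> b)) \<star> (sw (S @ M @ S) A \<box> one M) \<and>
   ((one S \<box> p2) \<star> b) \<star> (one (S @ M @ S) \<box> l) = ((one (S @ A) \<box> l) \<star> (p \<box> one M))
     \<boxplus> ((((one S \<box> m) \<star> (sw A S \<box> one A)) \<box> one M) \<star> (one A \<box> ((one S \<box> p2) \<star> b)) \<star> (sw (S @ M @ S) A \<box> one M))"
  by (subst sum_eq_iff) (simp_all add: cmp_add add_cmp flip: ten_one_cmp)

lemma derivation_right_iff: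
  "b \<star> (one (S @ M @ S) \<box> r) = ((((one S \<box> i1) \<star> (one (S @ M) \<box> m) \<star> (one S \<box> p1 \<box> one A))
         \<boxplus> ((one S \<box> i2) \<star> (one (S @ A) \<box> r) \<star> (one S \<box> p2 \<box> one A))) \<star> (b \<box> one A))
     \<boxplus> ((one S \<box> i1) \<star> (one S \<box> r \<box> one A) \<star> (sw M S \<box> one (A @ A)) \<star> (one M \<box> p) \<star> (sw (S @ M @ S) M \<box> one A)) \<longleftrightarrow>
   ((one S \<box> p1) \<star> b) \<star> (one (S @ M @ S) \<box> r) = ((one (S @ M) \<box> m) \<star> (((one S \<box> p1) \<star> b) \<box> one A))
     \<boxplus> ((one S \<box> r \<box> one A) \<star> (sw M S \<box> one (A @ A)) \<star> (one M \<box> p) \<star> (sw (S @ M @ S) M \<box> one A)) \<and>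
   ((one S \<box> p2) \<star> b) \<star> (one (S @ M @ S) \<box> r) = (one (S @ A) \<box> r) \<star> (((one S \<box> p2) \<star> b) \<box> one A)"
  by (subst sum_eq_iff) (simp_all add: cmp_add add_cmp flip: ten_one_cmp)

end

section \<open>Invertible objects and the shift of morphisms\<close>

context strict_smc
begin

text \<open>By interchange the left side is \<open>(E \<star> E') \<box> F\<close>: a closed loop
  beside \<open>F\<close>, whose value is \<open>one []\<close>.\<close>

lemma sandwich:
  assumes "arr E" "arr E'" "E \<star> E' = one []" "dom E = X" "cod E' = X" "dom E' = []" "cod E = []"
    "arr F" "dom F = xs" "cod F = ys"
  shows "(E \<box> one ys) \<star> (one X \<box> F) \<star> (E' \<box> one xs) = F"
proof -
  have "obj X" "obj xs" "obj ys"
    using assms obj_dom[of E] obj_dom[of F] obj_cod[of F] by simp_all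
  with assms show ?thesis
    by (simp add: interchange)
qed

text \<open>Tensoring \<open>one S \<box> F\<close> once more with \<open>T\<close> and closing
  \<open>T @ S\<close> to a loop recovers \<open>F\<close>.\<close>

lemma faithfulI:
  assumes "obj S" "obj T" "arr E" "arr E'" "E \<star> E' = one []" "dom E = T @ S" "cod E' = T @ S"
    "dom E' = []" "cod E = []"
  shows "faithful S"
  unfolding faithful_def
proof (intro allI impI)
  fix F G
  assume *: "arr F" "arr G" "dom F = dom G" "cod F = cod G" "one S \<box> F = one S \<box> G"
  then have "one (T @ S) \<box> F = one (T @ S) \<box> G"
    using assms(1,2) by (simp flip: one_ten_one_ten)
  then show "F = G"
    using sandwich[of E E' "T @ S" F "dom F" "cod F"] sandwich[of E E' "T @ S" G "dom F" "cod F"] assms *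
    by simp
qed

definition hom_axioms ::
  "'x list \<Rightarrow> 'x list \<Rightarrow> 'a \<Rightarrow> 'a \<Rightarrow> 'a \<Rightarrow> 'a \<Rightarrow> 'a \<Rightarrow> 'a \<Rightarrow> 'a \<Rightarrow> 'a \<Rightarrow> 'a \<Rightarrow> bool" where
  "hom_axioms S A l r bl br l' r' bl' br' f \<longleftrightarrow>
     f \<star> l = l' \<star> (one A \<box> f) \<and> f \<star> r = r' \<star> (f \<box> one A) \<and>
     (one S \<box> f \<box> one A) \<star> bl = bl' \<star> (one S \<box> f \<box> one S \<box> f) \<and>
     (one (S @ A) \<box> f) \<star> br = br' \<star> (one S \<box> f \<box> one S \<box> f)"

end

context strict_smc
begin

lemma hom_axioms_one:
  "\<lbrakk>obj S; obj A; obj M; arr l; arr r; arr bl; arr br; dom l = A @ M; dom r = M @ A;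
    dom bl = S @ M @ S @ M; dom br = S @ M @ S @ M; cod l = M; cod r = M; cod bl = S @ M @ A; cod br = S @ A @ M\<rbrakk>
   \<Longrightarrow> hom_axioms S A l r bl br l r bl br (one M)"
  by (simp add: hom_axioms_def)

lemma hom_axioms_cmp:
  assumes [simp]: "obj S" "obj A" "arr f" "arr g" "dom f = M" "cod f = M2" "dom g = M2" "cod g = M3"
      "arr l" "arr r" "arr bl" "arr br" "arr l2" "arr r2" "arr bl2" "arr br2" "arr l3" "arr r3" "arr bl3" "arr br3"
      "cod l = M" "cod r = M" "cod bl = S @ M @ A" "cod br = S @ A @ M"
      "dom l2 = A @ M2" "dom r2 = M2 @ A" "dom bl2 = S @ M2 @ S @ M2" "dom br2 = S @ M2 @ S @ M2"
      "cod l2 = M2" "cod r2 = M2" "cod bl2 = S @ M2 @ A" "cod br2 = S @ A @ M2"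
      "dom l3 = A @ M3" "dom r3 = M3 @ A" "dom bl3 = S @ M3 @ S @ M3" "dom br3 = S @ M3 @ S @ M3"
    and f: "hom_axioms S A l r bl br l2 r2 bl2 br2 f"
    and g: "hom_axioms S A l2 r2 bl2 br2 l3 r3 bl3 br3 g"
  shows "hom_axioms S A l r bl br l3 r3 bl3 br3 (g \<star> f)"
proof -
  have [simp]: "obj M" "obj M2" "obj M3"
    using obj_dom[of f] obj_dom[of g] obj_cod[of g] by simp_all
  note F = f[unfolded hom_axioms_def] and G = g[unfolded hom_axioms_def]
  have G': "g \<star> l2 \<star> x = l3 \<star> (one A \<box> g) \<star> x" if "arr x" "cod x = A @ M2" for x
    using that G by (simp flip: cmp_assoc)
  have G'': "g \<star> r2 \<star> x = r3 \<star> (g \<box> one A) \<star> x" if "arr x" "cod x = M2 @ A" for x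
    using that G by (simp flip: cmp_assoc)
  have Gl: "(one S \<box> g \<box> one A) \<star> bl2 \<star> x = bl3 \<star> (one S \<box> g \<box> one S \<box> g) \<star> x"
    if "arr x" "cod x = S @ M2 @ S @ M2" for x
    using that G by (simp flip: cmp_assoc)
  have Gr: "(one (S @ A) \<box> g) \<star> br2 \<star> x = br3 \<star> (one S \<box> g \<box> one S \<box> g) \<star> x"
    if "arr x" "cod x = S @ M2 @ S @ M2" for x
    using that G by (simp flip: cmp_assoc)
  have 1: "one S \<box> (g \<star> f) \<box> one A = (one S \<box> g \<box> one A) \<star> (one S \<box> f \<box> one A)"
    "one (S @ A) \<box> (g \<star> f) = (one (S @ A) \<box> g) \<star> (one (S @ A) \<box> f)"
    "one A \<box> (g \<star> f) = (one A \<box> g) \<star> (one A \<box> f)" "(g \<star> f) \<box> one A = (g \<box> one A) \<star> (f \<box> one A)"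
    "one S \<box> (g \<star> f) \<box> one S \<box> (g \<star> f) = (one S \<box> g \<box> one S \<box> g) \<star> (one S \<box> f \<box> one S \<box> f)"
    by (simp_all add: interchange)
  show ?thesis
    unfolding hom_axioms_def
  proof (intro conjI)
    show "(g \<star> f) \<star> l = l3 \<star> (one A \<box> (g \<star> f))"
      unfolding 1 using F by (simp add: G')
    show "(g \<star> f) \<star> r = r3 \<star> ((g \<star> f) \<box> one A)"
      unfolding 1 using F by (simp add: G'')
    show "(one S \<box> (g \<star> f) \<box> one A) \<star> bl = bl3 \<star> (one S \<box> (g \<star> f) \<box> one S \<box> (g \<star> f))"
      unfolding 1(1,5) using F by (simp add: Gl)
    show "(one (S @ A) \<box> (g \<star> f)) \<star> br = br3 \<star> (one S \<box> (g \<star> f) \<box> one S \<box> (g \<star> f))"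
      unfolding 1(2,5) using F by (simp add: Gr)
  qed
qed

end

locale strict_invertible = strict_smc +
  fixes S T and E E'
  assumes objs [simp]: "obj S" "obj T"
    and arrs [simp]: "arr E" "arr E'"
    and doms [simp]: "dom E = T @ S" "dom E' = []"
    and cods [simp]: "cod E = []" "cod E' = T @ S"
    and E_E' [simp]: "E \<star> E' = one []" and E'_E [simp]: "E' \<star> E = one (T @ S)"
begin

text \<open>Composed with the symmetry, \<open>E\<close> exhibits \<open>S\<close> as an inverse of
  \<open>T\<close>, so results for \<open>S\<close> carry over to \<open>T\<close>. It is also the
  isomorphism behind essential surjectivity.\<close>

lemma E_swap: "(E \<star> sw S T) \<star> (sw T S \<star> E') = one []" "(sw T S \<star> E') \<star> (E \<star> sw S T) = one (S @ T)"
proof -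
  have "E' \<star> E \<star> F = F" if "arr F" "cod F = T @ S" for F
    using that by (simp flip: cmp_assoc)
  then show "(sw T S \<star> E') \<star> (E \<star> sw S T) = one (S @ T)"
    by simp
qed simp

lemma faithful: "faithful S" "faithful T"
  using faithfulI[of S T E E'] faithfulI[of T S "E \<star> sw S T" "sw T S \<star> E'"] E_swap(1) by simp_all

lemma full:
  assumes [simp]: "arr H" "dom H = S @ xs" "cod H = S @ ys"
  obtains F where "arr F" "dom F = xs" "cod F = ys" "H = one S \<box> F"
proof -
  have [simp]: "obj xs" "obj ys"
    using obj_dom[of H] obj_cod[of H] by simp_all
  \<comment> \<open>The candidate is \<open>one T \<box> H\<close> with \<open>T @ S\<close>
    contracted at both ends. Since \<open>sandwich\<close> writes \<open>F\<close> as the same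
    contraction of \<open>one (T @ S) \<box> F\<close>, cancelling the isomorphisms \<open>E\<close>
    and \<open>E'\<close> and then \<open>T\<close> gives \<open>H = one S \<box> F\<close>.\<close>
  define F where "F = (E \<box> one ys) \<star> (one T \<box> H) \<star> (E' \<box> one xs)"
  have F: "arr F" "dom F = xs" "cod F = ys"
    unfolding F_def by simp_all
  then have "(E \<box> one ys) \<star> (one (T @ S) \<box> F) \<star> (E' \<box> one xs) = (E \<box> one ys) \<star> (one T \<box> H) \<star> (E' \<box> one xs)"
    using sandwich[of E E' "T @ S" F xs ys] by (simp add: F_def)
  then have "(one (T @ S) \<box> F) \<star> (E' \<box> one xs) = (one T \<box> H) \<star> (E' \<box> one xs)"
    by (subst (asm) iso_cancel_left[where H' = "E' \<box> one ys"]) (simp_all add: F interchange)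
  then have "one (T @ S) \<box> F = one T \<box> H"
    by (subst (asm) iso_cancel_right[where H' = "E \<box> one xs"]) (simp_all add: F interchange)
  then have "one T \<box> (one S \<box> F) = one T \<box> H"
    using F by simp
  then have "H = one S \<box> F"
    using faithful(2) F unfolding faithful_def by simp
  then show thesis
    using that F by blast
qed

text \<open>The left side is the formula of the theorem for the shifted anchor, applied to the
  anchor built from \<open>p0\<close>. The two crossings of \<open>N\<close> combine to one with
  \<open>T @ S\<close>, which \<open>E'\<close> passes by naturality; \<open>sandwich\<close> does
  the rest.\<close>

lemma anchor_unshift:
  assumes [simp]: "arr p0" "dom p0 = N @ A" "cod p0 = B @ A"
  shows "(E \<box> one (B @ A)) \<star> (one T \<box> ((one S \<box> p0) \<star> (sw N S \<box> one A))) \<star> (sw N T \<box> one (S @ A))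
    \<star> (one N \<box> E' \<box> one A) = p0"
proof -
  have [simp]: "obj N" "obj A" "obj B"
    using obj_dom[of p0] obj_cod[of p0] by simp_all
  have "((one T \<box> sw N S \<box> one A) \<star> (sw N T \<box> one (S @ A))) \<star> (one N \<box> E' \<box> one A)
      = (sw N (T @ S) \<star> (one N \<box> E')) \<box> one A"
    using sw_append_right[of N T S] by (simp flip: ten_one_cmp)
  also have "\<dots> = E' \<box> one (N @ A)"
    by (simp add: sw_natural)
  finally show ?thesis
    using sandwich[of E E' "T @ S" p0 "N @ A" "B @ A"] by (simp flip: ten_one_cmp)
qed

text \<open>Undoing the crossing of \<open>N\<close> and \<open>S\<close> yields an arrow with
  \<open>S\<close> in front on both sides, to which \<open>full\<close> applies.\<close>

lemma anchor_shift:
  assumes [simp]: "arr p" "dom p = N @ S @ A" "cod p = S @ ys"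
  obtains p0 where "arr p0" "dom p0 = N @ A" "cod p0 = ys" "p = (one S \<box> p0) \<star> (sw N S \<box> one A)"
proof -
  have [simp]: "obj N" "obj A" "obj ys"
    using obj_dom[of p] obj_cod[of p] by simp_all
  obtain p0 where p0: "arr p0" "dom p0 = N @ A" "cod p0 = ys" "p \<star> (sw S N \<box> one A) = one S \<box> p0"
    by (rule full[of "p \<star> (sw S N \<box> one A)" "N @ A" ys]) simp_all
  have "p = (p \<star> (sw S N \<box> one A)) \<star> (sw N S \<box> one A)"
    by (simp add: interchange)
  then show thesis
    using that p0 by simp
qed

text \<open>For the two actions, cancelling crossings and faithfulness remove \<open>S\<close>. The
  condition on \<open>bl\<close> is the same on both sides, and that on \<open>br\<close> differs by
  an invertible crossing.\<close>

lemma hom_axioms_shift: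
  assumes [simp]: "obj M" "obj A" "obj M2" "arr l" "arr r" "arr bl" "arr br" "arr l2" "arr r2" "arr bl2" "arr br2" "arr f"
    "dom l = A @ M" "dom r = M @ A" "dom bl = S @ M @ S @ M" "dom br = S @ M @ S @ M"
    "cod l = M" "cod r = M" "cod bl = S @ M @ A" "cod br = S @ A @ M"
    "dom l2 = A @ M2" "dom r2 = M2 @ A" "dom bl2 = S @ M2 @ S @ M2" "dom br2 = S @ M2 @ S @ M2"
    "cod l2 = M2" "cod r2 = M2" "cod bl2 = S @ M2 @ A" "cod br2 = S @ A @ M2" "dom f = M" "cod f = M2"
  shows "hom_axioms S A l r bl br l2 r2 bl2 br2 f \<longleftrightarrow>
    hom_axioms [] A ((one S \<box> l) \<star> (sw A S \<box> one M)) (one S \<box> r) bl ((sw S A \<box> one M) \<star> br)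
      ((one S \<box> l2) \<star> (sw A S \<box> one M2)) (one S \<box> r2) bl2 ((sw S A \<box> one M2) \<star> br2) (one S \<box> f)"
proof -
  have S: "one S \<box> F = one S \<box> G \<longleftrightarrow> F = G" if "arr F" "arr G" "dom F = dom G" "cod F = cod G" for F G
    using that faithful(1) unfolding faithful_def by blast
  have 1: "(one S \<box> f) \<star> (one S \<box> l) \<star> (sw A S \<box> one M) = (one S \<box> (f \<star> l)) \<star> (sw A S \<box> one M)"
    by (simp flip: ten_one_cmp)
  have "(sw A S \<box> one M2) \<star> (one (A @ S) \<box> f) = (one (S @ A) \<box> f) \<star> (sw A S \<box> one M)"
    by (simp add: interchange)
  then have 2: "(one S \<box> l2) \<star> (sw A S \<box> one M2) \<star> (one (A @ S) \<box> f) = (one S \<box> (l2 \<star> (one A \<box> f))) \<star> (sw A S \<box> one M)"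
    by (simp flip: ten_one_cmp)
  have l: "(one S \<box> (f \<star> l)) \<star> (sw A S \<box> one M) = (one S \<box> (l2 \<star> (one A \<box> f))) \<star> (sw A S \<box> one M)
      \<longleftrightarrow> f \<star> l = l2 \<star> (one A \<box> f)"
    by (subst iso_cancel_right[where H' = "sw S A \<box> one M"]) (simp_all add: interchange S)
  have r: "(one S \<box> f) \<star> (one S \<box> r) = (one S \<box> r2) \<star> (one S \<box> f \<box> one A) \<longleftrightarrow> f \<star> r = r2 \<star> (f \<box> one A)"
    by (simp add: ten_one_cmp S)
  have "(one (A @ S) \<box> f) \<star> (sw S A \<box> one M) = (sw S A \<box> one M2) \<star> (one (S @ A) \<box> f)"
    by (simp add: interchange)
  then have 3: "(one (A @ S) \<box> f) \<star> (sw S A \<box> one M) \<star> br = (sw S A \<box> one M2) \<star> (one (S @ A) \<box> f) \<star> br"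
    by (simp flip: cmp_assoc)
  have br: "(sw S A \<box> one M2) \<star> (one (S @ A) \<box> f) \<star> br = (sw S A \<box> one M2) \<star> br2 \<star> (one S \<box> f \<box> one S \<box> f)
      \<longleftrightarrow> (one (S @ A) \<box> f) \<star> br = br2 \<star> (one S \<box> f \<box> one S \<box> f)"
    by (rule iso_cancel_left[where H' = "sw A S \<box> one M2"]) (simp_all add: interchange)
  show ?thesis
    unfolding hom_axioms_def by (simp add: 1 2 3 l r br)
qed

end

section \<open>Strictification\<close>

text \<open>As hom-sets may overlap, an arrow is packaged with its source and target.\<close>

type_synonym ('o, 'm) typed = "'o \<times> 'm \<times> 'o"

section \<open>Typed arrows and the unit laws of coherence\<close>

context additive_symmetric_monoidal_category
begin

definition tarr :: "('o, 'm) typed \<Rightarrow> bool" where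
  "tarr F \<longleftrightarrow> fst F \<in> Obj C \<and> snd (snd F) \<in> Obj C \<and> fst (snd F) \<in> Hom C (fst F) (snd (snd F))"

definition src :: "('o, 'm) typed \<Rightarrow> 'o" where "src F = fst F"
definition trg :: "('o, 'm) typed \<Rightarrow> 'o" where "trg F = snd (snd F)"
definition mor :: "('o, 'm) typed \<Rightarrow> 'm" where "mor F = fst (snd F)"

lemma typed_eqI: "\<lbrakk>src F = src G; trg F = trg G; mor F = mor G\<rbrakk> \<Longrightarrow> F = G"
  by (simp add: src_def trg_def mor_def prod_eq_iff)

lemma typed_simps [simp]: "src (X, f, Y) = X" "trg (X, f, Y) = Y" "mor (X, f, Y) = f"
  by (simp_all add: src_def trg_def mor_def)

lemma tarr_iff: "tarr F \<longleftrightarrow> src F \<in> Obj C \<and> trg F \<in> Obj C \<and> mor F \<in> Hom C (src F) (trg F)"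
  by (simp add: tarr_def src_def trg_def mor_def)

lemma tarr_objs [simp]: "tarr F \<Longrightarrow> src F \<in> Obj C" "tarr F \<Longrightarrow> trg F \<in> Obj C"
  by (simp_all add: tarr_iff)

lemma mor_in: "tarr F \<Longrightarrow> mor F \<in> Hom C (src F) (trg F)"
  by (simp add: tarr_iff del: tarr_objs)

definition cmp0 (infixr "\<bullet>" 70) where "G \<bullet> F = (src F, mor G \<cdot> mor F, trg G)"
definition ten0 (infixr "\<odot>" 75) where
  "F \<odot> G = (src F \<otimes>\<^sub>o src G, mor F \<otimes>\<^sub>m mor G, trg F \<otimes>\<^sub>o trg G)"
definition id0 where "id0 X = (X, \<langle>X\<rangle>, X)"
definition as where "as X Y Z = ((X \<otimes>\<^sub>o Y) \<otimes>\<^sub>o Z, \<alpha> X Y Z, X \<otimes>\<^sub>o (Y \<otimes>\<^sub>o Z))"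
definition as_inv where "as_inv X Y Z = (X \<otimes>\<^sub>o (Y \<otimes>\<^sub>o Z), assoc_inv C X Y Z, (X \<otimes>\<^sub>o Y) \<otimes>\<^sub>o Z)"
definition lu where "lu X = (\<I> \<otimes>\<^sub>o X, \<ll> X, X)"
definition lu_inv where "lu_inv X = (X, lunit_inv C X, \<I> \<otimes>\<^sub>o X)"
definition ru where "ru X = (X \<otimes>\<^sub>o \<I>, \<rr> X, X)"
definition ru_inv where "ru_inv X = (X, inv_arrow C (X \<otimes>\<^sub>o \<I>) X (\<rr> X), X \<otimes>\<^sub>o \<I>)"
definition sy where "sy X Y = (X \<otimes>\<^sub>o Y, \<tau> X Y, Y \<otimes>\<^sub>o X)"
definition add0 (infixl "\<squnion>" 65) where "F \<squnion> G = (src F, mor F \<oplus>\<^sub>m mor G, trg F)"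
definition neg0 where "neg0 F = (src F, neg C (src F) (trg F) (mor F), trg F)"
definition zero0 where "zero0 X Y = (X, zerom C X Y, Y)"

lemmas typed_defs = cmp0_def ten0_def id0_def as_def as_inv_def lu_def lu_inv_def ru_def ru_inv_def sy_def
  add0_def neg0_def zero0_def

lemma inverse_arrows_unique:
  assumes "X \<in> Obj C" "Y \<in> Obj C" "inverse_arrows C X Y f g" "inverse_arrows C X Y f h"
  shows "g = h"
proof -
  have *: "f \<in> Hom C X Y" "g \<in> Hom C Y X" "h \<in> Hom C Y X" "g \<cdot> f = \<langle>X\<rangle>" "f \<cdot> h = \<langle>Y\<rangle>"
    using assms unfolding inverse_arrows_def by auto
  have "g = g \<cdot> (f \<cdot> h)"
    using * assms comp_ident[of Y X g] by simp
  also have "\<dots> = (g \<cdot> f) \<cdot> h"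
    using * assms comp_assoc[of Y X Y X g f h] by simp
  also have "\<dots> = h"
    using * assms ident_comp[of Y X h] by simp
  finally show ?thesis .
qed

lemma inv_arrow:
  assumes "X \<in> Obj C" "Y \<in> Obj C" "iso_arrow C X Y f"
  shows "inverse_arrows C X Y f (inv_arrow C X Y f)"
  unfolding inv_arrow_def
  using assms(3) inverse_arrows_unique[OF assms(1,2)] by (metis iso_arrow_def theI)

lemma src_trg [simp]:
  "src (G \<bullet> F) = src F" "trg (G \<bullet> F) = trg G"
  "src (F \<odot> G) = src F \<otimes>\<^sub>o src G" "trg (F \<odot> G) = trg F \<otimes>\<^sub>o trg G"
  "src (id0 X) = X" "trg (id0 X) = X"
  "src (as X Y Z) = (X \<otimes>\<^sub>o Y) \<otimes>\<^sub>o Z" "trg (as X Y Z) = X \<otimes>\<^sub>o (Y \<otimes>\<^sub>o Z)"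
  "src (as_inv X Y Z) = X \<otimes>\<^sub>o (Y \<otimes>\<^sub>o Z)" "trg (as_inv X Y Z) = (X \<otimes>\<^sub>o Y) \<otimes>\<^sub>o Z"
  "src (lu X) = \<I> \<otimes>\<^sub>o X" "trg (lu X) = X" "src (lu_inv X) = X" "trg (lu_inv X) = \<I> \<otimes>\<^sub>o X"
  "src (ru X) = X \<otimes>\<^sub>o \<I>" "trg (ru X) = X" "src (ru_inv X) = X" "trg (ru_inv X) = X \<otimes>\<^sub>o \<I>"
  "src (sy X Y) = X \<otimes>\<^sub>o Y" "trg (sy X Y) = Y \<otimes>\<^sub>o X"
  "src (F \<squnion> G) = src F" "trg (F \<squnion> G) = trg F" "src (neg0 F) = src F" "trg (neg0 F) = trg F"
  "src (zero0 X Y) = X" "trg (zero0 X Y) = Y"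
  by (simp_all add: typed_defs)

lemma mor_simps:
  "mor (G \<bullet> F) = mor G \<cdot> mor F" "mor (F \<odot> G) = mor F \<otimes>\<^sub>m mor G" "mor (id0 X) = \<langle>X\<rangle>"
  "mor (as X Y Z) = \<alpha> X Y Z" "mor (as_inv X Y Z) = assoc_inv C X Y Z" "mor (lu X) = \<ll> X"
  "mor (lu_inv X) = lunit_inv C X" "mor (ru X) = \<rr> X" "mor (sy X Y) = \<tau> X Y"
  "mor (F \<squnion> G) = mor F \<oplus>\<^sub>m mor G" "mor (neg0 F) = neg C (src F) (trg F) (mor F)"
  "mor (zero0 X Y) = zerom C X Y"
  by (simp_all add: typed_defs)

declare unit_obj [simp] tensor_obj [simp]

lemma tarr_simps [simp]:
  "\<lbrakk>tarr F; tarr G; src G = trg F\<rbrakk> \<Longrightarrow> tarr (G \<bullet> F)"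
  "\<lbrakk>tarr F; tarr G\<rbrakk> \<Longrightarrow> tarr (F \<odot> G)"
  "X \<in> Obj C \<Longrightarrow> tarr (id0 X)"
  "\<lbrakk>X \<in> Obj C; Y \<in> Obj C\<rbrakk> \<Longrightarrow> tarr (sy X Y)"
  by (auto simp del: tarr_objs simp add: tarr_iff mor_simps tensor_in ident_in symm_in intro: comp_in)

lemma inverses [simp]:
  "\<lbrakk>X \<in> Obj C; Y \<in> Obj C; Z \<in> Obj C\<rbrakk> \<Longrightarrow> tarr (as X Y Z)"
  "\<lbrakk>X \<in> Obj C; Y \<in> Obj C; Z \<in> Obj C\<rbrakk> \<Longrightarrow> tarr (as_inv X Y Z)"
  "\<lbrakk>X \<in> Obj C; Y \<in> Obj C; Z \<in> Obj C\<rbrakk> \<Longrightarrow> as_inv X Y Z \<bullet> as X Y Z = id0 ((X \<otimes>\<^sub>o Y) \<otimes>\<^sub>o Z)"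
  "\<lbrakk>X \<in> Obj C; Y \<in> Obj C; Z \<in> Obj C\<rbrakk> \<Longrightarrow> as X Y Z \<bullet> as_inv X Y Z = id0 (X \<otimes>\<^sub>o (Y \<otimes>\<^sub>o Z))"
  "X \<in> Obj C \<Longrightarrow> tarr (lu X)" "X \<in> Obj C \<Longrightarrow> tarr (lu_inv X)"
  "X \<in> Obj C \<Longrightarrow> lu_inv X \<bullet> lu X = id0 (\<I> \<otimes>\<^sub>o X)" "X \<in> Obj C \<Longrightarrow> lu X \<bullet> lu_inv X = id0 X"
  "X \<in> Obj C \<Longrightarrow> tarr (ru X)" "X \<in> Obj C \<Longrightarrow> tarr (ru_inv X)"
  "X \<in> Obj C \<Longrightarrow> ru_inv X \<bullet> ru X = id0 (X \<otimes>\<^sub>o \<I>)" "X \<in> Obj C \<Longrightarrow> ru X \<bullet> ru_inv X = id0 X"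
  using inv_arrow[OF _ _ assoc_iso, of X Y Z] inv_arrow[OF _ _ lunit_iso, of X]
    inv_arrow[OF _ _ runit_iso, of X]
  by (simp_all add: tarr_def typed_defs inverse_arrows_def assoc_inv_def lunit_inv_def)

lemma cmp0_assoc [simp]:
  "\<lbrakk>tarr F; tarr G; tarr H; src H = trg G; src G = trg F\<rbrakk> \<Longrightarrow> (H \<bullet> G) \<bullet> F = H \<bullet> (G \<bullet> F)"
  using comp_assoc[of "src F" "src G" "src H" "trg H"] by (auto simp del: tarr_objs simp add: tarr_iff mor_simps intro: typed_eqI)

lemma cmp0_id [simp]: "\<lbrakk>tarr F; src F = X\<rbrakk> \<Longrightarrow> F \<bullet> id0 X = F"
  using comp_ident[of "src F" "trg F"] by (auto simp del: tarr_objs simp add: tarr_iff mor_simps intro: typed_eqI)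

lemma id_cmp0 [simp]: "\<lbrakk>tarr F; trg F = X\<rbrakk> \<Longrightarrow> id0 X \<bullet> F = F"
  using ident_comp[of "src F" "trg F"] by (auto simp del: tarr_objs simp add: tarr_iff mor_simps intro: typed_eqI)

lemma interchange0:
  "\<lbrakk>tarr F; tarr G; tarr F'; tarr G'; src G = trg F; src G' = trg F'\<rbrakk>
    \<Longrightarrow> (G \<odot> G') \<bullet> (F \<odot> F') = (G \<bullet> F) \<odot> (G' \<bullet> F')"
  using tensor_comp[of "src F" "trg F" "trg G" "src F'" "trg F'" "trg G'"]
  by (auto simp del: tarr_objs simp add: tarr_iff mor_simps intro!: typed_eqI)

lemma id_ten0_id [simp]: "\<lbrakk>X \<in> Obj C; Y \<in> Obj C\<rbrakk> \<Longrightarrow> id0 X \<odot> id0 Y = id0 (X \<otimes>\<^sub>o Y)"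
  by (auto simp: mor_simps tensor_ident intro: typed_eqI)

lemma as_natural:
  "\<lbrakk>tarr F; tarr G; tarr H; trg F = X; trg G = Y; trg H = Z\<rbrakk>
    \<Longrightarrow> as X Y Z \<bullet> ((F \<odot> G) \<odot> H) = (F \<odot> (G \<odot> H)) \<bullet> as (src F) (src G) (src H)"
  by (auto simp del: tarr_objs simp add: tarr_iff mor_simps assoc_natural intro!: typed_eqI)

lemma lu_natural: "\<lbrakk>tarr F; trg F = Y\<rbrakk> \<Longrightarrow> lu Y \<bullet> (id0 \<I> \<odot> F) = F \<bullet> lu (src F)"
  by (auto simp del: tarr_objs simp add: tarr_iff mor_simps lunit_natural intro!: typed_eqI)

lemma ru_natural: "\<lbrakk>tarr F; trg F = Y\<rbrakk> \<Longrightarrow> ru Y \<bullet> (F \<odot> id0 \<I>) = F \<bullet> ru (src F)"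
  by (auto simp del: tarr_objs simp add: tarr_iff mor_simps runit_natural intro!: typed_eqI)

lemma sy_natural:
  "\<lbrakk>tarr F; tarr G; trg F = X; trg G = Y\<rbrakk> \<Longrightarrow> sy X Y \<bullet> (F \<odot> G) = (G \<odot> F) \<bullet> sy (src F) (src G)"
  by (auto simp del: tarr_objs simp add: tarr_iff mor_simps symm_natural intro!: typed_eqI)

lemma triangle0:
  "\<lbrakk>X \<in> Obj C; Y \<in> Obj C\<rbrakk> \<Longrightarrow> (id0 X \<odot> lu Y) \<bullet> as X \<I> Y = ru X \<odot> id0 Y"
  by (auto simp: mor_simps triangle intro!: typed_eqI)

lemma pentagon0:
  "\<lbrakk>W \<in> Obj C; X \<in> Obj C; Y \<in> Obj C; Z \<in> Obj C\<rbrakk> \<Longrightarrow>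
   (id0 W \<odot> as X Y Z) \<bullet> as W (X \<otimes>\<^sub>o Y) Z \<bullet> (as W X Y \<odot> id0 Z) = as W X (Y \<otimes>\<^sub>o Z) \<bullet> as (W \<otimes>\<^sub>o X) Y Z"
  by (auto simp: mor_simps pentagon intro!: typed_eqI)

lemma hexagon0:
  "\<lbrakk>X \<in> Obj C; Y \<in> Obj C; Z \<in> Obj C\<rbrakk> \<Longrightarrow>
   as Y Z X \<bullet> sy X (Y \<otimes>\<^sub>o Z) \<bullet> as X Y Z = (id0 Y \<odot> sy X Z) \<bullet> as Y X Z \<bullet> (sy X Y \<odot> id0 Z)"
  by (auto simp: mor_simps hexagon intro!: typed_eqI)

lemma sy_sy [simp]: "\<lbrakk>X \<in> Obj C; Y \<in> Obj C\<rbrakk> \<Longrightarrow> sy Y X \<bullet> sy X Y = id0 (X \<otimes>\<^sub>o Y)"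
  by (auto simp: mor_simps symm_symm intro!: typed_eqI)

lemma cancel0_left:
  assumes "tarr H" "tarr H'" "tarr F" "tarr G" "trg F = src H" "trg G = src H" "src H' = trg H"
    "H' \<bullet> H = id0 (src H)" "H \<bullet> F = H \<bullet> G"
  shows "F = G"
  using assms by (metis cmp0_assoc id_cmp0)

lemma cancel0_right:
  assumes "tarr H" "tarr H'" "tarr F" "tarr G" "src F = trg H" "src G = trg H" "trg H' = src H"
    "H \<bullet> H' = id0 (trg H)" "F \<bullet> H = G \<bullet> H"
  shows "F = G"
  using assms by (metis cmp0_assoc cmp0_id)

text \<open>Naturality of the unit isomorphism makes \<open>id0 \<I> \<odot> F\<close> conjugate to
  \<open>F\<close>. This and its mirror image allow coherence equations to be tested after tensoring
  with \<I>.\<close>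

lemma unit_ten_faithful:
  assumes "tarr F" "tarr G" "src F = src G" "trg F = trg G" "id0 \<I> \<odot> F = id0 \<I> \<odot> G"
  shows "F = G"
proof -
  have "F \<bullet> lu (src F) = G \<bullet> lu (src F)"
    using assms lu_natural[of F "trg F"] lu_natural[of G "trg G"] by simp
  then show ?thesis
    by (rule cancel0_right[rotated -1, where H' = "lu_inv (src F)"]) (use assms in simp_all)
qed

lemma ten_unit_faithful:
  assumes "tarr F" "tarr G" "src F = src G" "trg F = trg G" "F \<odot> id0 \<I> = G \<odot> id0 \<I>"
  shows "F = G"
proof -
  have "F \<bullet> ru (src F) = G \<bullet> ru (src F)"
    using assms ru_natural[of F "trg F"] ru_natural[of G "trg G"] by simp
  then show ?thesis
    by (rule cancel0_right[rotated -1, where H' = "ru_inv (src F)"]) (use assms in simp_all)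
qed

lemma ten_id_cmp0:
  "\<lbrakk>tarr F; tarr G; X \<in> Obj C; src G = trg F\<rbrakk> \<Longrightarrow> (G \<odot> id0 X) \<bullet> (F \<odot> id0 X) = (G \<bullet> F) \<odot> id0 X"
  "\<lbrakk>tarr F; tarr G; X \<in> Obj C; src G = trg F\<rbrakk> \<Longrightarrow> (id0 X \<odot> G) \<bullet> (id0 X \<odot> F) = id0 X \<odot> (G \<bullet> F)"
  by (simp_all add: interchange0)

text \<open>Kelly's argument: after tensoring with \<I>, the pentagon for \<I>, \<I>, X, Y and two
  triangles connect both sides. The lemma for \<open>ru\<close> is the mirror image.\<close>

lemma lu_ten:
  assumes [simp]: "X \<in> Obj C" "Y \<in> Obj C"
  shows "lu (X \<otimes>\<^sub>o Y) \<bullet> as \<I> X Y = lu X \<odot> id0 Y"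
proof (rule unit_ten_faithful)
  let ?H = "as \<I> (\<I> \<otimes>\<^sub>o X) Y \<bullet> (as \<I> \<I> X \<odot> id0 Y)"
  have "(id0 \<I> \<odot> (lu (X \<otimes>\<^sub>o Y) \<bullet> as \<I> X Y)) \<bullet> ?H
      = (id0 \<I> \<odot> lu (X \<otimes>\<^sub>o Y)) \<bullet> (as \<I> \<I> (X \<otimes>\<^sub>o Y) \<bullet> as (\<I> \<otimes>\<^sub>o \<I>) X Y)"
    by (simp add: pentagon0 flip: ten_id_cmp0)
  also have "\<dots> = (ru \<I> \<odot> id0 (X \<otimes>\<^sub>o Y)) \<bullet> as (\<I> \<otimes>\<^sub>o \<I>) X Y"
    by (simp add: flip: cmp0_assoc triangle0)
  also have "\<dots> = as \<I> X Y \<bullet> ((ru \<I> \<odot> id0 X) \<odot> id0 Y)"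
    using as_natural[of "ru \<I>" "id0 X" "id0 Y" \<I> X Y] by simp
  also have "\<dots> = as \<I> X Y \<bullet> ((id0 \<I> \<odot> lu X) \<odot> id0 Y) \<bullet> (as \<I> \<I> X \<odot> id0 Y)"
    by (simp add: ten_id_cmp0 flip: triangle0)
  also have "\<dots> = (id0 \<I> \<odot> (lu X \<odot> id0 Y)) \<bullet> ?H"
    using as_natural[of "id0 \<I>" "lu X" "id0 Y" \<I> X Y] by (simp flip: cmp0_assoc)
  finally show "id0 \<I> \<odot> (lu (X \<otimes>\<^sub>o Y) \<bullet> as \<I> X Y) = id0 \<I> \<odot> (lu X \<odot> id0 Y)"
    by (rule cancel0_right[rotated -1, where H' = "(as_inv \<I> \<I> X \<odot> id0 Y) \<bullet> as_inv \<I> (\<I> \<otimes>\<^sub>o X) Y"])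
      (simp_all, simp add: interchange0 flip: cmp0_assoc[of _ _ "_ \<odot> _"])
qed simp_all

lemma ru_ten:
  assumes [simp]: "X \<in> Obj C" "Y \<in> Obj C"
  shows "(id0 X \<odot> ru Y) \<bullet> as X Y \<I> = ru (X \<otimes>\<^sub>o Y)"
proof (rule ten_unit_faithful)
  have "as X Y \<I> \<bullet> (((id0 X \<odot> ru Y) \<bullet> as X Y \<I>) \<odot> id0 \<I>)
      = (as X Y \<I> \<bullet> ((id0 X \<odot> ru Y) \<odot> id0 \<I>)) \<bullet> (as X Y \<I> \<odot> id0 \<I>)"
    by (simp add: ten_id_cmp0)
  also have "\<dots> = (id0 X \<odot> ((id0 Y \<odot> lu \<I>) \<bullet> as Y \<I> \<I>)) \<bullet> as X (Y \<otimes>\<^sub>o \<I>) \<I> \<bullet> (as X Y \<I> \<odot> id0 \<I>)"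
    by (simp add: as_natural triangle0)
  also have "\<dots> = (id0 X \<odot> (id0 Y \<odot> lu \<I>)) \<bullet> as X Y (\<I> \<otimes>\<^sub>o \<I>) \<bullet> as (X \<otimes>\<^sub>o Y) \<I> \<I>"
    by (simp add: pentagon0 flip: ten_id_cmp0)
  also have "\<dots> = as X Y \<I> \<bullet> (id0 (X \<otimes>\<^sub>o Y) \<odot> lu \<I>) \<bullet> as (X \<otimes>\<^sub>o Y) \<I> \<I>"
    using as_natural[of "id0 X" "id0 Y" "lu \<I>" X Y \<I>] by (simp flip: cmp0_assoc)
  also have "\<dots> = as X Y \<I> \<bullet> (ru (X \<otimes>\<^sub>o Y) \<odot> id0 \<I>)"
    by (simp add: triangle0)
  finally show "((id0 X \<odot> ru Y) \<bullet> as X Y \<I>) \<odot> id0 \<I> = ru (X \<otimes>\<^sub>o Y) \<odot> id0 \<I>"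
    by (rule cancel0_left[rotated -1, where H' = "as_inv X Y \<I>"]) simp_all
qed simp_all

lemma lu_unit: "lu \<I> = ru \<I>"
proof (rule ten_unit_faithful)
  \<comment> \<open>This is naturality of \<open>lu\<close> at the arrow \<open>lu \<I>\<close>
    itself, after cancelling that isomorphism.\<close>
  have "lu (\<I> \<otimes>\<^sub>o \<I>) = id0 \<I> \<odot> lu \<I>"
    by (rule cancel0_left[where H = "lu \<I>" and H' = "lu_inv \<I>"]) (simp_all add: lu_natural)
  then show "lu \<I> \<odot> id0 \<I> = ru \<I> \<odot> id0 \<I>"
    by (simp add: triangle0 flip: lu_ten)
qed simp_all

text \<open>The hexagon for X, \<I>, \<I>, compared with the triangle. It yields the rule that
  crossing the empty list is an identity.\<close>

lemma lu_sy:
  assumes [simp]: "X \<in> Obj C"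
  shows "lu X \<bullet> sy X \<I> = ru X"
proof (rule ten_unit_faithful)
  have "sy X \<I> \<bullet> (ru X \<odot> id0 \<I>) = sy X \<I> \<bullet> (id0 X \<odot> lu \<I>) \<bullet> as X \<I> \<I>"
    by (simp add: triangle0)
  also have "\<dots> = (lu \<I> \<odot> id0 X) \<bullet> sy X (\<I> \<otimes>\<^sub>o \<I>) \<bullet> as X \<I> \<I>"
    using sy_natural[of "id0 X" "lu \<I>" X \<I>] by (simp flip: cmp0_assoc)
  also have "\<dots> = lu (\<I> \<otimes>\<^sub>o X) \<bullet> (id0 \<I> \<odot> sy X \<I>) \<bullet> as \<I> X \<I> \<bullet> (sy X \<I> \<odot> id0 \<I>)"
    by (simp add: hexagon0 flip: lu_ten)
  also have "\<dots> = sy X \<I> \<bullet> (lu (X \<otimes>\<^sub>o \<I>) \<bullet> as \<I> X \<I>) \<bullet> (sy X \<I> \<odot> id0 \<I>)"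
    using lu_natural[of "sy X \<I>"] by (simp flip: cmp0_assoc)
  also have "\<dots> = sy X \<I> \<bullet> ((lu X \<bullet> sy X \<I>) \<odot> id0 \<I>)"
    by (simp add: lu_ten ten_id_cmp0)
  finally have "ru X \<odot> id0 \<I> = (lu X \<bullet> sy X \<I>) \<odot> id0 \<I>"
    by (rule cancel0_left[rotated -1, where H' = "sy \<I> X"]) simp_all
  then show "(lu X \<bullet> sy X \<I>) \<odot> id0 \<I> = ru X \<odot> id0 \<I>" ..
qed simp_all

section \<open>Products of lists and their concatenation\<close>

primrec tlist :: "'o list \<Rightarrow> 'o" where
  "tlist [] = \<I>"
| "tlist (x # xs) = x \<otimes>\<^sub>o tlist xs"

text \<open>The structure isomorphism that makes \<open>tlist\<close> a strong monoidal map from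
  lists under concatenation to \<open>C\<close>.\<close>

primrec app :: "'o list \<Rightarrow> 'o list \<Rightarrow> ('o, 'm) typed" where
  "app [] ys = lu (tlist ys)"
| "app (x # xs) ys = (id0 x \<odot> app xs ys) \<bullet> as x (tlist xs) (tlist ys)"

primrec app_inv :: "'o list \<Rightarrow> 'o list \<Rightarrow> ('o, 'm) typed" where
  "app_inv [] ys = lu_inv (tlist ys)"
| "app_inv (x # xs) ys = as_inv x (tlist xs) (tlist ys) \<bullet> (id0 x \<odot> app_inv xs ys)"

definition obj_list :: "'o list \<Rightarrow> bool" where
  "obj_list xs \<longleftrightarrow> set xs \<subseteq> Obj C"

lemma obj_list_simps [simp]: "obj_list []" "obj_list (x # xs) \<longleftrightarrow> x \<in> Obj C \<and> obj_list xs"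
  "obj_list (xs @ ys) \<longleftrightarrow> obj_list xs \<and> obj_list ys"
  by (auto simp: obj_list_def)

lemma tlist_obj [simp]: "obj_list xs \<Longrightarrow> tlist xs \<in> Obj C"
  by (induction xs) auto

lemma app_type [simp]:
  "src (app xs ys) = tlist xs \<otimes>\<^sub>o tlist ys" "trg (app xs ys) = tlist (xs @ ys)"
  "src (app_inv xs ys) = tlist (xs @ ys)" "trg (app_inv xs ys) = tlist xs \<otimes>\<^sub>o tlist ys"
  by (cases xs; simp; fail | induction xs; simp)+

lemma app_tarr [simp]: "\<lbrakk>obj_list xs; obj_list ys\<rbrakk> \<Longrightarrow> tarr (app xs ys)" "\<lbrakk>obj_list xs; obj_list ys\<rbrakk> \<Longrightarrow> tarr (app_inv xs ys)"
  by (induction xs) simp_all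

lemma app_app_inv [simp]:
  "\<lbrakk>obj_list xs; obj_list ys\<rbrakk> \<Longrightarrow> app xs ys \<bullet> app_inv xs ys = id0 (tlist (xs @ ys))"
  "\<lbrakk>obj_list xs; obj_list ys\<rbrakk> \<Longrightarrow> app_inv xs ys \<bullet> app xs ys = id0 (tlist xs \<otimes>\<^sub>o tlist ys)"
proof (induction xs)
  case (Cons x xs)
  {
    case 1
    then show ?case
      using Cons by (simp flip: cmp0_assoc[of _ "as_inv _ _ _" "as _ _ _"]) (simp add: interchange0)
  next
    case 2
    have "(id0 x \<odot> app_inv xs ys) \<bullet> (id0 x \<odot> app xs ys) \<bullet> as x (tlist xs) (tlist ys)
        = as x (tlist xs) (tlist ys)"
      using Cons 2 by (simp add: ten_id_cmp0 flip: cmp0_assoc)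
    then show ?case
      using Cons 2 by simp
  }
qed simp_all

text \<open>This is the associativity law of that monoidal structure. By induction on
  \<open>xs\<close>, the base is \<open>lu_ten\<close> and the step the pentagon; it is the
  coherence behind strict associativity.\<close>

lemma app_assoc:
  assumes "obj_list xs" and [simp]: "obj_list ys" "obj_list zs"
  shows "app (xs @ ys) zs \<bullet> (app xs ys \<odot> id0 (tlist zs))
    = app xs (ys @ zs) \<bullet> (id0 (tlist xs) \<odot> app ys zs) \<bullet> as (tlist xs) (tlist ys) (tlist zs)"
  using assms(1)
proof (induction xs)
  case Nil
  have "lu (tlist (ys @ zs)) \<bullet> (id0 \<I> \<odot> app ys zs) \<bullet> as \<I> (tlist ys) (tlist zs)
      = app ys zs \<bullet> lu (tlist ys \<otimes>\<^sub>o tlist zs) \<bullet> as \<I> (tlist ys) (tlist zs)"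
    using lu_natural[of "app ys zs" "tlist (ys @ zs)"] by (simp flip: cmp0_assoc)
  then show ?case
    by (simp add: lu_ten)
next
  case (Cons x xs)
  then have [simp]: "x \<in> Obj C" "obj_list xs" by auto
  let ?x = "id0 x" and ?X = "tlist xs" and ?Y = "tlist ys" and ?Z = "tlist zs"
  have "app ((x # xs) @ ys) zs \<bullet> (app (x # xs) ys \<odot> id0 ?Z)
      = (?x \<odot> app (xs @ ys) zs) \<bullet> (as x (tlist (xs @ ys)) ?Z \<bullet> ((?x \<odot> app xs ys) \<odot> id0 ?Z))
        \<bullet> (as x ?X ?Y \<odot> id0 ?Z)"
    by (simp add: ten_id_cmp0)
  also have "\<dots> = (?x \<odot> (app (xs @ ys) zs \<bullet> (app xs ys \<odot> id0 ?Z)))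
        \<bullet> as x (?X \<otimes>\<^sub>o ?Y) ?Z \<bullet> (as x ?X ?Y \<odot> id0 ?Z)"
    by (simp add: as_natural flip: ten_id_cmp0)
  also have "\<dots> = (?x \<odot> app xs (ys @ zs)) \<bullet> (?x \<odot> (id0 ?X \<odot> app ys zs))
        \<bullet> (?x \<odot> as ?X ?Y ?Z) \<bullet> as x (?X \<otimes>\<^sub>o ?Y) ?Z \<bullet> (as x ?X ?Y \<odot> id0 ?Z)"
    using Cons by (simp flip: ten_id_cmp0)
  also have "\<dots> = (?x \<odot> app xs (ys @ zs)) \<bullet> (?x \<odot> (id0 ?X \<odot> app ys zs))
        \<bullet> as x ?X (?Y \<otimes>\<^sub>o ?Z) \<bullet> as (x \<otimes>\<^sub>o ?X) ?Y ?Z"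
    by (simp add: pentagon0)
  also have "\<dots> = app (x # xs) (ys @ zs) \<bullet> (id0 (tlist (x # xs)) \<odot> app ys zs)
        \<bullet> as (tlist (x # xs)) ?Y ?Z"
    using as_natural[of ?x "id0 ?X" "app ys zs" x ?X "tlist (ys @ zs)"]
    by simp (simp flip: cmp0_assoc)
  finally show ?case .
qed

lemma app_Nil: "obj_list xs \<Longrightarrow> app xs [] = ru (tlist xs)"
  by (induction xs) (simp_all add: lu_unit ru_ten)

section \<open>Additive structure on typed arrows\<close>

context
  fixes X Y
  assumes XY [simp]: "X \<in> Obj C" "Y \<in> Obj C"
begin

interpretation hg: comm_group "hom_group C X Y"
  by (rule hom_comm_group) simp_all

lemma hom_facts:
  "zerom C X Y \<in> Hom C X Y"
  "\<lbrakk>f \<in> Hom C X Y; g \<in> Hom C X Y\<rbrakk> \<Longrightarrow> f \<oplus>\<^sub>m g \<in> Hom C X Y"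
  "f \<in> Hom C X Y \<Longrightarrow> neg C X Y f \<in> Hom C X Y"
  "f \<in> Hom C X Y \<Longrightarrow> f \<oplus>\<^sub>m neg C X Y f = zerom C X Y"
  "f \<in> Hom C X Y \<Longrightarrow> f \<oplus>\<^sub>m zerom C X Y = f"
  "f \<in> Hom C X Y \<Longrightarrow> zerom C X Y \<oplus>\<^sub>m f = f"
  "\<lbrakk>f \<in> Hom C X Y; f \<oplus>\<^sub>m f = f\<rbrakk> \<Longrightarrow> f = zerom C X Y"
  "\<lbrakk>f \<in> Hom C X Y; g \<in> Hom C X Y; f \<oplus>\<^sub>m g = zerom C X Y\<rbrakk> \<Longrightarrow> g = neg C X Y f"
  "\<lbrakk>f \<in> Hom C X Y; g \<in> Hom C X Y\<rbrakk> \<Longrightarrow> f \<oplus>\<^sub>m g = g \<oplus>\<^sub>m f"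
  using hg.one_closed hg.m_closed[of f g] hg.inv_closed[of f] hg.r_inv[of f] hg.r_one[of f]
    hg.l_one[of f] hg.l_cancel_one[of f f] hg.inv_equality[of g f] hg.m_comm[of f g]
  by (auto simp: hom_group_def neg_def)

end

lemma tarr_additive [simp]:
  "\<lbrakk>tarr F; tarr G; src F = src G; trg F = trg G\<rbrakk> \<Longrightarrow> tarr (F \<squnion> G)"
  "tarr F \<Longrightarrow> tarr (neg0 F)"
  "\<lbrakk>X \<in> Obj C; Y \<in> Obj C\<rbrakk> \<Longrightarrow> tarr (zero0 X Y)"
  using hom_facts(1)[of X Y] hom_facts(2)[of "src F" "trg F" "mor F" "mor G"]
    hom_facts(3)[of "src F" "trg F" "mor F"]
  by (auto simp del: tarr_objs simp add: tarr_iff mor_simps)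

lemma cmp0_add:
  "\<lbrakk>tarr F; tarr G; tarr H; src F = src G; trg F = trg G; src H = trg F\<rbrakk>
    \<Longrightarrow> H \<bullet> (F \<squnion> G) = (H \<bullet> F) \<squnion> (H \<bullet> G)"
  "\<lbrakk>tarr F; tarr G; tarr H; src F = src G; trg F = trg G; src F = trg H\<rbrakk>
    \<Longrightarrow> (F \<squnion> G) \<bullet> H = (F \<bullet> H) \<squnion> (G \<bullet> H)"
  using comp_add_right[of "src F" "trg F" "trg H" "mor H" "mor F" "mor G"]
    comp_add_left[of "src H" "src F" "trg F" "mor F" "mor G" "mor H"]
  by (auto simp del: tarr_objs simp add: tarr_iff mor_simps intro!: typed_eqI)

lemma ten0_add:
  "\<lbrakk>tarr F; tarr G; tarr H; src F = src G; trg F = trg G\<rbrakk> \<Longrightarrow> H \<odot> (F \<squnion> G) = (H \<odot> F) \<squnion> (H \<odot> G)"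
  "\<lbrakk>tarr F; tarr G; tarr H; src F = src G; trg F = trg G\<rbrakk> \<Longrightarrow> (F \<squnion> G) \<odot> H = (F \<odot> H) \<squnion> (G \<odot> H)"
  using tensor_add_right[of "src H" "trg H" "src F" "trg F" "mor H" "mor F" "mor G"]
    tensor_add_left[of "src F" "trg F" "src H" "trg H" "mor F" "mor G" "mor H"]
  by (auto simp del: tarr_objs simp add: tarr_iff mor_simps intro!: typed_eqI)

lemma add0_facts:
  "tarr F \<Longrightarrow> F \<squnion> neg0 F = zero0 (src F) (trg F)"
  "tarr F \<Longrightarrow> F \<squnion> zero0 (src F) (trg F) = F"
  "tarr F \<Longrightarrow> zero0 (src F) (trg F) \<squnion> F = F"
  "\<lbrakk>tarr F; tarr G; src G = src F; trg G = trg F; F \<squnion> G = zero0 (src F) (trg F)\<rbrakk> \<Longrightarrow> G = neg0 F"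
  using hom_facts(4-6)[of "src F" "trg F" "mor F"] hom_facts(8)[of "src F" "trg F" "mor F" "mor G"]
  by (auto simp del: tarr_objs simp add: tarr_iff mor_simps typed_defs intro!: typed_eqI)

lemma add0_zero:
  "\<lbrakk>tarr F; src F = X; trg F = Y\<rbrakk> \<Longrightarrow> F \<squnion> zero0 X Y = F"
  "\<lbrakk>tarr F; src F = X; trg F = Y\<rbrakk> \<Longrightarrow> zero0 X Y \<squnion> F = F"
  using add0_facts(2,3)[of F] by auto

text \<open>Zero is the only arrow equal to its own double, so every additive operation preserves
  it.\<close>

lemma add0_idem:
  assumes "tarr F" "F \<squnion> F = F"
  shows "F = zero0 (src F) (trg F)"
proof -
  have "mor F \<oplus>\<^sub>m mor F = mor F"
    using arg_cong[OF assms(2), of mor] by (simp add: mor_simps)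
  then show ?thesis
    using hom_facts(7)[of "src F" "trg F" "mor F"] assms(1) mor_in
    by (auto simp: typed_defs intro!: typed_eqI)
qed

lemma cmp0_zero:
  "\<lbrakk>tarr H; X \<in> Obj C; src H = Y\<rbrakk> \<Longrightarrow> H \<bullet> zero0 X Y = zero0 X (trg H)"
  "\<lbrakk>tarr H; Y \<in> Obj C; trg H = X\<rbrakk> \<Longrightarrow> zero0 X Y \<bullet> H = zero0 (src H) Y"
  using add0_idem[of "H \<bullet> zero0 X Y"] cmp0_add(1)[of "zero0 X Y" "zero0 X Y" H]
    add0_idem[of "zero0 X Y \<bullet> H"] cmp0_add(2)[of "zero0 X Y" "zero0 X Y" H]
    add0_facts(2)[of "zero0 X Y"] by auto

lemma ten0_zero:
  "\<lbrakk>tarr H; X \<in> Obj C; Y \<in> Obj C\<rbrakk> \<Longrightarrow> H \<odot> zero0 X Y = zero0 (src H \<otimes>\<^sub>o X) (trg H \<otimes>\<^sub>o Y)"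
  using add0_idem[of "H \<odot> zero0 X Y"] ten0_add(1)[of "zero0 X Y" "zero0 X Y" H]
    add0_facts(2)[of "zero0 X Y"] by auto

text \<open>A negative is characterised by its sum with the original being zero, and additive
  operations preserve such sums.\<close>

lemma cmp0_neg:
  "\<lbrakk>tarr F; tarr H; src H = trg F\<rbrakk> \<Longrightarrow> H \<bullet> neg0 F = neg0 (H \<bullet> F)"
  "\<lbrakk>tarr F; tarr H; src F = trg H\<rbrakk> \<Longrightarrow> neg0 F \<bullet> H = neg0 (F \<bullet> H)"
  "\<lbrakk>tarr F; tarr H\<rbrakk> \<Longrightarrow> H \<odot> neg0 F = neg0 (H \<odot> F)"
  by (rule add0_facts(4); simp add: add0_facts(1) cmp0_zero ten0_zero
      flip: cmp0_add ten0_add)+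

section \<open>The strict category of lists\<close>

type_synonym (in -) ('a, 'b) strict = "'a list \<times> 'b \<times> 'a list"

definition sdom :: "('o, 'm) strict \<Rightarrow> 'o list" where "sdom F = fst F"
definition scod :: "('o, 'm) strict \<Rightarrow> 'o list" where "scod F = snd (snd F)"
text \<open>Strict arrows store lists, as the object \<open>tlist xs\<close> alone need not tell how
  it is cut into strands; \<open>ty\<close> forgets the cutting.\<close>

definition ty :: "('o, 'm) strict \<Rightarrow> ('o, 'm) typed" where
  "ty F = (tlist (sdom F), fst (snd F), tlist (scod F))"
definition mk :: "'o list \<Rightarrow> ('o, 'm) typed \<Rightarrow> 'o list \<Rightarrow> ('o, 'm) strict" where
  "mk xs F ys = (xs, mor F, ys)"
definition sarr :: "('o, 'm) strict \<Rightarrow> bool" where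
  "sarr F \<longleftrightarrow> obj_list (sdom F) \<and> obj_list (scod F) \<and> tarr (ty F)"

lemma mk_simps [simp]: "sdom (mk xs F ys) = xs" "scod (mk xs F ys) = ys"
  "\<lbrakk>src F = tlist xs; trg F = tlist ys\<rbrakk> \<Longrightarrow> ty (mk xs F ys) = F"
  "src (ty G) = tlist (sdom G)" "trg (ty G) = tlist (scod G)"
  by (auto simp: mk_def sdom_def scod_def ty_def intro: typed_eqI)

lemma strict_eqI: "\<lbrakk>sdom F = sdom G; scod F = scod G; ty F = ty G\<rbrakk> \<Longrightarrow> F = G"
  by (auto simp: sdom_def scod_def ty_def prod_eq_iff)

definition scmp (infixr "\<star>" 70) where
  "G \<star> F = mk (sdom F) (ty G \<bullet> ty F) (scod G)"
definition sten (infixr "\<box>" 75) where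
  "F \<box> G = mk (sdom F @ sdom G) (app (scod F) (scod G) \<bullet> (ty F \<odot> ty G) \<bullet> app_inv (sdom F) (sdom G))
     (scod F @ scod G)"
definition sone where "sone xs = mk xs (id0 (tlist xs)) xs"
definition ssw where
  "ssw xs ys = mk (xs @ ys) (app ys xs \<bullet> sy (tlist xs) (tlist ys) \<bullet> app_inv xs ys) (ys @ xs)"
definition sadd (infixl "\<boxplus>" 65) where "F \<boxplus> G = mk (sdom F) (ty F \<squnion> ty G) (scod F)"
definition sneg where "sneg F = mk (sdom F) (neg0 (ty F)) (scod F)"
definition szero where "szero xs ys = mk xs (zero0 (tlist xs) (tlist ys)) ys"

lemmas strict_defs = scmp_def sten_def sone_def ssw_def sadd_def sneg_def szero_def

lemma ty_simps:
  "ty (G \<star> F) = ty G \<bullet> ty F"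
  "ty (F \<box> G) = app (scod F) (scod G) \<bullet> (ty F \<odot> ty G) \<bullet> app_inv (sdom F) (sdom G)"
  "ty (sone xs) = id0 (tlist xs)"
  "ty (ssw xs ys) = app ys xs \<bullet> sy (tlist xs) (tlist ys) \<bullet> app_inv xs ys"
  "ty (F \<boxplus> G) = ty F \<squnion> ty G" "ty (sneg F) = neg0 (ty F)"
  "ty (szero xs ys) = zero0 (tlist xs) (tlist ys)"
  by (simp_all add: strict_defs)

lemma sdom_scod [simp]:
  "sdom (G \<star> F) = sdom F" "scod (G \<star> F) = scod G"
  "sdom (F \<box> G) = sdom F @ sdom G" "scod (F \<box> G) = scod F @ scod G"
  "sdom (sone xs) = xs" "scod (sone xs) = xs"
  "sdom (ssw xs ys) = xs @ ys" "scod (ssw xs ys) = ys @ xs"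
  "sdom (F \<boxplus> G) = sdom F" "scod (F \<boxplus> G) = scod F" "sdom (sneg F) = sdom F" "scod (sneg F) = scod F"
  "sdom (szero xs ys) = xs" "scod (szero xs ys) = ys"
  by (simp_all add: strict_defs)

lemma sarrD [simp]: "sarr F \<Longrightarrow> obj_list (sdom F)" "sarr F \<Longrightarrow> obj_list (scod F)" "sarr F \<Longrightarrow> tarr (ty F)"
  by (simp_all add: sarr_def)

lemma sarrI: "\<lbrakk>obj_list (sdom F); obj_list (scod F); tarr (ty F)\<rbrakk> \<Longrightarrow> sarr F"
  unfolding sarr_def by blast

lemma sten_app:
  "\<lbrakk>sarr F; sarr G; a = sdom F; b = sdom G\<rbrakk>
    \<Longrightarrow> ty (F \<box> G) \<bullet> app a b = app (scod F) (scod G) \<bullet> (ty F \<odot> ty G)"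
  by (simp add: ty_simps)

lemma ssw_app:
  "\<lbrakk>obj_list xs; obj_list ys\<rbrakk> \<Longrightarrow> ty (ssw xs ys) \<bullet> app xs ys = app ys xs \<bullet> sy (tlist xs) (tlist ys)"
  by (simp add: ty_simps)

text \<open>Composites are normalised to the right, so an equation of composites has to be
  applicable in front of a tail \<open>L\<close>.\<close>

lemma cmp0_rewrite:
  assumes "G \<bullet> F = H \<bullet> K" "tarr F" "tarr G" "tarr H" "tarr K" "tarr L" "src G = trg F" "src H = trg K" "src F = trg L"
  shows "G \<bullet> F \<bullet> L = H \<bullet> K \<bullet> L"
proof -
  have "src K = src F" by (metis assms(1) src_trg(1))
  then show ?thesis
    using assms by (metis cmp0_assoc)
qed

lemma cmp0_cancel:
  "\<lbrakk>G \<bullet> F = id0 X; tarr F; tarr G; tarr L; src G = trg F; src F = trg L; trg L = X\<rbrakk> \<Longrightarrow> G \<bullet> F \<bullet> L = L"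
  by (simp flip: cmp0_assoc)

text \<open>Arrows out of \<open>tlist (a @ b @ c)\<close> can be compared on the left-bracketed
  product of the three blocks, where \<open>sten\<close> and \<open>ssw\<close> unfold to the
  operations of \<open>C\<close>.\<close>

lemma app_cancel:
  assumes "tarr F" "tarr G" "src F = tlist (a @ b @ c)" "src G = tlist (a @ b @ c)"
    and [simp]: "obj_list a" "obj_list b" "obj_list c"
    and "F \<bullet> app (a @ b) c \<bullet> (app a b \<odot> id0 (tlist c)) = G \<bullet> app (a @ b) c \<bullet> (app a b \<odot> id0 (tlist c))"
  shows "F = G"
proof -
  let ?P = "app (a @ b) c \<bullet> (app a b \<odot> id0 (tlist c))"
  let ?Q = "(app_inv a b \<odot> id0 (tlist c)) \<bullet> app_inv (a @ b) c"
  have "(app a b \<odot> id0 (tlist c)) \<bullet> (app_inv a b \<odot> id0 (tlist c)) \<bullet> app_inv (a @ b) c = app_inv (a @ b) c"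
    by (simp add: ten_id_cmp0 flip: cmp0_assoc)
  then have "?P \<bullet> ?Q = id0 (tlist (a @ b @ c))"
    by simp
  then show ?thesis
    using assms by (intro cancel0_right[where F = F and G = G and H = ?P and H' = ?Q]) simp_all
qed

text \<open>Read on left-bracketed products, the two sides differ by an associator at each end.
  Naturality moves it through the boxes and \<open>app_assoc\<close> absorbs it, which turns the
  associator into an equality.\<close>

lemma sten_assoc:
  assumes [simp]: "sarr F" "sarr G" "sarr H"
  shows "(F \<box> G) \<box> H = F \<box> (G \<box> H)"
proof (rule strict_eqI)
  let ?a = "sdom F" and ?b = "sdom G" and ?c = "sdom H"
    and ?a' = "scod F" and ?b' = "scod G" and ?c' = "scod H"
  have [simp]: "sarr (F \<box> G)" "sarr (G \<box> H)" "sarr ((F \<box> G) \<box> H)" "sarr (F \<box> (G \<box> H))"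
    by (auto intro!: sarrI simp: ty_simps)
  have "ty ((F \<box> G) \<box> H) \<bullet> app (?a @ ?b) ?c \<bullet> (app ?a ?b \<odot> id0 (tlist ?c))
      = app (?a' @ ?b') ?c' \<bullet> (ty (F \<box> G) \<odot> ty H) \<bullet> (app ?a ?b \<odot> id0 (tlist ?c))"
    by (simp add: cmp0_rewrite[OF sten_app])
  also have "\<dots> = (app (?a' @ ?b') ?c' \<bullet> (app ?a' ?b' \<odot> id0 (tlist ?c'))) \<bullet> ((ty F \<odot> ty G) \<odot> ty H)"
    by (simp add: interchange0 sten_app)
  also have "\<dots> = app ?a' (?b' @ ?c') \<bullet> (id0 (tlist ?a') \<odot> app ?b' ?c') \<bullet> (ty F \<odot> (ty G \<odot> ty H)) \<bullet> as (tlist ?a) (tlist ?b) (tlist ?c)"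
    by (simp add: app_assoc as_natural)
  also have "\<dots> = app ?a' (?b' @ ?c') \<bullet> (ty F \<odot> ty (G \<box> H)) \<bullet> (id0 (tlist ?a) \<odot> app ?b ?c) \<bullet> as (tlist ?a) (tlist ?b) (tlist ?c)"
    by (simp add: interchange0 sten_app flip: cmp0_assoc)
  also have "\<dots> = ty (F \<box> (G \<box> H)) \<bullet> app (?a @ ?b) ?c \<bullet> (app ?a ?b \<odot> id0 (tlist ?c))"
    by (simp add: app_assoc cmp0_rewrite[OF sten_app])
  finally show "ty ((F \<box> G) \<box> H) = ty (F \<box> (G \<box> H))"
    by (rule app_cancel[rotated -1]) simp_all
qed simp_all

lemma sone_sten: "sarr F \<Longrightarrow> sone [] \<box> F = F"
  by (auto intro!: strict_eqI simp: ty_simps cmp0_rewrite[OF lu_natural])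

lemma app_inv_Nil: "obj_list xs \<Longrightarrow> app_inv xs [] = ru_inv (tlist xs)"
  by (rule cancel0_left[where H = "ru (tlist xs)" and H' = "ru_inv (tlist xs)"])
    (use app_app_inv(1)[of xs "[]"] in \<open>simp_all add: app_Nil\<close>)

lemma sten_sone: "sarr F \<Longrightarrow> F \<box> sone [] = F"
  by (auto intro!: strict_eqI simp: ty_simps app_Nil app_inv_Nil cmp0_rewrite[OF ru_natural])

text \<open>The hexagon of \<open>C\<close> with its associators absorbed by
  \<open>app_assoc\<close>.\<close>

lemma ssw_append:
  assumes [simp]: "obj_list xs" "obj_list ys" "obj_list zs"
  shows "ssw xs (ys @ zs) = (sone ys \<box> ssw xs zs) \<star> (ssw xs ys \<box> sone zs)"
proof (rule strict_eqI)
  let ?X = "tlist xs" and ?Y = "tlist ys" and ?Z = "tlist zs"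
  have [simp]: "sarr (sone ys)" "sarr (sone zs)" "sarr (ssw xs zs)" "sarr (ssw xs ys)"
    "tarr (ty (sone ys \<box> ssw xs zs))" "tarr (ty (ssw xs ys \<box> sone zs))" "tarr (ty (ssw xs (ys @ zs)))"
    by (auto intro!: sarrI simp: ty_simps)
  have "ty (ssw xs (ys @ zs)) \<bullet> app (xs @ ys) zs \<bullet> (app xs ys \<odot> id0 ?Z)
      = app (ys @ zs) xs \<bullet> (sy ?X (tlist (ys @ zs)) \<bullet> (id0 ?X \<odot> app ys zs)) \<bullet> as ?X ?Y ?Z"
    by (simp add: app_assoc cmp0_rewrite[OF ssw_app])
  also have "\<dots> = (app (ys @ zs) xs \<bullet> (app ys zs \<odot> id0 ?X)) \<bullet> sy ?X (?Y \<otimes>\<^sub>o ?Z) \<bullet> as ?X ?Y ?Z"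
    by (simp add: sy_natural)
  also have "\<dots> = app ys (zs @ xs) \<bullet> (id0 ?Y \<odot> app zs xs) \<bullet> as ?Y ?Z ?X \<bullet> sy ?X (?Y \<otimes>\<^sub>o ?Z) \<bullet> as ?X ?Y ?Z"
    by (simp add: app_assoc)
  also have "\<dots> = app ys (zs @ xs) \<bullet> (id0 ?Y \<odot> (app zs xs \<bullet> sy ?X ?Z)) \<bullet> as ?Y ?X ?Z \<bullet> (sy ?X ?Y \<odot> id0 ?Z)"
    by (simp add: hexagon0 flip: ten_id_cmp0)
  also have "\<dots> = app ys (zs @ xs) \<bullet> (ty (sone ys) \<odot> ty (ssw xs zs)) \<bullet> (id0 ?Y \<odot> app xs zs)
      \<bullet> as ?Y ?X ?Z \<bullet> (sy ?X ?Y \<odot> id0 ?Z)"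
    by (simp add: ty_simps(3) ssw_app flip: ten_id_cmp0) (simp add: ten_id_cmp0 ssw_app flip: cmp0_assoc)
  also have "\<dots> = ty (sone ys \<box> ssw xs zs) \<bullet> app (ys @ xs) zs \<bullet> (app ys xs \<odot> id0 ?Z) \<bullet> (sy ?X ?Y \<odot> id0 ?Z)"
    by (simp add: cmp0_rewrite[OF app_assoc] cmp0_rewrite[OF sten_app])
  also have "\<dots> = ty (sone ys \<box> ssw xs zs) \<bullet> app (ys @ xs) zs \<bullet> (ty (ssw xs ys) \<odot> ty (sone zs)) \<bullet> (app xs ys \<odot> id0 ?Z)"
    by (simp add: ty_simps(3) ten_id_cmp0 ssw_app)
  also have "\<dots> = ty ((sone ys \<box> ssw xs zs) \<star> (ssw xs ys \<box> sone zs)) \<bullet> app (xs @ ys) zs \<bullet> (app xs ys \<odot> id0 ?Z)"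
    by (simp add: ty_simps(1) cmp0_rewrite[OF sten_app])
  finally show "ty (ssw xs (ys @ zs)) = ty ((sone ys \<box> ssw xs zs) \<star> (ssw xs ys \<box> sone zs))"
    by (rule app_cancel[rotated -1]) (simp_all add: ty_simps(1))
qed simp_all

sublocale strict: strict_smc obj_list sarr sdom scod scmp sten sone ssw sadd sneg szero
proof
  fix F G H F' G' :: "('o, 'm) strict" and xs ys zs
  show "\<lbrakk>sarr F; sarr G; sdom G = scod F\<rbrakk> \<Longrightarrow> sarr (G \<star> F)"
    and "\<lbrakk>sarr F; sarr G\<rbrakk> \<Longrightarrow> sarr (F \<box> G)"
    and "obj_list xs \<Longrightarrow> sarr (sone xs)" and "\<lbrakk>obj_list xs; obj_list ys\<rbrakk> \<Longrightarrow> sarr (ssw xs ys)"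
    and "\<lbrakk>sarr F; sarr G; sdom F = sdom G; scod F = scod G\<rbrakk> \<Longrightarrow> sarr (F \<boxplus> G)"
    and "sarr F \<Longrightarrow> sarr (sneg F)" and "\<lbrakk>obj_list xs; obj_list ys\<rbrakk> \<Longrightarrow> sarr (szero xs ys)"
    by (auto intro!: sarrI simp: ty_simps)
  show "\<lbrakk>sarr F; sarr G; sarr H\<rbrakk> \<Longrightarrow> (F \<box> G) \<box> H = F \<box> (G \<box> H)"
    by (rule sten_assoc)
  show "\<lbrakk>sarr F; sarr G; sarr F'; sarr G'; sdom G = scod F; sdom G' = scod F'\<rbrakk>
      \<Longrightarrow> (G \<box> G') \<star> (F \<box> F') = (G \<star> F) \<box> (G' \<star> F')"
    by (auto intro!: strict_eqI simp: ty_simps cmp0_cancel[OF app_app_inv(2)] simp flip: interchange0)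
  show "\<lbrakk>sarr F; sarr G; scod F = xs; scod G = ys\<rbrakk> \<Longrightarrow> ssw xs ys \<star> (F \<box> G) = (G \<box> F) \<star> ssw (sdom F) (sdom G)"
    by (auto intro!: strict_eqI simp: ty_simps cmp0_cancel[OF app_app_inv(2)] cmp0_rewrite[OF sy_natural])
  show "\<lbrakk>obj_list xs; obj_list ys\<rbrakk> \<Longrightarrow> ssw ys xs \<star> ssw xs ys = sone (xs @ ys)"
    by (auto intro!: strict_eqI simp: ty_simps cmp0_cancel[OF app_app_inv(2)] cmp0_cancel[OF sy_sy])
  show "\<lbrakk>obj_list xs; obj_list ys; obj_list zs\<rbrakk> \<Longrightarrow> ssw xs (ys @ zs) = (sone ys \<box> ssw xs zs) \<star> (ssw xs ys \<box> sone zs)"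
    by (rule ssw_append)
  show "obj_list xs \<Longrightarrow> ssw xs [] = sone xs"
    by (rule strict_eqI) (simp_all add: ty_simps app_inv_Nil lu_sy flip: cmp0_assoc)
  show "\<lbrakk>sarr F; sarr G; sarr H; sdom F = sdom G; scod F = scod G\<rbrakk> \<Longrightarrow> H \<box> (F \<boxplus> G) = (H \<box> F) \<boxplus> (H \<box> G)"
    by (auto intro!: strict_eqI simp: ty_simps ten0_add cmp0_add)
  show "\<lbrakk>sarr F; sarr H\<rbrakk> \<Longrightarrow> H \<box> sneg F = sneg (H \<box> F)"
    by (auto intro!: strict_eqI simp: ty_simps cmp0_neg)
  show "\<lbrakk>obj_list xs; obj_list ys; obj_list zs\<rbrakk> \<Longrightarrow> sone zs \<box> szero xs ys = szero (zs @ xs) (zs @ ys)"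
    by (auto intro!: strict_eqI simp: ty_simps ten0_zero cmp0_zero)
qed (auto intro!: strict_eqI sone_sten sten_sone simp: ty_simps cmp0_add cmp0_neg cmp0_zero add0_zero)

end

section \<open>Charts and the strict arrows they represent\<close>

datatype ('o, 'm) chart =
  Chart (ob: 'o) (wires: "'o list") (chart_to: "('o, 'm) typed") (chart_from: "('o, 'm) typed")

context additive_symmetric_monoidal_category
begin

text \<open>An object may have many charts with different numbers of wires. Passing between them is
  what regroups \<Sigma> and M as the single object \<Sigma> \<otimes> M.\<close>

definition chart :: "('o, 'm) chart \<Rightarrow> bool" where
  "chart e \<longleftrightarrow> ob e \<in> Obj C \<and> obj_list (wires e) \<and> tarr (chart_to e) \<and> tarr (chart_from e) \<and>
     src (chart_to e) = ob e \<and> trg (chart_to e) = tlist (wires e) \<and> src (chart_from e) = tlist (wires e) \<and> trg (chart_from e) = ob e \<and>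
     chart_from e \<bullet> chart_to e = id0 (ob e) \<and> chart_to e \<bullet> chart_from e = id0 (tlist (wires e))"

lemma chartD [simp]:
  assumes "chart e"
  shows "ob e \<in> Obj C" "obj_list (wires e)" "tarr (chart_to e)" "tarr (chart_from e)"
    "src (chart_to e) = ob e" "trg (chart_to e) = tlist (wires e)" "src (chart_from e) = tlist (wires e)" "trg (chart_from e) = ob e"
    "chart_from e \<bullet> chart_to e = id0 (ob e)" "chart_to e \<bullet> chart_from e = id0 (tlist (wires e))"
  using assms unfolding chart_def by simp_all

text \<open>Since \<open>tlist [X]\<close> ends in a trailing \<I>, even a single wire needs the
  right unit isomorphism.\<close>

definition atom :: "'o \<Rightarrow> ('o, 'm) chart" where "atom X = Chart X [X] (ru_inv X) (ru X)"
text \<open>Having no wires, \<I> vanishes from the strict diagrams; this realises the suspension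
  \<open>[]\<close>.\<close>

definition unit_chart :: "('o, 'm) chart" where "unit_chart = Chart \<I> [] (id0 \<I>) (id0 \<I>)"
definition chart_ten :: "('o, 'm) chart \<Rightarrow> ('o, 'm) chart \<Rightarrow> ('o, 'm) chart" (infixr "##" 75) where
  "e ## e' = Chart (ob e \<otimes>\<^sub>o ob e') (wires e @ wires e')
     (app (wires e) (wires e') \<bullet> (chart_to e \<odot> chart_to e')) ((chart_from e \<odot> chart_from e') \<bullet> app_inv (wires e) (wires e'))"

lemma chart_simps [simp]:
  "ob (atom X) = X" "wires (atom X) = [X]" "ob unit_chart = \<I>" "wires unit_chart = []"
  "ob (e ## e') = ob e \<otimes>\<^sub>o ob e'" "wires (e ## e') = wires e @ wires e'"
  by (simp_all add: atom_def unit_chart_def chart_ten_def)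

lemma ten_chart_simps:
  "chart_to (e ## e') = app (wires e) (wires e') \<bullet> (chart_to e \<odot> chart_to e')"
  "chart_from (e ## e') = (chart_from e \<odot> chart_from e') \<bullet> app_inv (wires e) (wires e')"
  "chart_to unit_chart = id0 \<I>" "chart_from unit_chart = id0 \<I>"
  by (simp_all add: chart_ten_def unit_chart_def)

lemma interchange0_cmp:
  "\<lbrakk>tarr F; tarr G; tarr F'; tarr G'; tarr L; src G = trg F; src G' = trg F'; trg L = src F \<otimes>\<^sub>o src F'\<rbrakk>
    \<Longrightarrow> (G \<odot> G') \<bullet> (F \<odot> F') \<bullet> L = ((G \<bullet> F) \<odot> (G' \<bullet> F')) \<bullet> L"
  by (simp add: interchange0 flip: cmp0_assoc)

lemma valid_atom [simp]: "X \<in> Obj C \<Longrightarrow> chart (atom X)"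
  by (simp add: chart_def atom_def)

lemma valid_unit_chart [simp]: "chart unit_chart"
  by (simp add: chart_def unit_chart_def)

lemma chart_ten [simp]: "\<lbrakk>chart e; chart e'\<rbrakk> \<Longrightarrow> chart (e ## e')"
  unfolding chart_def[of "e ## e'"]
  by (simp add: ten_chart_simps cmp0_cancel[OF app_app_inv(2)] interchange0
      interchange0_cmp)

definition transport :: "('o, 'm) chart \<Rightarrow> ('o, 'm) typed \<Rightarrow> ('o, 'm) chart \<Rightarrow> ('o, 'm) strict" where
  "transport e G e' = mk (wires e) (chart_to e' \<bullet> G \<bullet> chart_from e) (wires e')"

lemma transport_simps [simp]: "sdom (transport e G e') = wires e" "scod (transport e G e') = wires e'"
  "\<lbrakk>chart e; chart e'\<rbrakk> \<Longrightarrow> ty (transport e G e') = chart_to e' \<bullet> G \<bullet> chart_from e"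
  by (simp_all add: transport_def)

lemma sarr_transport [simp]: "\<lbrakk>chart e; chart e'; tarr G; src G = ob e; trg G = ob e'\<rbrakk> \<Longrightarrow> sarr (transport e G e')"
  by (auto intro: sarrI)

text \<open>The charts and \<open>f\<close> determine \<open>F\<close>. Stated as a relation, this
  can be proved by rules that follow the structure of \<open>f\<close> and construct the charts and
  \<open>F\<close> by unification.\<close>

definition repr :: "('o, 'm) chart \<Rightarrow> 'm \<Rightarrow> ('o, 'm) chart \<Rightarrow> ('o, 'm) strict \<Rightarrow> bool" where
  "repr e f e' F \<longleftrightarrow> chart e \<and> chart e' \<and> f \<in> Hom C (ob e) (ob e') \<and> F = transport e (ob e, f, ob e') e'"

lemma reprI:
  assumes "chart e" "chart e'" "tarr G" "src G = ob e" "trg G = ob e'" "f = mor G" "F = transport e G e'"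
  shows "repr e f e' F"
proof -
  have "G = (ob e, f, ob e')"
    by (rule typed_eqI) (simp_all add: assms)
  then show ?thesis
    using assms mor_in[of G] by (simp add: repr_def)
qed

lemma reprE:
  assumes "repr e f e' F"
  obtains G where "chart e" "chart e'" "tarr G" "src G = ob e" "trg G = ob e'" "f = mor G" "F = transport e G e'"
  using assms unfolding repr_def by (metis tarr_iff typed_simps chartD(1))

lemma repr_arr:
  assumes "repr e f e' F"
  shows "sarr F" "sdom F = wires e" "scod F = wires e'" "f \<in> Hom C (ob e) (ob e')" "chart e" "chart e'"
proof -
  show "f \<in> Hom C (ob e) (ob e')"
    using assms unfolding repr_def by blast
qed (use assms in \<open>auto elim!: reprE\<close>)

lemma transport_eq_iff:
  assumes "chart e" "chart e'" "tarr G" "tarr H" "src G = ob e" "src H = ob e" "trg G = ob e'" "trg H = ob e'"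
  shows "transport e G e' = transport e H e' \<longleftrightarrow> G = H"
proof
  assume "transport e G e' = transport e H e'"
  then have "chart_to e' \<bullet> G \<bullet> chart_from e = chart_to e' \<bullet> H \<bullet> chart_from e"
    using assms by (metis transport_simps(3))
  then have "G \<bullet> chart_from e = H \<bullet> chart_from e"
    by (rule cancel0_left[rotated -1, where H' = "chart_from e'"]) (use assms in simp_all)
  then show "G = H"
    by (rule cancel0_right[rotated -1, where H' = "chart_to e"]) (use assms in simp_all)
qed simp

lemma repr_iff: "\<lbrakk>repr e f e' F; repr e g e' G\<rbrakk> \<Longrightarrow> f = g \<longleftrightarrow> F = G"
  unfolding repr_def by (auto simp del: tarr_objs simp: transport_eq_iff tarr_iff)

text \<open>The scheme of every translation below: the rules \<open>repr_rules\<close> find strict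
  arrows for both sides, and simplification brings their equation into the form
  \<open>Q\<close>.\<close>

lemma repr_eq_iff: "\<lbrakk>repr e f e' F; repr e g e' G; (F = G) = Q\<rbrakk> \<Longrightarrow> (f = g) = Q"
  by (simp add: repr_iff)

lemma repr_cong: "\<lbrakk>repr e f e' F; F = G\<rbrakk> \<Longrightarrow> repr e f e' G"
  by simp

lemma repr_exists: "\<lbrakk>chart e; chart e'; f \<in> Hom C (ob e) (ob e')\<rbrakk> \<Longrightarrow> \<exists>F. repr e f e' F"
  by (simp add: repr_def)

text \<open>Brings constructions back: an arrow found in the strict calculus, such as a quotient by
  \<Sigma>, comes from one of \<open>C\<close>.\<close>

lemma repr_surj:
  assumes "chart e" "chart e'" "sarr F" "sdom F = wires e" "scod F = wires e'"
  shows "\<exists>f. repr e f e' F"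
proof
  have "transport e (chart_from e' \<bullet> ty F \<bullet> chart_to e) e' = F"
    using assms by (auto intro!: strict_eqI simp: cmp0_cancel[OF chartD(10)])
  then show "repr e (mor (chart_from e' \<bullet> ty F \<bullet> chart_to e)) e' F"
    using assms by (intro reprI[where G = "chart_from e' \<bullet> ty F \<bullet> chart_to e"]) simp_all
qed

lemma repr_comp:
  assumes "repr e f e' F" "repr e' g e'' G"
  shows "repr e (g \<cdot> f) e'' (G \<star> F)"
  using assms
  by (elim reprE, intro reprI[where G = "_ \<bullet> _"])
    (auto simp: mor_simps ty_simps cmp0_cancel[OF chartD(9)] intro!: strict_eqI)

lemma repr_ten:
  assumes "repr e f e' F" "repr u g u' G"
  shows "repr (e ## u) (f \<otimes>\<^sub>m g) (e' ## u') (F \<box> G)"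
  using assms
  by (elim reprE, intro reprI[where G = "_ \<odot> _"])
    (auto simp: mor_simps ty_simps ten_chart_simps interchange0_cmp interchange0 intro!: strict_eqI)

lemma repr_ident: "\<lbrakk>chart e; X = ob e\<rbrakk> \<Longrightarrow> repr e \<langle>X\<rangle> e (sone (wires e))"
  by (intro reprI[where G = "id0 X"]) (auto simp: mor_simps ty_simps intro!: strict_eqI)

text \<open>The two product charts differ exactly by the associator and \<open>app_assoc\<close>, so
  between them the associator is an identity.\<close>

lemma transport_as:
  assumes [simp]: "chart e1" "chart e2" "chart e3"
  shows "transport ((e1 ## e2) ## e3) (as (ob e1) (ob e2) (ob e3)) (e1 ## (e2 ## e3)) = sone (wires e1 @ wires e2 @ wires e3)"
    (is "?l = ?r")
proof (rule strict_eqI)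
  let ?a = "wires e1" and ?b = "wires e2" and ?c = "wires e3"
  have "ty ?l \<bullet> app (?a @ ?b) ?c \<bullet> (app ?a ?b \<odot> id0 (tlist ?c))
      = app ?a (?b @ ?c) \<bullet> (chart_to e1 \<odot> (app ?b ?c \<bullet> (chart_to e2 \<odot> chart_to e3))) \<bullet>
        as (ob e1) (ob e2) (ob e3) \<bullet> (((chart_from e1 \<odot> chart_from e2) \<bullet> app_inv ?a ?b \<bullet> app ?a ?b) \<odot> chart_from e3)"
    by (simp add: ten_chart_simps cmp0_cancel[OF app_app_inv(2)] interchange0)
  also have "\<dots> = app ?a (?b @ ?c) \<bullet> (id0 (tlist ?a) \<odot> app ?b ?c) \<bullet> (chart_to e1 \<odot> (chart_to e2 \<odot> chart_to e3)) \<bullet>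
      (chart_from e1 \<odot> (chart_from e2 \<odot> chart_from e3)) \<bullet> as (tlist ?a) (tlist ?b) (tlist ?c)"
    by (simp add: as_natural interchange0_cmp interchange0)
  also have "\<dots> = app (?a @ ?b) ?c \<bullet> (app ?a ?b \<odot> id0 (tlist ?c))"
    by (simp add: interchange0_cmp interchange0 app_assoc)
  finally show "ty ?l = ty ?r"
    by (intro app_cancel[where F = "ty ?l" and G = "ty ?r" and a = ?a and b = ?b and c = ?c])
      (simp_all add: ty_simps(3) del: transport_simps(3))
qed simp_all

lemma repr_assoc:
  "\<lbrakk>chart e1; chart e2; chart e3; X = ob e1; Y = ob e2; Z = ob e3\<rbrakk>
    \<Longrightarrow> repr ((e1 ## e2) ## e3) (\<alpha> X Y Z) (e1 ## (e2 ## e3)) (sone (wires e1 @ wires e2 @ wires e3))"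
  by (intro reprI[where G = "as X Y Z"]) (auto simp: mor_simps transport_as)

text \<open>If an isomorphism becomes an identity in charts, so does its inverse. This covers
  \<open>assoc_inv\<close> and \<open>lunit_inv\<close>.\<close>

lemma transport_inverse:
  assumes "chart e" "chart e'" "tarr G" "tarr H" "src G = ob e" "trg G = ob e'" "src H = ob e'" "trg H = ob e"
    "G \<bullet> H = id0 (ob e')" "transport e G e' = sone (wires e)" "wires e' = wires e"
  shows "transport e' H e = sone (wires e)"
proof -
  have "transport e G e' \<star> transport e' H e = sone (wires e)"
    using assms(1-9,11)
    by (auto intro!: strict_eqI simp: ty_simps cmp0_cancel[OF chartD(9)] cmp0_cancel[OF assms(9)])
  then show ?thesis
    using assms by simp
qed

lemma repr_assoc_inv:
  assumes "chart e1" "chart e2" "chart e3" "X = ob e1" "Y = ob e2" "Z = ob e3"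
  shows "repr (e1 ## (e2 ## e3)) (assoc_inv C X Y Z) ((e1 ## e2) ## e3) (sone (wires e1 @ wires e2 @ wires e3))"
  using assms transport_inverse[of "(e1 ## e2) ## e3" "e1 ## (e2 ## e3)" "as X Y Z" "as_inv X Y Z"] transport_as[of e1 e2 e3]
  by (intro reprI[where G = "as_inv X Y Z"]) (auto simp: mor_simps)

lemma repr_symm:
  "\<lbrakk>chart e1; chart e2; X = ob e1; Y = ob e2\<rbrakk>
    \<Longrightarrow> repr (e1 ## e2) (\<tau> X Y) (e2 ## e1) (ssw (wires e1) (wires e2))"
  by (intro reprI[where G = "sy X Y"])
    (auto simp: mor_simps ty_simps ten_chart_simps sy_natural interchange0 cmp0_rewrite[OF sy_natural]
      interchange0_cmp intro!: strict_eqI)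

lemma transport_lu: "chart e \<Longrightarrow> transport (unit_chart ## e) (lu (ob e)) e = sone (wires e)"
  by (auto intro!: strict_eqI simp: ty_simps)
    (simp add: ten_chart_simps cmp0_rewrite[OF lu_natural] cmp0_cancel[OF chartD(10)])

lemma repr_lunit: "\<lbrakk>chart e; X = ob e\<rbrakk> \<Longrightarrow> repr (unit_chart ## e) (\<ll> X) e (sone (wires e))"
  by (intro reprI[where G = "lu X"]) (auto simp: mor_simps transport_lu)

lemma repr_lunit_inv:
  assumes "chart e" "X = ob e"
  shows "repr e (lunit_inv C X) (unit_chart ## e) (sone (wires e))"
proof (rule reprI)
  have "transport e (lu_inv X) (unit_chart ## e) = sone (wires (unit_chart ## e))"
    by (rule transport_inverse[where G = "lu X"]) (use assms in \<open>simp_all add: transport_lu\<close>)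
  then show "sone (wires e) = transport e (lu_inv X) (unit_chart ## e)"
    by simp
qed (use assms in \<open>simp_all add: mor_simps\<close>)

lemma repr_add:
  assumes "repr e f e' F" "repr e g e' G"
  shows "repr e (f \<oplus>\<^sub>m g) e' (F \<boxplus> G)"
  using assms
  by (elim reprE, intro reprI[where G = "_ \<squnion> _"])
    (auto simp: mor_simps ty_simps cmp0_add intro!: strict_eqI)

lemma repr_neg:
  assumes "repr e f e' F" "X = ob e" "Y = ob e'"
  shows "repr e (neg C X Y f) e' (sneg F)"
  using assms
  by (elim reprE, intro reprI[where G = "neg0 _"])
    (auto simp: mor_simps ty_simps cmp0_neg intro!: strict_eqI)

lemma repr_zero: "\<lbrakk>chart e; chart e'; X = ob e; Y = ob e'\<rbrakk> \<Longrightarrow> repr e (zerom C X Y) e' (szero (wires e) (wires e'))"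
  by (intro reprI[where G = "zero0 X Y"]) (auto simp: mor_simps ty_simps cmp0_zero intro!: strict_eqI)

lemmas repr_rules = repr_comp repr_ten repr_ident repr_assoc repr_assoc_inv repr_symm repr_lunit repr_lunit_inv repr_add repr_neg repr_zero

end

section \<open>Translation of the axioms\<close>

context additive_symmetric_monoidal_category
begin

text \<open>A direct sum is not a tensor product of its summands, so it becomes one wire of its own,
  tied to the charts of the summands by four strict arrows.\<close>

definition charted_biproduct where
  "charted_biproduct S X Y e1 e2 i1 i2 p1 p2 \<longleftrightarrow>
     repr e1 (in1 C X Y) (atom (X \<oplus>\<^sub>o Y)) i1 \<and> repr e2 (in2 C X Y) (atom (X \<oplus>\<^sub>o Y)) i2 \<and>
     repr (atom (X \<oplus>\<^sub>o Y)) (pr1 C X Y) e1 p1 \<and> repr (atom (X \<oplus>\<^sub>o Y)) (pr2 C X Y) e2 p2 \<and>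
     strict_biproduct obj_list sarr sdom scod scmp sten sone ssw sadd sneg szero
       S (wires e1) (wires e2) [X \<oplus>\<^sub>o Y] i1 i2 p1 p2"

lemma charted_biproductD:
  assumes "charted_biproduct S X Y e1 e2 i1 i2 p1 p2"
  shows "repr e1 (in1 C X Y) (atom (X \<oplus>\<^sub>o Y)) i1" "repr e2 (in2 C X Y) (atom (X \<oplus>\<^sub>o Y)) i2"
    "repr (atom (X \<oplus>\<^sub>o Y)) (pr1 C X Y) e1 p1" "repr (atom (X \<oplus>\<^sub>o Y)) (pr2 C X Y) e2 p2"
    "strict_biproduct obj_list sarr sdom scod scmp sten sone ssw sadd sneg szero
       S (wires e1) (wires e2) [X \<oplus>\<^sub>o Y] i1 i2 p1 p2"
  using assms unfolding charted_biproduct_def by simp_all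

lemma biproduct_charts:
  assumes [simp]: "chart e1" "chart e2" "obj_list S" and X: "ob e1 = X" and Y: "ob e2 = Y"
  obtains i1 i2 p1 p2 where "charted_biproduct S X Y e1 e2 i1 i2 p1 p2"
proof -
  have XY [simp]: "X \<in> Obj C" "Y \<in> Obj C"
    using X Y chartD(1)[of e1] chartD(1)[of e2] by simp_all
  let ?e = "atom (X \<oplus>\<^sub>o Y)"
  have [simp]: "X \<oplus>\<^sub>o Y \<in> Obj C"
    by (simp add: dsum_obj)
  obtain i1 i2 p1 p2 where repr_proj:
      "repr e1 (in1 C X Y) ?e i1" "repr e2 (in2 C X Y) ?e i2" "repr ?e (pr1 C X Y) e1 p1" "repr ?e (pr2 C X Y) e2 p2"
    using repr_exists[of e1 ?e, simplified X, simplified, OF in1_in[OF XY]]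
      repr_exists[of e2 ?e, simplified Y, simplified, OF in2_in[OF XY]]
      repr_exists[of ?e e1, simplified X, simplified, OF pr1_in[OF XY]]
      repr_exists[of ?e e2, simplified Y, simplified, OF pr2_in[OF XY]] by auto
  have "strict_biproduct obj_list sarr sdom scod scmp sten sone ssw sadd sneg szero S (wires e1) (wires e2) [X \<oplus>\<^sub>o Y] i1 i2 p1 p2"
  proof
    show "p1 \<star> i1 = sone (wires e1)"
      using pr1_in1[OF XY] repr_iff[OF repr_comp[OF repr_proj(1,3)] repr_ident[of e1]] by (simp add: X)
    show "p2 \<star> i2 = sone (wires e2)"
      using pr2_in2[OF XY] repr_iff[OF repr_comp[OF repr_proj(2,4)] repr_ident[of e2]] by (simp add: Y)
    show "p1 \<star> i2 = szero (wires e2) (wires e1)"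
      using pr1_in2[OF XY] repr_iff[OF repr_comp[OF repr_proj(2,3)] repr_zero[of e2 e1]] by (simp add: X Y)
    show "p2 \<star> i1 = szero (wires e1) (wires e2)"
      using pr2_in1[OF XY] repr_iff[OF repr_comp[OF repr_proj(1,4)] repr_zero[of e1 e2]] by (simp add: X Y)
    show "(i1 \<star> p1) \<boxplus> (i2 \<star> p2) = sone [X \<oplus>\<^sub>o Y]"
      using dsum_ident[OF XY] repr_iff[OF repr_add[OF repr_comp[OF repr_proj(3,1)] repr_comp[OF repr_proj(4,2)]] repr_ident[of ?e]]
      by simp
  qed (use repr_proj[THEN repr_arr(1)] repr_proj[THEN repr_arr(2)] repr_proj[THEN repr_arr(3)] in simp_all)
  then show thesis
    using that repr_proj unfolding charted_biproduct_def by blast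
qed

end

text \<open>The charts are left open in order to cover both structures: \<open>atom \<Sigma>\<close>
  and \<open>atom M\<close> for the original, \<open>unit_chart\<close> and
  \<open>atom \<Sigma> ## atom M\<close> for the shift. The bracket is represented by its
  components, as in \<open>dlr_axioms\<close>.\<close>

locale dlr_charts = additive_symmetric_monoidal_category C
  for C :: "('o, 'm, 'z) asm_category_scheme" (structure) +
  fixes eS eM eA :: "('o, 'm) chart" and \<Sigma> M A :: 'o and \<mu> l r \<rho> b :: 'm
    and m' l' r' p' bl' br' :: "('o, 'm) strict"
  assumes wf [simp]: "chart eS" "chart eM" "chart eA"
    and cobs [simp]: "ob eS = \<Sigma>" "ob eM = M" "ob eA = A"
    and repr_mult: "repr (eA ## eA) \<mu> eA m'"
    and repr_lact: "repr (eA ## eM) l eM l'"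
    and repr_ract: "repr (eM ## eA) r eM r'"
    and repr_anchor: "repr ((eS ## eM) ## (eS ## eA)) \<rho> ((eS ## eA) ## eA) p'"
    and repr_bracket_l: "repr ((eS ## eM) ## (eS ## eM)) (proj_l C \<Sigma> A M \<cdot> b) ((eS ## eM) ## eA) bl'"
    and repr_bracket_r: "repr ((eS ## eM) ## (eS ## eM)) (proj_r C \<Sigma> A M \<cdot> b) ((eS ## eA) ## eM) br'"
    and bracket_in: "b \<in> Hom C ((\<Sigma> \<otimes>\<^sub>o M) \<otimes>\<^sub>o (\<Sigma> \<otimes>\<^sub>o M)) (\<Sigma> \<otimes>\<^sub>o brk_sum C A M)"
begin

lemmas repr_data = repr_mult repr_lact repr_ract repr_anchor repr_bracket_l repr_bracket_r

lemma objs [simp]: "\<Sigma> \<in> Obj C" "M \<in> Obj C" "A \<in> Obj C"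
  using chartD(1)[OF wf(1)] chartD(1)[OF wf(2)] chartD(1)[OF wf(3)] by simp_all

lemmas [simp] = repr_arr(1)[OF repr_mult] repr_arr(1)[OF repr_lact] repr_arr(1)[OF repr_ract] repr_arr(1)[OF repr_anchor]
  repr_arr(1)[OF repr_bracket_l] repr_arr(1)[OF repr_bracket_r]

lemma doms_cods [simp]:
  "sdom m' = wires eA @ wires eA" "sdom l' = wires eA @ wires eM" "sdom r' = wires eM @ wires eA"
  "sdom p' = wires eS @ wires eM @ wires eS @ wires eA"
  "sdom bl' = wires eS @ wires eM @ wires eS @ wires eM" "sdom br' = wires eS @ wires eM @ wires eS @ wires eM"
  "scod m' = wires eA" "scod l' = wires eM" "scod r' = wires eM" "scod p' = wires eS @ wires eA @ wires eA"
  "scod bl' = wires eS @ wires eM @ wires eA" "scod br' = wires eS @ wires eA @ wires eM"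
  using repr_arr(2,3)[OF repr_mult] repr_arr(2,3)[OF repr_lact] repr_arr(2,3)[OF repr_ract] repr_arr(2,3)[OF repr_anchor]
    repr_arr(2,3)[OF repr_bracket_l] repr_arr(2,3)[OF repr_bracket_r]
  by simp_all

lemmas typing = wf cobs objs doms_cods repr_arr(1)[OF repr_mult] repr_arr(1)[OF repr_lact]
  repr_arr(1)[OF repr_ract] repr_arr(1)[OF repr_anchor]
  repr_arr(1)[OF repr_bracket_l] repr_arr(1)[OF repr_bracket_r]

abbreviation (input) "nS \<equiv> wires eS"
abbreviation (input) "nM \<equiv> wires eM"
abbreviation (input) "nA \<equiv> wires eA"
abbreviation (input) "lM \<equiv> (sone nS \<box> l') \<star> (ssw nA nS \<box> sone nM)"
abbreviation (input) "lA \<equiv> (sone nS \<box> m') \<star> (ssw nA nS \<box> sone nA)"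
abbreviation (input) "pt \<equiv> sneg ((sone nS \<box> ssw nA nA) \<star> p' \<star> ssw (nS @ nA) (nS @ nM))"

text \<open>Only the chart of the common source has to be given; its bracketing must match that of
  the equation in \<open>C\<close>. Associators become identities and drop out.\<close>

lemma bimodule_translation:
  "l \<cdot> (\<mu> \<otimes>\<^sub>m \<langle>M\<rangle>) = l \<cdot> (\<langle>A\<rangle> \<otimes>\<^sub>m l) \<cdot> \<alpha> A A M \<longleftrightarrow> l' \<star> (m' \<box> sone nM) = l' \<star> (sone nA \<box> l')"
  "r \<cdot> (r \<otimes>\<^sub>m \<langle>A\<rangle>) = r \<cdot> (\<langle>M\<rangle> \<otimes>\<^sub>m \<mu>) \<cdot> \<alpha> M A A \<longleftrightarrow> r' \<star> (r' \<box> sone nA) = r' \<star> (sone nM \<box> m')"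
  "r \<cdot> (l \<otimes>\<^sub>m \<langle>A\<rangle>) = l \<cdot> (\<langle>A\<rangle> \<otimes>\<^sub>m r) \<cdot> \<alpha> A M A \<longleftrightarrow> r' \<star> (l' \<box> sone nA) = l' \<star> (sone nA \<box> r')"
  subgoal by (rule repr_eq_iff[where e = "(eA ## eA) ## eM"], (rule repr_data repr_rules | simp)+)
  subgoal by (rule repr_eq_iff[where e = "(eM ## eA) ## eA"], (rule repr_data repr_rules | simp)+)
  subgoal by (rule repr_eq_iff[where e = "(eA ## eM) ## eA"], (rule repr_data repr_rules | simp)+)
  done

lemma anchor_bimodule_hom_translation:
  "anchor_bimodule_hom C \<Sigma> A \<mu> M l r \<rho> \<longleftrightarrow>
     p' \<star> (lM \<box> sone (nS @ nA)) = (sone (nS @ nA) \<box> m') \<star> (ssw nA (nS @ nA) \<box> sone nA) \<star> (sone nA \<box> p') \<and>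
     p' \<star> (sone nS \<box> r' \<box> sone (nS @ nA)) \<star> (sone (nS @ nM) \<box> ssw (nS @ nA) nA)
       = (sone nS \<box> m' \<box> sone nA) \<star> (sone (nS @ nA) \<box> ssw nA nA) \<star> (p' \<box> sone nA)"
proof -
  have "\<rho> \<cdot> src_lact C \<Sigma> A M l = int_lact C \<Sigma> A \<mu> \<cdot> (\<langle>A\<rangle> \<otimes>\<^sub>m \<rho>) \<longleftrightarrow>
     p' \<star> (lM \<box> sone (nS @ nA)) = (sone (nS @ nA) \<box> m') \<star> (ssw nA (nS @ nA) \<box> sone nA) \<star> (sone nA \<box> p')"
    unfolding src_lact_def int_lact_def susp_lact_def
    by (rule repr_eq_iff[where e = "eA ## ((eS ## eM) ## (eS ## eA))"], (rule repr_data repr_rules | simp)+)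
  moreover have "\<rho> \<cdot> src_ract C \<Sigma> A M r = int_ract C \<Sigma> A \<mu> \<cdot> (\<rho> \<otimes>\<^sub>m \<langle>A\<rangle>) \<longleftrightarrow>
     p' \<star> (sone nS \<box> r' \<box> sone (nS @ nA)) \<star> (sone (nS @ nM) \<box> ssw (nS @ nA) nA)
       = (sone nS \<box> m' \<box> sone nA) \<star> (sone (nS @ nA) \<box> ssw nA nA) \<star> (p' \<box> sone nA)"
    unfolding src_ract_def int_ract_def susp_ract_def
    by (rule repr_eq_iff[where e = "((eS ## eM) ## (eS ## eA)) ## eA"], (rule repr_data repr_rules | simp)+)
  ultimately show ?thesis
    using repr_arr(4)[OF repr_anchor] by (simp add: anchor_bimodule_hom_def bimodule_hom_def)
qed

lemma anchor_derivation_translation: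
  "anchor_derivation C \<Sigma> A \<mu> M \<rho> \<longleftrightarrow>
     p' \<star> (sone (nS @ nM @ nS) \<box> m') = ((sone (nS @ nA) \<box> m') \<star> (p' \<box> sone nA))
        \<boxplus> ((lA \<box> sone nA) \<star> (sone nA \<box> p') \<star> (ssw (nS @ nM @ nS) nA \<box> sone nA))"
  unfolding anchor_derivation_def ext_ract_def ext_lact_def susp_lact_def swap_past_def
  by (rule repr_eq_iff[where e = "((eS ## eM) ## (eS ## eA)) ## eA"], (rule repr_data repr_rules | simp)+)

lemma anchor_bracket_compat_translation:
  "anchor_bracket_compat C \<Sigma> A M \<rho> b \<longleftrightarrow>
     ((pt \<box> sone nA) \<star> (sone (nS @ nA) \<box> bl'))
        \<boxplus> ((sone nS \<box> ssw (nA @ nA) nA) \<star> (p' \<box> sone nA) \<star> (sone (nS @ nM) \<box> p') \<star> ssw (nS @ nA) (nS @ nM @ nS @ nM))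
        \<boxplus> ((sone nS \<box> ssw nA (nA @ nA)) \<star> (p' \<box> sone nA) \<star> (sone (nS @ nM) \<box> pt) \<star> ssw (nS @ nA @ nS @ nM) (nS @ nM))
        = szero (nS @ nA @ nS @ nM @ nS @ nM) (nS @ nA @ nA @ nA)"
  unfolding anchor_bracket_compat_def Let_def anchor_tau_def flatten_def
  by (rule repr_eq_iff[where e = "(eS ## eA) ## ((eS ## eM) ## (eS ## eM))"], (rule repr_data repr_rules | simp)+)

lemma double_jacobi_translation:
  "double_jacobi C \<Sigma> A M \<rho> b \<longleftrightarrow>
     ((bl' \<box> sone nA) \<star> (sone (nS @ nM) \<box> bl'))
        \<boxplus> ((sone nS \<box> ssw nA (nM @ nA)) \<star> (br' \<box> sone nA) \<star> (sone (nS @ nM) \<box> bl') \<star> ssw (nS @ nM @ nS @ nM) (nS @ nM))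
        \<boxplus> ((sone nS \<box> ssw (nA @ nA) nM) \<star> (p' \<box> sone nM) \<star> (sone (nS @ nM) \<box> br') \<star> ssw (nS @ nM) (nS @ nM @ nS @ nM))
        = szero (nS @ nM @ nS @ nM @ nS @ nM) (nS @ nM @ nA @ nA)"
  unfolding double_jacobi_def Let_def flatten_def
  by (rule repr_eq_iff[where e = "(eS ## eM) ## ((eS ## eM) ## (eS ## eM))"], (rule repr_data repr_rules | simp)+)

text \<open>The whole bracket has some strict image \<open>B\<close>, and its components must be
  \<open>bl'\<close> and \<open>br'\<close>, because charts and arrow determine the strict
  arrow.\<close>

lemma bracket_charts:
  obtains i1 i2 p1 p2 B where
    "charted_biproduct nS (M \<otimes>\<^sub>o A) (A \<otimes>\<^sub>o M) (eM ## eA) (eA ## eM) i1 i2 p1 p2"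
    "repr ((eS ## eM) ## (eS ## eM)) b (eS ## atom (brk_sum C A M)) B"
    "(sone nS \<box> p1) \<star> B = bl'" "(sone nS \<box> p2) \<star> B = br'"
proof -
  let ?P = "brk_sum C A M" and ?N = "(eS ## eM) ## (eS ## eM)"
  have [simp]: "?P \<in> Obj C"
    unfolding brk_sum_def by (simp add: dsum_obj)
  have *: "chart (eM ## eA)" "chart (eA ## eM)" "obj_list nS"
      "ob (eM ## eA) = M \<otimes>\<^sub>o A" "ob (eA ## eM) = A \<otimes>\<^sub>o M"
    by simp_all
  obtain i1 i2 p1 p2 where P: "charted_biproduct nS (M \<otimes>\<^sub>o A) (A \<otimes>\<^sub>o M) (eM ## eA) (eA ## eM) i1 i2 p1 p2"
    by (rule biproduct_charts[OF *])
  note repr_proj = charted_biproductD(1-4)[OF P, folded brk_sum_def]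
  obtain B where repr_b: "repr ?N b (eS ## atom ?P) B"
    using repr_exists[of ?N "eS ## atom ?P", simplified, OF bracket_in] by auto
  note arrs [simp] = repr_proj[THEN repr_arr(1)] repr_proj[THEN repr_arr(2)]
    repr_proj[THEN repr_arr(3)] repr_arr(1-3)[OF repr_b]
  have "repr ?N (proj_l C \<Sigma> A M \<cdot> b) ((eS ## eM) ## eA) ((sone nS \<box> p1) \<star> B)"
    unfolding proj_l_def by (rule repr_cong, (rule repr_proj repr_b repr_rules | simp)+)
  then have bl: "(sone nS \<box> p1) \<star> B = bl'"
    using repr_iff[OF _ repr_bracket_l] by blast
  have "repr ?N (proj_r C \<Sigma> A M \<cdot> b) ((eS ## eA) ## eM) ((sone nS \<box> p2) \<star> B)"
    unfolding proj_r_def by (rule repr_cong, (rule repr_proj repr_b repr_rules | simp)+)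
  then have br: "(sone nS \<box> p2) \<star> B = br'"
    using repr_iff[OF _ repr_bracket_r] by blast
  show thesis
    by (rule that[OF P repr_b bl br])
qed

lemma bracket_translation:
  "bracket_antisym C \<Sigma> A M b \<longleftrightarrow>
     bl' \<star> ssw (nS @ nM) (nS @ nM) = sneg ((sone nS \<box> ssw nA nM) \<star> br') \<and>
     br' \<star> ssw (nS @ nM) (nS @ nM) = sneg ((sone nS \<box> ssw nM nA) \<star> bl')" (is ?antisym)
  "bracket_derivation C \<Sigma> A \<mu> M l r \<rho> b \<longleftrightarrow>
     (bl' \<star> (sone (nS @ nM @ nS) \<box> l') = (lM \<box> sone nA) \<star> (sone nA \<box> bl') \<star> (ssw (nS @ nM @ nS) nA \<box> sone nM) \<and>
      br' \<star> (sone (nS @ nM @ nS) \<box> l') = ((sone (nS @ nA) \<box> l') \<star> (p' \<box> sone nM))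
        \<boxplus> ((lA \<box> sone nM) \<star> (sone nA \<box> br') \<star> (ssw (nS @ nM @ nS) nA \<box> sone nM))) \<and>
     (bl' \<star> (sone (nS @ nM @ nS) \<box> r') = ((sone (nS @ nM) \<box> m') \<star> (bl' \<box> sone nA))
        \<boxplus> ((sone nS \<box> r' \<box> sone nA) \<star> (ssw nM nS \<box> sone (nA @ nA)) \<star> (sone nM \<box> p') \<star> (ssw (nS @ nM @ nS) nM \<box> sone nA)) \<and>
      br' \<star> (sone (nS @ nM @ nS) \<box> r') = (sone (nS @ nA) \<box> r') \<star> (br' \<box> sone nA))" (is ?derivation)
proof -
  let ?N = "(eS ## eM) ## (eS ## eM)"
  have [simp]: "brk_sum C A M \<in> Obj C"
    unfolding brk_sum_def by (simp add: dsum_obj)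
  obtain i1 i2 p1 p2 B where P:
      "charted_biproduct nS (M \<otimes>\<^sub>o A) (A \<otimes>\<^sub>o M) (eM ## eA) (eA ## eM) i1 i2 p1 p2"
    and repr_b: "repr ?N b (eS ## atom (brk_sum C A M)) B"
    and bl: "(sone nS \<box> p1) \<star> B = bl'" and br: "(sone nS \<box> p2) \<star> B = br'"
    by (rule bracket_charts)
  note P' = charted_biproductD[OF P, unfolded chart_simps, folded brk_sum_def]
  note repr_bip = P'(1-4) repr_b
  note [simp] = repr_bip[THEN repr_arr(1)] repr_bip[THEN repr_arr(2)] repr_bip[THEN repr_arr(3)]
  interpret strict_biproduct obj_list sarr sdom scod "(\<star>)" "(\<box>)" sone ssw "(\<boxplus>)" sneg szero
      nS "nM @ nA" "nA @ nM" "[brk_sum C A M]" i1 i2 p1 p2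
    by (rule P'(5))
  interpret sb: strict_bracket obj_list sarr sdom scod "(\<star>)" "(\<box>)" sone ssw "(\<boxplus>)" sneg szero
      nS nM nA "[brk_sum C A M]" i1 i2 p1 p2 m' l' r' p' B
    by unfold_locales simp_all
  note repr_data' = repr_mult repr_lact repr_ract repr_anchor repr_bip
  \<comment> \<open>The axiom is first translated as one equation for \<open>B\<close>;
    \<open>strict_bracket\<close> then splits it into its two components.\<close>
  have "bracket_antisym C \<Sigma> A M b \<longleftrightarrow> B \<star> ssw (nS @ nM) (nS @ nM)
      = sneg ((sone nS \<box> ((i2 \<star> ssw nM nA \<star> p1) \<boxplus> (i1 \<star> ssw nA nM \<star> p2))) \<star> B)"
    unfolding bracket_antisym_def
    by (rule repr_eq_iff[where e = ?N], (rule repr_data' repr_rules | simp)+)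
  then show ?antisym
    by (simp only: sb.antisym_iff bl br)
  have "b \<cdot> (\<langle>\<Sigma> \<otimes>\<^sub>o M\<rangle> \<otimes>\<^sub>m ((\<langle>\<Sigma>\<rangle> \<otimes>\<^sub>m l) \<cdot> \<alpha> \<Sigma> A M)) \<cdot> \<alpha> (\<Sigma> \<otimes>\<^sub>o M) (\<Sigma> \<otimes>\<^sub>o A) M
       = phi_l C \<Sigma> A \<mu> M l \<rho> b \<longleftrightarrow>
     B \<star> (sone (nS @ nM @ nS) \<box> l') = ((sone nS \<box> i2) \<star> (sone (nS @ nA) \<box> l') \<star> (p' \<box> sone nM))
     \<boxplus> ((((sone nS \<box> i1) \<star> (lM \<box> sone nA) \<star> (sone (nA @ nS) \<box> p1))
         \<boxplus> ((sone nS \<box> i2) \<star> (lA \<box> sone nM) \<star> (sone (nA @ nS) \<box> p2)))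
        \<star> (sone nA \<box> B) \<star> (ssw (nS @ nM @ nS) nA \<box> sone nM))"
    unfolding phi_l_def susp_lact_def swap_past_def incl_l_def incl_r_def proj_l_def proj_r_def
    by (rule repr_eq_iff[where e = "((eS ## eM) ## (eS ## eA)) ## eM"], (rule repr_data' repr_rules | simp)+)
  moreover have "b \<cdot> (\<langle>\<Sigma> \<otimes>\<^sub>o M\<rangle> \<otimes>\<^sub>m ((\<langle>\<Sigma>\<rangle> \<otimes>\<^sub>m r) \<cdot> \<alpha> \<Sigma> M A)) \<cdot> \<alpha> (\<Sigma> \<otimes>\<^sub>o M) (\<Sigma> \<otimes>\<^sub>o M) A
       = phi_r C \<Sigma> A \<mu> M r \<rho> b \<longleftrightarrow>
     B \<star> (sone (nS @ nM @ nS) \<box> r') = ((((sone nS \<box> i1) \<star> (sone (nS @ nM) \<box> m') \<star> (sone nS \<box> p1 \<box> sone nA))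
         \<boxplus> ((sone nS \<box> i2) \<star> (sone (nS @ nA) \<box> r') \<star> (sone nS \<box> p2 \<box> sone nA))) \<star> (B \<box> sone nA))
     \<boxplus> ((sone nS \<box> i1) \<star> (sone nS \<box> r' \<box> sone nA) \<star> (ssw nM nS \<box> sone (nA @ nA)) \<star> (sone nM \<box> p') \<star> (ssw (nS @ nM @ nS) nM \<box> sone nA))"
    unfolding phi_r_def susp_ract_def swap_past_def incl_l_def incl_r_def proj_l_def proj_r_def
    by (rule repr_eq_iff[where e = "((eS ## eM) ## (eS ## eM)) ## eA"], (rule repr_data' repr_rules | simp)+)
  ultimately show ?derivation
    unfolding bracket_derivation_def by (simp only: sb.derivation_left_iff sb.derivation_right_iff bl br)
qed

theorem double_lie_rinehart_iff:
  assumes "und d = M" "lact d = l" "ract d = r" "anchor d = \<rho>" "bracket d = b"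
  shows "double_lie_rinehart C \<Sigma> A \<mu> d \<longleftrightarrow> strict.dlr_axioms nS nM nA m' l' r' p' bl' br'"
proof -
  have "bimodule C A \<mu> M l r \<longleftrightarrow> l' \<star> (m' \<box> sone nM) = l' \<star> (sone nA \<box> l') \<and>
      r' \<star> (r' \<box> sone nA) = r' \<star> (sone nM \<box> m') \<and> r' \<star> (l' \<box> sone nA) = l' \<star> (sone nA \<box> r')"
    using repr_arr(4)[OF repr_lact] repr_arr(4)[OF repr_ract] by (simp add: bimodule_def bimodule_translation)
  then show ?thesis
    using repr_arr(4)[OF repr_anchor] bracket_in
    unfolding double_lie_rinehart_def strict.dlr_axioms_def Let_def assms
      anchor_bimodule_hom_translation anchor_derivation_translation anchor_bracket_compat_translation
      double_jacobi_translation bracket_translation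
    by (simp add: conj_ac)
qed

end

lemma (in additive_symmetric_monoidal_category) dlr_hom_iff:
  assumes "dlr_charts C eS eM eA \<Sigma> M A \<mu> l r \<rho> b m' l' r' p' bl' br'"
    and "dlr_charts C eS eN eA \<Sigma> N A \<mu> l2 r2 \<rho>2 b2 m' l2' r2' p2' bl2' br2'"
    and "und d = M" "lact d = l" "ract d = r" "bracket d = b"
    and "und e = N" "lact e = l2" "ract e = r2" "bracket e = b2"
    and repr_f: "repr eM \<phi> eN f"
  shows "dlr_hom C \<Sigma> A d e \<phi> \<longleftrightarrow> strict.hom_axioms (wires eS) (wires eA) l' r' bl' br' l2' r2' bl2' br2' f"
proof -
  let ?S = "wires eS" and ?A = "wires eA"
  interpret d: dlr_charts C eS eM eA \<Sigma> M A \<mu> l r \<rho> b m' l' r' p' bl' br' by fact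
  interpret e: dlr_charts C eS eN eA \<Sigma> N A \<mu> l2 r2 \<rho>2 b2 m' l2' r2' p2' bl2' br2' by fact
  obtain i1 i2 p1 p2 B where P: "charted_biproduct ?S (M \<otimes>\<^sub>o A) (A \<otimes>\<^sub>o M) (eM ## eA) (eA ## eM) i1 i2 p1 p2"
    and B: "repr ((eS ## eM) ## (eS ## eM)) b (eS ## atom (brk_sum C A M)) B"
    and d_bl: "(sone ?S \<box> p1) \<star> B = bl'" and d_br: "(sone ?S \<box> p2) \<star> B = br'"
    by (rule d.bracket_charts)
  note repr_d = charted_biproductD(1-4)[OF P, folded brk_sum_def] B
  obtain j1 j2 q1 q2 B2 where Q: "charted_biproduct ?S (N \<otimes>\<^sub>o A) (A \<otimes>\<^sub>o N) (eN ## eA) (eA ## eN) j1 j2 q1 q2"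
    and B2: "repr ((eS ## eN) ## (eS ## eN)) b2 (eS ## atom (brk_sum C A N)) B2"
    and e_bl: "(sone ?S \<box> q1) \<star> B2 = bl2'" and e_br: "(sone ?S \<box> q2) \<star> B2 = br2'"
    by (rule e.bracket_charts)
  note Q' = charted_biproductD[OF Q, unfolded chart_simps, folded brk_sum_def]
  note repr_e = Q'(1-4) B2
  interpret strict_biproduct obj_list sarr sdom scod "(\<star>)" "(\<box>)" sone ssw "(\<boxplus>)" sneg szero
      ?S "wires eN @ ?A" "?A @ wires eN" "[brk_sum C A N]" j1 j2 q1 q2
    by (rule Q'(5))
  note [simp] = repr_d[THEN repr_arr(1)] repr_d[THEN repr_arr(2)] repr_d[THEN repr_arr(3)]
    repr_e[THEN repr_arr(1)] repr_e[THEN repr_arr(2)] repr_e[THEN repr_arr(3)] repr_arr(1-3)[OF repr_f]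
  have 1: "\<phi> \<cdot> l = l2 \<cdot> (\<langle>A\<rangle> \<otimes>\<^sub>m \<phi>) \<longleftrightarrow> f \<star> l' = l2' \<star> (sone ?A \<box> f)"
    by (rule repr_eq_iff[where e = "eA ## eM"], (rule d.repr_lact e.repr_lact repr_f repr_rules | simp)+)
  have 2: "\<phi> \<cdot> r = r2 \<cdot> (\<phi> \<otimes>\<^sub>m \<langle>A\<rangle>) \<longleftrightarrow> f \<star> r' = r2' \<star> (f \<box> sone ?A)"
    by (rule repr_eq_iff[where e = "eM ## eA"], (rule d.repr_ract e.repr_ract repr_f repr_rules | simp)+)
  let ?F = "(j1 \<star> (f \<box> sone ?A) \<star> p1) \<boxplus> (j2 \<star> (sone ?A \<box> f) \<star> p2)"
  let ?ff = "sone ?S \<box> f \<box> sone ?S \<box> f"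
  have "(\<langle>\<Sigma>\<rangle> \<otimes>\<^sub>m dsumm C (M \<otimes>\<^sub>o A) (A \<otimes>\<^sub>o M) (N \<otimes>\<^sub>o A) (A \<otimes>\<^sub>o N) (\<phi> \<otimes>\<^sub>m \<langle>A\<rangle>) (\<langle>A\<rangle> \<otimes>\<^sub>m \<phi>)) \<cdot> b
      = b2 \<cdot> ((\<langle>\<Sigma>\<rangle> \<otimes>\<^sub>m \<phi>) \<otimes>\<^sub>m (\<langle>\<Sigma>\<rangle> \<otimes>\<^sub>m \<phi>)) \<longleftrightarrow> (sone ?S \<box> ?F) \<star> B = B2 \<star> ?ff"
    unfolding dsumm_def
    by (rule repr_eq_iff[where e = "(eS ## eM) ## (eS ## eM)"], (rule repr_d repr_e repr_f repr_rules | simp)+)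
  \<comment> \<open>Projecting to the summands of the target turns \<open>dsumm\<close> into its two
    entries, each applied to one component of the bracket.\<close>
  also have "\<dots> \<longleftrightarrow> (sone ?S \<box> q1) \<star> (sone ?S \<box> ?F) \<star> B = bl2' \<star> ?ff \<and>
      (sone ?S \<box> q2) \<star> (sone ?S \<box> ?F) \<star> B = br2' \<star> ?ff"
    by (subst sum_eq_iff) (simp_all flip: e_bl e_br)
  also have "(sone ?S \<box> q1) \<star> (sone ?S \<box> ?F) \<star> B = (sone ?S \<box> f \<box> sone ?A) \<star> bl'"
    by (simp add: strict.ten_add strict.cmp_add strict.add_cmp flip: d_bl strict.ten_one_cmp)
  also have "(sone ?S \<box> q2) \<star> (sone ?S \<box> ?F) \<star> B = (sone (?S @ ?A) \<box> f) \<star> br'"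
    by (simp add: strict.ten_add strict.cmp_add strict.add_cmp flip: d_br strict.ten_one_cmp)
  finally show ?thesis
    using repr_arr(4)[OF repr_f] 1 2
    by (simp add: dlr_hom_def bimodule_hom_def strict.hom_axioms_def assms)
qed

section \<open>Suspension\<close>

text \<open>The usual construction of a quasi-inverse: choose preimages of objects with isomorphisms
  \<open>u\<close> and \<open>v\<close>, lift conjugated arrows by fullness, and verify all laws
  after applying \<open>F\<close>.\<close>

lemma equivalence_of_categoriesI:
  fixes C :: "('o, 'm, 'y) category_scheme" and D :: "('p, 'n, 'z) category_scheme" (structure)
  assumes "category_functor C D F Fm"
    and faithful: "\<And>X Y f g. \<lbrakk>X \<in> Obj C; Y \<in> Obj C; f \<in> Hom C X Y; g \<in> Hom C X Y; Fm X Y f = Fm X Y g\<rbrakk> \<Longrightarrow> f = g"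
    and full: "\<And>X Y h. \<lbrakk>X \<in> Obj C; Y \<in> Obj C; h \<in> Hom D (F X) (F Y)\<rbrakk> \<Longrightarrow> \<exists>f \<in> Hom C X Y. Fm X Y f = h"
    and surj: "\<And>Z. Z \<in> Obj D \<Longrightarrow> \<exists>X \<in> Obj C. \<exists>u. iso_arrow D (F X) Z u"
  shows "equivalence_of_categories C D F Fm"
proof -
  interpret F: category_functor C D F Fm by fact
  have "\<exists>X u v. X \<in> Obj C \<and> inverse_arrows D (F X) Z u v" if "Z \<in> Obj D" for Z
    using surj[OF that] unfolding iso_arrow_def by blast
  then obtain G u v where G: "\<And>Z. Z \<in> Obj D \<Longrightarrow> G Z \<in> Obj C"
      and "\<And>Z. Z \<in> Obj D \<Longrightarrow> inverse_arrows D (F (G Z)) Z (u Z) (v Z)"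
    by metis
  then have u: "\<And>Z. Z \<in> Obj D \<Longrightarrow> u Z \<in> Hom D (F (G Z)) Z"
    and v: "\<And>Z. Z \<in> Obj D \<Longrightarrow> v Z \<in> Hom D Z (F (G Z))"
    and vu: "\<And>Z. Z \<in> Obj D \<Longrightarrow> v Z \<cdot> u Z = \<langle>F (G Z)\<rangle>"
    and uv: "\<And>Z. Z \<in> Obj D \<Longrightarrow> u Z \<cdot> v Z = \<langle>Z\<rangle>"
    by (auto simp: inverse_arrows_def)
  define lift where "lift X Y h = (SOME f. f \<in> Hom C X Y \<and> Fm X Y f = h)" for X Y h
  have lift: "lift X Y h \<in> Hom C X Y" "Fm X Y (lift X Y h) = h"
    if "X \<in> Obj C" "Y \<in> Obj C" "h \<in> Hom D (F X) (F Y)" for X Y h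
    using someI_ex[of "\<lambda>f. f \<in> Hom C X Y \<and> Fm X Y f = h"] full[OF that]
    unfolding lift_def by blast+
  note FD = F.map_obj
  \<comment> \<open>An arrow from \<open>Y\<close> to \<open>Z\<close> is first conjugated to one
    from \<open>F (G Y)\<close> to \<open>F (G Z)\<close>; only such arrows can be lifted.\<close>
  let ?Gm = "\<lambda>Y Z h. lift (G Y) (G Z) (v Z \<cdot> (h \<cdot> u Y))"
  have conj_in: "v Z \<cdot> (h \<cdot> u Y) \<in> Hom D (F (G Y)) (F (G Z))"
    if "Y \<in> Obj D" "Z \<in> Obj D" "h \<in> Hom D Y Z" for Y Z h
    using that by (meson F.target.comp_in FD G u v)
  have Gm: "?Gm Y Z h \<in> Hom C (G Y) (G Z)" "Fm (G Y) (G Z) (?Gm Y Z h) = v Z \<cdot> (h \<cdot> u Y)"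
    if "Y \<in> Obj D" "Z \<in> Obj D" "h \<in> Hom D Y Z" for Y Z h
    using lift[OF G[OF that(1)] G[OF that(2)] conj_in[OF that]] by simp_all
  have u_Gm: "u Z \<cdot> (v Z \<cdot> (h \<cdot> u Y)) = h \<cdot> u Y"
    if "Y \<in> Obj D" "Z \<in> Obj D" "h \<in> Hom D Y Z" for Y Z h
  proof -
    have h: "h \<cdot> u Y \<in> Hom D (F (G Y)) Z"
      using that by (meson F.target.comp_in FD G u)
    have "u Z \<cdot> (v Z \<cdot> (h \<cdot> u Y)) = (u Z \<cdot> v Z) \<cdot> (h \<cdot> u Y)"
      using F.target.comp_assoc[OF FD[OF G[OF that(1)]] that(2) FD[OF G[OF that(2)]] that(2) u[OF that(2)] v[OF that(2)] h]
      by simp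
    then show ?thesis
      using F.target.ident_comp[OF FD[OF G[OF that(1)]] that(2) h] uv[OF that(2)] by simp
  qed
  \<comment> \<open>After applying \<open>F\<close> the isomorphisms in the middle of a composite
    cancel, and faithfulness reflects the result.\<close>
  have "category_functor D C G ?Gm"
  proof
    fix X assume X: "X \<in> Obj D"
    show "?Gm X X \<langle>X\<rangle> = \<langle>G X\<rangle>\<^bsub>C\<^esub>"
    proof (rule faithful)
      show "Fm (G X) (G X) (?Gm X X \<langle>X\<rangle>) = Fm (G X) (G X) \<langle>G X\<rangle>\<^bsub>C\<^esub>"
        using Gm(2)[OF X X F.target.ident_in[OF X]] F.target.ident_comp[OF FD[OF G[OF X]] X u[OF X]]
          vu[OF X] F.map_ident[OF G[OF X]] by metis
    qed (use X in \<open>simp_all add: G Gm F.target.ident_in F.source.ident_in\<close>)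
  next
    fix X Y Z g f
    assume a: "X \<in> Obj D" "Y \<in> Obj D" "Z \<in> Obj D" "g \<in> Hom D Y Z" "f \<in> Hom D X Y"
    note o = FD[OF G[OF a(1)]] FD[OF G[OF a(2)]] FD[OF G[OF a(3)]]
    have gf: "g \<cdot> f \<in> Hom D X Z"
      using a by (meson F.target.comp_in)
    have gu: "g \<cdot> u Y \<in> Hom D (F (G Y)) Z" and fu: "f \<cdot> u X \<in> Hom D (F (G X)) Y"
      using a o by (meson F.target.comp_in u)+
    show "?Gm X Z (g \<cdot> f) = ?Gm Y Z g \<cdot>\<^bsub>C\<^esub> ?Gm X Y f"
    proof (rule faithful)
      have "Fm (G X) (G Z) (?Gm Y Z g \<cdot>\<^bsub>C\<^esub> ?Gm X Y f)
          = (v Z \<cdot> (g \<cdot> u Y)) \<cdot> (v Y \<cdot> (f \<cdot> u X))"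
        using F.map_comp[OF G[OF a(1)] G[OF a(2)] G[OF a(3)] Gm(1)[OF a(2,3,4)] Gm(1)[OF a(1,2,5)]]
          Gm(2)[OF a(2,3,4)] Gm(2)[OF a(1,2,5)] by simp
      also have "\<dots> = v Z \<cdot> (g \<cdot> (u Y \<cdot> (v Y \<cdot> (f \<cdot> u X))))"
        using F.target.comp_assoc[OF o(1,2) a(3) o(3) v[OF a(3)] gu conj_in[OF a(1,2,5)]]
          F.target.comp_assoc[OF o(1,2) a(2,3,4) u[OF a(2)] conj_in[OF a(1,2,5)]] by simp
      also have "\<dots> = v Z \<cdot> ((g \<cdot> f) \<cdot> u X)"
        using u_Gm[OF a(1,2,5)] F.target.comp_assoc[OF o(1) a(1,2,3,4,5) u[OF a(1)]] by simp
      finally show "Fm (G X) (G Z) (?Gm X Z (g \<cdot> f)) = Fm (G X) (G Z) (?Gm Y Z g \<cdot>\<^bsub>C\<^esub> ?Gm X Y f)"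
        using Gm(2)[OF a(1,3) gf] by simp
      show "?Gm Y Z g \<cdot>\<^bsub>C\<^esub> ?Gm X Y f \<in> Hom C (G X) (G Z)"
        using a by (meson F.source.comp_in G Gm(1))
    qed (use a gf in \<open>simp_all add: G Gm\<close>)
  qed (use G Gm in simp_all)
  \<comment> \<open>The unit is the lift of \<open>v (F X)\<close>; its inverse will be the lift of
    \<open>u (F X)\<close>. The counit is \<open>u\<close> itself.\<close>
  moreover define \<eta> where "\<eta> X = lift X (G (F X)) (v (F X))" for X
  have \<eta>: "\<eta> X \<in> Hom C X (G (F X))" "Fm X (G (F X)) (\<eta> X) = v (F X)" if "X \<in> Obj C" for X
    using lift[OF that G[OF FD[OF that]] v[OF FD[OF that]]] unfolding \<eta>_def by simp_all
  have "natural_iso C C (\<lambda>X. X) (\<lambda>X Y f. f) (\<lambda>X. G (F X)) (\<lambda>X Y f. ?Gm (F X) (F Y) (Fm X Y f)) \<eta>"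
    unfolding natural_iso_def
  proof (intro conjI ballI)
    fix X assume X: "X \<in> Obj C"
    note FX = FD[OF X] and GFX = G[OF FD[OF X]]
    let ?w = "lift (G (F X)) X (u (F X))"
    have w: "?w \<in> Hom C (G (F X)) X" "Fm (G (F X)) X ?w = u (F X)"
      using lift[OF GFX X u[OF FX]] by simp_all
    have "?w \<cdot>\<^bsub>C\<^esub> \<eta> X = \<langle>X\<rangle>\<^bsub>C\<^esub>"
    proof (rule faithful[OF X X])
      show "Fm X X (?w \<cdot>\<^bsub>C\<^esub> \<eta> X) = Fm X X \<langle>X\<rangle>\<^bsub>C\<^esub>"
        using F.map_comp[OF X GFX X w(1) \<eta>(1)[OF X]] w(2) \<eta>(2)[OF X] uv[OF FX] F.map_ident[OF X] by simp
    qed (use X GFX w \<eta> in \<open>meson F.source.comp_in F.source.ident_in\<close>)+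
    moreover have "\<eta> X \<cdot>\<^bsub>C\<^esub> ?w = \<langle>G (F X)\<rangle>\<^bsub>C\<^esub>"
    proof (rule faithful[OF GFX GFX])
      show "Fm (G (F X)) (G (F X)) (\<eta> X \<cdot>\<^bsub>C\<^esub> ?w) = Fm (G (F X)) (G (F X)) \<langle>G (F X)\<rangle>\<^bsub>C\<^esub>"
        using F.map_comp[OF GFX X GFX \<eta>(1)[OF X] w(1)] w(2) \<eta>(2)[OF X] vu[OF FX] F.map_ident[OF GFX] by simp
    qed (use X GFX w \<eta> in \<open>meson F.source.comp_in F.source.ident_in\<close>)+
    ultimately show "iso_arrow C X (G (F X)) (\<eta> X)"
      using \<eta>(1)[OF X] w(1) unfolding iso_arrow_def inverse_arrows_def by blast
  next
    fix X Y f assume a: "X \<in> Obj C" "Y \<in> Obj C" "f \<in> Hom C X Y"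
    note FX = FD[OF a(1)] and FY = FD[OF a(2)] and GFX = G[OF FD[OF a(1)]] and GFY = G[OF FD[OF a(2)]]
    note Ff = F.map_in[OF a]
    have fu: "Fm X Y f \<cdot> u (F X) \<in> Hom D (F (G (F X))) (F Y)"
      using FX FY FD[OF GFX] u[OF FX] Ff by (meson F.target.comp_in)
    show "\<eta> Y \<cdot>\<^bsub>C\<^esub> f = ?Gm (F X) (F Y) (Fm X Y f) \<cdot>\<^bsub>C\<^esub> \<eta> X"
    proof (rule faithful[OF a(1) GFY])
      have "Fm X (G (F Y)) (?Gm (F X) (F Y) (Fm X Y f) \<cdot>\<^bsub>C\<^esub> \<eta> X)
          = (v (F Y) \<cdot> (Fm X Y f \<cdot> u (F X))) \<cdot> v (F X)"
        using F.map_comp[OF a(1) GFX GFY Gm(1)[OF FX FY Ff] \<eta>(1)[OF a(1)]]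
          Gm(2)[OF FX FY Ff] \<eta>(2)[OF a(1)] by simp
      also have "\<dots> = v (F Y) \<cdot> (Fm X Y f \<cdot> (u (F X) \<cdot> v (F X)))"
        using F.target.comp_assoc[OF FX FD[OF GFX] FY FD[OF GFY] v[OF FY] fu v[OF FX]]
          F.target.comp_assoc[OF FX FD[OF GFX] FX FY Ff u[OF FX] v[OF FX]] by simp
      also have "\<dots> = Fm X (G (F Y)) (\<eta> Y \<cdot>\<^bsub>C\<^esub> f)"
        using uv[OF FX] F.target.comp_ident[OF FX FY Ff] F.map_comp[OF a(1,2) GFY \<eta>(1)[OF a(2)] a(3)]
          \<eta>(2)[OF a(2)] by simp
      finally show "Fm X (G (F Y)) (\<eta> Y \<cdot>\<^bsub>C\<^esub> f) = Fm X (G (F Y)) (?Gm (F X) (F Y) (Fm X Y f) \<cdot>\<^bsub>C\<^esub> \<eta> X)"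
        by simp
    qed (use a GFX GFY \<eta> Gm(1)[OF FX FY Ff] in \<open>meson F.source.comp_in\<close>)+
  qed
  moreover have "natural_iso D D (\<lambda>X. F (G X)) (\<lambda>X Y f. Fm (G X) (G Y) (?Gm X Y f)) (\<lambda>X. X) (\<lambda>X Y f. f) u"
    unfolding natural_iso_def
  proof (intro conjI ballI)
    fix X assume "X \<in> Obj D"
    then show "iso_arrow D (F (G X)) X (u X)"
      using u v uv vu unfolding iso_arrow_def inverse_arrows_def by blast
  qed (simp add: Gm(2) u_Gm)
  ultimately show ?thesis
    unfolding equivalence_of_categories_def using \<open>category_functor C D F Fm\<close> by blast
qed

section \<open>The categories of double Lie-Rinehart algebras\<close>

lemma DLR_simps:
  "Obj (DLR C \<Sigma> A \<mu>) = {d. double_lie_rinehart C \<Sigma> A \<mu> d}"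
  "Hom (DLR C \<Sigma> A \<mu>) d e = {\<phi>. dlr_hom C \<Sigma> A d e \<phi>}"
  "g \<cdot>\<^bsub>DLR C \<Sigma> A \<mu>\<^esub> f = g \<cdot>\<^bsub>C\<^esub> f" "\<langle>d\<rangle>\<^bsub>DLR C \<Sigma> A \<mu>\<^esub> = \<langle>und d\<rangle>\<^bsub>C\<^esub>"
  by (simp_all add: DLR_def)

context additive_symmetric_monoidal_category
begin

text \<open>Any arrows of the right types have strict images in any charts, so the algebra axioms
  play no part yet; this permits charting data before deciding whether they form an algebra.\<close>

lemma obtain_charts_for:
  assumes [simp]: "chart eS" "chart eM" "chart eA" "ob eS = \<Sigma>" "ob eM = M" "ob eA = A"
    and mult: "repr (eA ## eA) \<mu> eA m'"
    and l: "l \<in> Hom C (A \<otimes>\<^sub>o M) M" and r: "r \<in> Hom C (M \<otimes>\<^sub>o A) M"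
    and p: "\<rho> \<in> Hom C ((\<Sigma> \<otimes>\<^sub>o M) \<otimes>\<^sub>o (\<Sigma> \<otimes>\<^sub>o A)) ((\<Sigma> \<otimes>\<^sub>o A) \<otimes>\<^sub>o A)"
    and b: "b \<in> Hom C ((\<Sigma> \<otimes>\<^sub>o M) \<otimes>\<^sub>o (\<Sigma> \<otimes>\<^sub>o M)) (\<Sigma> \<otimes>\<^sub>o brk_sum C A M)"
  obtains l' r' p' bl' br' where "dlr_charts C eS eM eA \<Sigma> M A \<mu> l r \<rho> b m' l' r' p' bl' br'"
proof -
  let ?P = "atom (brk_sum C A M)"
  have [simp]: "\<Sigma> \<in> Obj C" "M \<in> Obj C" "A \<in> Obj C"
    using chartD(1)[of eS] chartD(1)[of eM] chartD(1)[of eA] by simp_all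
  then have [simp]: "brk_sum C A M \<in> Obj C"
    unfolding brk_sum_def by (simp add: dsum_obj)
  have *: "chart (eM ## eA)" "chart (eA ## eM)" "obj_list []" "ob (eM ## eA) = M \<otimes>\<^sub>o A" "ob (eA ## eM) = A \<otimes>\<^sub>o M"
    by simp_all
  obtain l' where l': "repr (eA ## eM) l eM l'"
    using repr_exists[of "eA ## eM" eM l] l by auto
  obtain r' where r': "repr (eM ## eA) r eM r'"
    using repr_exists[of "eM ## eA" eM r] r by auto
  obtain p' where p': "repr ((eS ## eM) ## (eS ## eA)) \<rho> ((eS ## eA) ## eA) p'"
    using repr_exists[of "(eS ## eM) ## (eS ## eA)" "(eS ## eA) ## eA" \<rho>] p by auto
  obtain B where B: "repr ((eS ## eM) ## (eS ## eM)) b (eS ## ?P) B"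
    using repr_exists[of "(eS ## eM) ## (eS ## eM)" "eS ## ?P" b] b by auto
  obtain i1 i2 p1 p2 where "charted_biproduct [] (M \<otimes>\<^sub>o A) (A \<otimes>\<^sub>o M) (eM ## eA) (eA ## eM) i1 i2 p1 p2"
    by (rule biproduct_charts[OF *])
  note P = charted_biproductD(3,4)[OF this, folded brk_sum_def]
  have "repr ((eS ## eM) ## (eS ## eM)) (proj_l C \<Sigma> A M \<cdot> b) ((eS ## eM) ## eA)
      ((sone (wires eS @ wires eM @ wires eA) \<star> (sone (wires eS) \<box> p1)) \<star> B)"
    unfolding proj_l_def by (rule repr_cong, (rule B P repr_rules | simp)+)
  moreover have "repr ((eS ## eM) ## (eS ## eM)) (proj_r C \<Sigma> A M \<cdot> b) ((eS ## eA) ## eM)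
      ((sone (wires eS @ wires eA @ wires eM) \<star> (sone (wires eS) \<box> p2)) \<star> B)"
    unfolding proj_r_def by (rule repr_cong, (rule B P repr_rules | simp)+)
  ultimately show thesis
    using mult l' r' p' b by (intro that, unfold_locales) simp_all
qed

abbreviation (input) object_charts where
  "object_charts \<Sigma> A \<mu> m' d l' r' p' bl' br' \<equiv> dlr_charts C (atom \<Sigma>) (atom (und d)) (atom A)
     \<Sigma> (und d) A \<mu> (lact d) (ract d) (anchor d) (bracket d) m' l' r' p' bl' br'"

lemma standard_charts:
  assumes "\<Sigma> \<in> Obj C" "A \<in> Obj C" "M \<in> Obj C"
    and "repr (atom A ## atom A) \<mu> (atom A) m'"
    and "l \<in> Hom C (A \<otimes>\<^sub>o M) M" and "r \<in> Hom C (M \<otimes>\<^sub>o A) M"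
    and "\<rho> \<in> Hom C ((\<Sigma> \<otimes>\<^sub>o M) \<otimes>\<^sub>o (\<Sigma> \<otimes>\<^sub>o A)) ((\<Sigma> \<otimes>\<^sub>o A) \<otimes>\<^sub>o A)"
    and "b \<in> Hom C ((\<Sigma> \<otimes>\<^sub>o M) \<otimes>\<^sub>o (\<Sigma> \<otimes>\<^sub>o M)) (\<Sigma> \<otimes>\<^sub>o brk_sum C A M)"
  obtains l' r' p' bl' br' where "dlr_charts C (atom \<Sigma>) (atom M) (atom A) \<Sigma> M A \<mu> l r \<rho> b m' l' r' p' bl' br'"
  by (rule obtain_charts_for[OF _ _ _ chart_simps(1) chart_simps(1) chart_simps(1) assms(4-8)])
    (use assms(1-3) that in simp_all)

lemma dlr_obtain_charts:
  assumes "double_lie_rinehart C \<Sigma> A \<mu> d" and "\<Sigma> \<in> Obj C" and "assoc_monoid C A \<mu>"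
    and "repr (atom A ## atom A) \<mu> (atom A) m'"
  obtains l' r' p' bl' br' where "object_charts \<Sigma> A \<mu> m' d l' r' p' bl' br'"
proof -
  have d: "und d \<in> Obj C" "lact d \<in> Hom C (A \<otimes>\<^sub>o und d) (und d)" "ract d \<in> Hom C (und d \<otimes>\<^sub>o A) (und d)"
      "anchor d \<in> Hom C ((\<Sigma> \<otimes>\<^sub>o und d) \<otimes>\<^sub>o (\<Sigma> \<otimes>\<^sub>o A)) ((\<Sigma> \<otimes>\<^sub>o A) \<otimes>\<^sub>o A)"
      "bracket d \<in> Hom C ((\<Sigma> \<otimes>\<^sub>o und d) \<otimes>\<^sub>o (\<Sigma> \<otimes>\<^sub>o und d)) (\<Sigma> \<otimes>\<^sub>o brk_sum C A (und d))"
    using assms(1) by (simp_all add: double_lie_rinehart_def Let_def bimodule_def)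
  have A: "A \<in> Obj C"
    using assms(3) by (simp add: assoc_monoid_def)
  show thesis
    by (rule standard_charts[OF assms(2) A d(1) assms(4) d(2-5)]) (rule that)
qed

lemma monoid_chart:
  assumes "assoc_monoid C A \<mu>"
  obtains m' where "repr (atom A ## atom A) \<mu> (atom A) m'"
proof -
  have "\<exists>m'. repr (atom A ## atom A) \<mu> (atom A) m'"
    using assms by (intro repr_exists) (simp_all add: assoc_monoid_def)
  then show thesis
    using that by blast
qed

lemma dlr_hom_in: "dlr_hom C \<Sigma> A d e \<phi> \<Longrightarrow> \<phi> \<in> Hom C (und d) (und e)"
  by (simp add: dlr_hom_def bimodule_hom_def)

text \<open>Identities and composites are recognised as morphisms in the strict calculus; the
  category laws are inherited from \<open>C\<close>.\<close>

lemma DLR_category: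
  assumes S: "\<Sigma> \<in> Obj C" and A: "assoc_monoid C A \<mu>"
  shows "category (DLR C \<Sigma> A \<mu>)"
proof -
  obtain m' where m': "repr (atom A ## atom A) \<mu> (atom A) m'"
    by (rule monoid_chart[OF A])
  have und: "und d \<in> Obj C" if "double_lie_rinehart C \<Sigma> A \<mu> d" for d
    using that by (simp add: double_lie_rinehart_def Let_def bimodule_def)
  show ?thesis
  proof (unfold_locales; unfold DLR_simps mem_Collect_eq)
    fix d assume d: "double_lie_rinehart C \<Sigma> A \<mu> d"
    obtain l r p bl br where c: "object_charts \<Sigma> A \<mu> m' d l r p bl br"
      by (rule dlr_obtain_charts[OF d S A m'])
    note [simp] = dlr_charts.typing[OF c]
    show "dlr_hom C \<Sigma> A d d \<langle>und d\<rangle>"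
      using dlr_hom_iff[OF c c refl refl refl refl refl refl refl refl repr_ident[of "atom (und d)"]]
      by (simp add: strict.hom_axioms_one)
  next
    fix d1 d2 d3 g f
    assume d: "double_lie_rinehart C \<Sigma> A \<mu> d1" "double_lie_rinehart C \<Sigma> A \<mu> d2" "double_lie_rinehart C \<Sigma> A \<mu> d3"
      and h: "dlr_hom C \<Sigma> A d2 d3 g" "dlr_hom C \<Sigma> A d1 d2 f"
    obtain l r p bl br where c1: "object_charts \<Sigma> A \<mu> m' d1 l r p bl br"
      by (rule dlr_obtain_charts[OF d(1) S A m'])
    obtain l2 r2 p2 bl2 br2 where c2: "object_charts \<Sigma> A \<mu> m' d2 l2 r2 p2 bl2 br2"
      by (rule dlr_obtain_charts[OF d(2) S A m'])
    obtain l3 r3 p3 bl3 br3 where c3: "object_charts \<Sigma> A \<mu> m' d3 l3 r3 p3 bl3 br3"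
      by (rule dlr_obtain_charts[OF d(3) S A m'])
    note [simp] = dlr_charts.typing[OF c1] dlr_charts.typing[OF c2] dlr_charts.typing[OF c3]
    obtain f' where f': "repr (atom (und d1)) f (atom (und d2)) f'"
      using repr_exists[of "atom (und d1)" "atom (und d2)" f] dlr_hom_in[OF h(2)] by auto
    obtain g' where g': "repr (atom (und d2)) g (atom (und d3)) g'"
      using repr_exists[of "atom (und d2)" "atom (und d3)" g] dlr_hom_in[OF h(1)] by auto
    have "strict.hom_axioms (wires (atom \<Sigma>)) (wires (atom A)) l r bl br l3 r3 bl3 br3 (g' \<star> f')"
    proof (rule strict.hom_axioms_cmp[where M = "[und d1]" and ?M2.0 = "[und d2]" and ?M3.0 = "[und d3]"])
      show "strict.hom_axioms (wires (atom \<Sigma>)) (wires (atom A)) l r bl br l2 r2 bl2 br2 f'"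
        using h(2) dlr_hom_iff[OF c1 c2 refl refl refl refl refl refl refl refl f'] by simp
      show "strict.hom_axioms (wires (atom \<Sigma>)) (wires (atom A)) l2 r2 bl2 br2 l3 r3 bl3 br3 g'"
        using h(1) dlr_hom_iff[OF c2 c3 refl refl refl refl refl refl refl refl g'] by simp
    qed (use f'[THEN repr_arr(1)] f'[THEN repr_arr(2)] f'[THEN repr_arr(3)]
        g'[THEN repr_arr(1)] g'[THEN repr_arr(2)] g'[THEN repr_arr(3)] in simp_all)
    then show "dlr_hom C \<Sigma> A d1 d3 (g \<cdot> f)"
      using dlr_hom_iff[OF c1 c3 refl refl refl refl refl refl refl refl repr_comp[OF f' g']] by simp
  qed (meson und dlr_hom_in comp_ident ident_comp comp_assoc)+
qed

end

section \<open>The shift in charts\<close>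

locale shift_setup = additive_symmetric_monoidal_category C
  for C :: "('o, 'm, 'z) asm_category_scheme" (structure) +
  fixes \<Sigma> T A :: 'o and \<epsilon> \<mu> :: 'm
  assumes Sigma_obj [simp]: "\<Sigma> \<in> Obj C" and T_obj [simp]: "T \<in> Obj C"
    and eps_iso: "iso_arrow C (T \<otimes>\<^sub>o \<Sigma>) \<I> \<epsilon>"
    and monoid: "assoc_monoid C A \<mu>"
begin

lemma A_obj [simp]: "A \<in> Obj C"
  using monoid by (simp add: assoc_monoid_def)

definition m' where "m' = transport (atom A ## atom A) (A \<otimes>\<^sub>o A, \<mu>, A) (atom A)"
definition E where "E = transport (atom T ## atom \<Sigma>) (T \<otimes>\<^sub>o \<Sigma>, \<epsilon>, \<I>) unit_chart"
definition E' where "E' = transport unit_chart (\<I>, inv_arrow C (T \<otimes>\<^sub>o \<Sigma>) \<I> \<epsilon>, T \<otimes>\<^sub>o \<Sigma>) (atom T ## atom \<Sigma>)"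

lemma repr_mult: "repr (atom A ## atom A) \<mu> (atom A) m'"
  using monoid by (simp add: repr_def m'_def assoc_monoid_def)

lemma eps_inverse: "inverse_arrows C (T \<otimes>\<^sub>o \<Sigma>) \<I> \<epsilon> (inv_arrow C (T \<otimes>\<^sub>o \<Sigma>) \<I> \<epsilon>)"
  using eps_iso by (intro inv_arrow) simp_all

lemma repr_eps:
  "repr (atom T ## atom \<Sigma>) \<epsilon> unit_chart E" "repr unit_chart (inv_arrow C (T \<otimes>\<^sub>o \<Sigma>) \<I> \<epsilon>) (atom T ## atom \<Sigma>) E'"
  using eps_inverse by (simp_all add: repr_def E_def E'_def inverse_arrows_def)

sublocale inv: strict_invertible obj_list sarr sdom scod scmp sten sone ssw sadd sneg szero "[\<Sigma>]" "[T]" E E'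
proof
  show "E \<star> E' = sone []"
    using repr_iff[OF repr_comp[OF repr_eps(2,1)] repr_ident[of unit_chart \<I>]] eps_inverse
    by (simp add: inverse_arrows_def)
  show "E' \<star> E = sone ([T] @ [\<Sigma>])"
    using repr_iff[OF repr_comp[OF repr_eps] repr_ident[of "atom T ## atom \<Sigma>" "T \<otimes>\<^sub>o \<Sigma>"]] eps_inverse
    by (simp add: inverse_arrows_def)
qed (use repr_eps[THEN repr_arr(1)] repr_eps[THEN repr_arr(2)] repr_eps[THEN repr_arr(3)] in simp_all)

text \<open>Reading \<Sigma> \<otimes> M through the two-part chart
  \<open>atom \<Sigma> ## eM\<close> puts the shifted structure into the same strict category. Its
  data are then those of the right side of \<open>dlr_axioms_shift\<close>.\<close>

lemma shift_charts:
  assumes "dlr_charts C (atom \<Sigma>) eM (atom A) \<Sigma> M A \<mu> l r \<rho> b m' l' r' p' bl' br'"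
    and p0: "sarr p0" "sdom p0 = \<Sigma> # wires eM @ [A]" "scod p0 = [A, A]"
    and p': "p' = (sone [\<Sigma>] \<box> p0) \<star> (ssw (\<Sigma> # wires eM) [\<Sigma>] \<box> sone [A])"
  shows "dlr_charts C unit_chart (atom \<Sigma> ## eM) (atom A) \<I> (\<Sigma> \<otimes>\<^sub>o M) A \<mu>
      (susp_lact C \<Sigma> A M l) (susp_ract C \<Sigma> A M r)
      (unit_anchor C A (\<Sigma> \<otimes>\<^sub>o M) (shift_anchor C \<Sigma> T \<epsilon> A M \<rho>))
      (unit_bracket C A (\<Sigma> \<otimes>\<^sub>o M) (shift_bracket C \<Sigma> A M b))
      m' ((sone [\<Sigma>] \<box> l') \<star> (ssw [A] [\<Sigma>] \<box> sone (wires eM))) (sone [\<Sigma>] \<box> r') p0 bl'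
      ((ssw [\<Sigma>] [A] \<box> sone (wires eM)) \<star> br')"
proof -
  interpret d: dlr_charts C "atom \<Sigma>" eM "atom A" \<Sigma> M A \<mu> l r \<rho> b m' l' r' p' bl' br' by fact
  let ?p = "unit_anchor C A (\<Sigma> \<otimes>\<^sub>o M) (shift_anchor C \<Sigma> T \<epsilon> A M \<rho>)"
  let ?eS = "atom \<Sigma>" and ?eA = "atom A" and ?N = "\<Sigma> \<otimes>\<^sub>o M"
  let ?eN = "?eS ## eM" and ?X = "(\<Sigma> \<otimes>\<^sub>o M) \<otimes>\<^sub>o A" and ?Y = "(\<Sigma> \<otimes>\<^sub>o A) \<otimes>\<^sub>o M" and ?Z = "A \<otimes>\<^sub>o (\<Sigma> \<otimes>\<^sub>o M)"
  note [simp] = p0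
  note repr_gens = d.repr_mult d.repr_lact d.repr_ract d.repr_anchor repr_eps
  note [simp] = repr_eps[THEN repr_arr(1)] repr_eps[THEN repr_arr(2)] repr_eps[THEN repr_arr(3)]
  have l: "repr (?eA ## ?eN) (susp_lact C \<Sigma> A M l) ?eN ((sone [\<Sigma>] \<box> l') \<star> (ssw [A] [\<Sigma>] \<box> sone (wires eM)))"
    unfolding susp_lact_def by (rule repr_cong, (rule repr_gens repr_rules | simp)+)
  have r: "repr (?eN ## ?eA) (susp_ract C \<Sigma> A M r) ?eN (sone [\<Sigma>] \<box> r')"
    unfolding susp_ract_def by (rule repr_cong, (rule repr_gens repr_rules | simp)+)
  \<comment> \<open>This is \<open>shift_anchor\<close> read strictly: units and associators have
    vanished, \<epsilon> and its inverse have become \<open>E\<close> and \<open>E'\<close>. Then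
    \<open>anchor_unshift\<close> contracts it to \<open>p0\<close>.\<close>
  have "repr ((unit_chart ## ?eN) ## (unit_chart ## ?eA)) ?p ((unit_chart ## ?eA) ## ?eA)
     ((E \<box> sone ([A] @ [A])) \<star> (sone [T] \<box> p') \<star> (ssw (\<Sigma> # wires eM) [T] \<box> sone ([\<Sigma>] @ [A]))
        \<star> (sone (\<Sigma> # wires eM) \<box> E' \<box> sone [A]))"
    unfolding unit_anchor_def shift_anchor_def Let_def
    by (rule repr_cong, (rule repr_gens repr_rules | simp)+)
  then have p: "repr ((unit_chart ## ?eN) ## (unit_chart ## ?eA)) ?p ((unit_chart ## ?eA) ## ?eA) p0"
    unfolding p' by (subst (asm) inv.anchor_unshift) simp_all
  obtain i1 i2 p1 p2 B where
      P: "charted_biproduct (wires ?eS) (M \<otimes>\<^sub>o A) (A \<otimes>\<^sub>o M) (eM ## ?eA) (?eA ## eM) i1 i2 p1 p2"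
    and B0: "repr (?eN ## ?eN) b (?eS ## atom (brk_sum C A M)) B"
    and bl: "(sone (wires ?eS) \<box> p1) \<star> B = bl'" and br: "(sone (wires ?eS) \<box> p2) \<star> B = br'"
    by (rule d.bracket_charts)
  note repr_b = charted_biproductD(1-4)[OF P, folded brk_sum_def] B0
  have *: "chart (?eN ## ?eA)" "chart ((?eS ## ?eA) ## eM)" "chart (?eA ## ?eN)" "obj_list []"
    "ob (?eN ## ?eA) = ?X" "ob ((?eS ## ?eA) ## eM) = ?Y" "ob (?eA ## ?eN) = ?Z"
    by simp_all
  \<comment> \<open>Besides the sum inside the suspension two more occur: the target of
    \<open>distrib\<close>, here, and that of the shifted bracket, next.\<close>
  obtain k1 k2 q1 q2 where "charted_biproduct [] ?X ?Y (?eN ## ?eA) ((?eS ## ?eA) ## eM) k1 k2 q1 q2"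
    by (rule biproduct_charts[OF *(1,2,4,5,6)])
  note Q = charted_biproductD[OF this] and repr_q = charted_biproductD(1-4)[OF this]
  obtain j1 j2 s1 s2 where "charted_biproduct [] ?X ?Z (?eN ## ?eA) (?eA ## ?eN) j1 j2 s1 s2"
    by (rule biproduct_charts[OF *(1,3,4,5,7)])
  note S = charted_biproductD[OF this, folded brk_sum_def]
    and repr_s = charted_biproductD(1-4)[OF this, folded brk_sum_def]
  interpret q: strict_biproduct obj_list sarr sdom scod "(\<star>)" "(\<box>)" sone ssw "(\<boxplus>)" sneg szero
      "[]" "wires (?eN ## ?eA)" "wires ((?eS ## ?eA) ## eM)" "[?X \<oplus>\<^sub>o ?Y]" k1 k2 q1 q2
    by (rule Q(5))
  interpret s: strict_biproduct obj_list sarr sdom scod "(\<star>)" "(\<box>)" sone ssw "(\<boxplus>)" sneg szero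
      "[]" "wires (?eN ## ?eA)" "wires (?eA ## ?eN)" "[brk_sum C A ?N]" j1 j2 s1 s2
    by (rule S(5))
  have [simp]: "brk_sum C A M \<in> Obj C" "brk_sum C A ?N \<in> Obj C" "?X \<oplus>\<^sub>o ?Y \<in> Obj C"
    unfolding brk_sum_def by (simp_all add: dsum_obj)
  note [simp] = repr_b[THEN repr_arr(1)] repr_b[THEN repr_arr(2)] repr_b[THEN repr_arr(3)]
    repr_q[THEN repr_arr(1)] repr_q[THEN repr_arr(2)] repr_q[THEN repr_arr(3)]
    repr_s[THEN repr_arr(1)] repr_s[THEN repr_arr(2)] repr_s[THEN repr_arr(3)]
  let ?b = "unit_bracket C A ?N (shift_bracket C \<Sigma> A M b)"
  \<comment> \<open>Read from the right: split by the projections under \<Sigma>, as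
    \<open>distrib\<close> does, then cross the second summand only. Projecting with
    \<open>s1\<close> or \<open>s2\<close> leaves a single term.\<close>
  let ?B = "((j1 \<star> q1) \<boxplus> (j2 \<star> (ssw [\<Sigma>] [A] \<box> sone (wires eM)) \<star> q2))
       \<star> ((k1 \<star> (sone [\<Sigma>] \<box> p1)) \<boxplus> (k2 \<star> (sone [\<Sigma>] \<box> p2))) \<star> B"
  have B: "repr ((unit_chart ## ?eN) ## (unit_chart ## ?eN)) ?b (unit_chart ## atom (brk_sum C A ?N)) ?B"
    unfolding unit_bracket_def shift_bracket_def dsumm_def distrib_def proj_l_def proj_r_def
    by (rule repr_cong, (rule repr_b repr_q repr_s repr_rules | simp)+)
  have "repr ((unit_chart ## ?eN) ## (unit_chart ## ?eN)) (proj_l C \<I> A ?N \<cdot> ?b) ((unit_chart ## ?eN) ## ?eA) (s1 \<star> ?B)"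
    unfolding proj_l_def by (rule repr_cong, (rule B repr_s repr_rules | simp)+)
  also have "s1 \<star> ?B = bl'"
    by (simp add: strict.cmp_add strict.add_cmp flip: bl)
  finally have bl0: "repr ((unit_chart ## ?eN) ## (unit_chart ## ?eN)) (proj_l C \<I> A ?N \<cdot> ?b) ((unit_chart ## ?eN) ## ?eA) bl'" .
  have "repr ((unit_chart ## ?eN) ## (unit_chart ## ?eN)) (proj_r C \<I> A ?N \<cdot> ?b) ((unit_chart ## ?eA) ## ?eN) (s2 \<star> ?B)"
    unfolding proj_r_def by (rule repr_cong, (rule B repr_s repr_rules | simp)+)
  also have "s2 \<star> ?B = (ssw [\<Sigma>] [A] \<box> sone (wires eM)) \<star> br'"
    by (simp add: strict.cmp_add strict.add_cmp flip: br)
  finally have br0: "repr ((unit_chart ## ?eN) ## (unit_chart ## ?eN)) (proj_r C \<I> A ?N \<cdot> ?b) ((unit_chart ## ?eA) ## ?eN)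
      ((ssw [\<Sigma>] [A] \<box> sone (wires eM)) \<star> br')" .
  show ?thesis
    by unfold_locales (use d.repr_mult l r p bl0 br0 repr_arr(4)[OF B] in simp_all)
qed

lemma double_lie_rinehart_shift:
  assumes charts: "dlr_charts C (atom \<Sigma>) eM (atom A) \<Sigma> M A \<mu> l r \<rho> b m' l' r' p' bl' br'"
    and p0: "sarr p0" "sdom p0 = \<Sigma> # wires eM @ [A]" "scod p0 = [A, A]"
    and p': "p' = (sone [\<Sigma>] \<box> p0) \<star> (ssw (\<Sigma> # wires eM) [\<Sigma>] \<box> sone [A])"
    and d: "und d = M" "lact d = l" "ract d = r" "anchor d = \<rho>" "bracket d = b"
  shows "double_lie_rinehart C \<Sigma> A \<mu> d \<longleftrightarrow> double_lie_rinehart C \<I> A \<mu> (shift_dlr C \<Sigma> T \<epsilon> A d)"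
proof -
  interpret d: dlr_charts C "atom \<Sigma>" eM "atom A" \<Sigma> M A \<mu> l r \<rho> b m' l' r' p' bl' br' by (rule charts)
  interpret sd: strict_dlr obj_list sarr sdom scod "(\<star>)" "(\<box>)" sone ssw "(\<boxplus>)" sneg szero
      "[\<Sigma>]" "wires eM" "[A]" m' l' r' p0 bl' br'
    using inv.faithful(1) p0 by unfold_locales simp_all
  have "double_lie_rinehart C \<Sigma> A \<mu> d \<longleftrightarrow> strict.dlr_axioms [\<Sigma>] (wires eM) [A] m' l' r' p' bl' br'"
    using d.double_lie_rinehart_iff[OF d] by simp
  also have "\<dots> \<longleftrightarrow> strict.dlr_axioms [] ([\<Sigma>] @ wires eM) [A] m'
      ((sone [\<Sigma>] \<box> l') \<star> (ssw [A] [\<Sigma>] \<box> sone (wires eM))) (sone [\<Sigma>] \<box> r') p0 bl'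
      ((ssw [\<Sigma>] [A] \<box> sone (wires eM)) \<star> br')"
    using sd.dlr_axioms_shift unfolding sd.p_def sd.lS_def sd.rS_def sd.br0_def p' by simp
  also have "\<dots> \<longleftrightarrow> double_lie_rinehart C \<I> A \<mu> (shift_dlr C \<Sigma> T \<epsilon> A d)"
    using dlr_charts.double_lie_rinehart_iff[OF shift_charts[OF charts p0 p'], of "shift_dlr C \<Sigma> T \<epsilon> A d"]
    by (simp add: shift_dlr_def d)
  finally show ?thesis .
qed

end

section \<open>The shift functor is an equivalence\<close>

context shift_setup
begin

abbreviation (input) "Sigma_dlr \<equiv> double_lie_rinehart C \<Sigma> A \<mu>"
abbreviation (input) "unit_dlr \<equiv> double_lie_rinehart C \<I> A \<mu>"
abbreviation (input) "shift \<equiv> shift_dlr C \<Sigma> T \<epsilon> A"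

lemma shift_sel [simp]:
  "und (shift d) = \<Sigma> \<otimes>\<^sub>o und d" "lact (shift d) = susp_lact C \<Sigma> A (und d) (lact d)"
  "ract (shift d) = susp_ract C \<Sigma> A (und d) (ract d)"
  "anchor (shift d) = unit_anchor C A (\<Sigma> \<otimes>\<^sub>o und d) (shift_anchor C \<Sigma> T \<epsilon> A (und d) (anchor d))"
  "bracket (shift d) = unit_bracket C A (\<Sigma> \<otimes>\<^sub>o und d) (shift_bracket C \<Sigma> A (und d) (bracket d))"
  by (simp_all add: shift_dlr_def Let_def)

lemma anchor_shift:
  assumes "dlr_charts C (atom \<Sigma>) eM (atom A) \<Sigma> M A \<mu> l r \<rho> b m' l' r' p' bl' br'"
  obtains p0 where "sarr p0" "sdom p0 = \<Sigma> # wires eM @ [A]" "scod p0 = [A, A]"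
    "p' = (sone [\<Sigma>] \<box> p0) \<star> (ssw (\<Sigma> # wires eM) [\<Sigma>] \<box> sone [A])"
proof -
  interpret dlr_charts C "atom \<Sigma>" eM "atom A" \<Sigma> M A \<mu> l r \<rho> b m' l' r' p' bl' br' by fact
  show thesis
    by (rule inv.anchor_shift[of p' "\<Sigma> # wires eM" "[A]" "[A, A]"]) (simp_all add: that)
qed

lemma shift_object_iff:
  assumes "M \<in> Obj C" "l \<in> Hom C (A \<otimes>\<^sub>o M) M" "r \<in> Hom C (M \<otimes>\<^sub>o A) M"
    and "\<rho> \<in> Hom C ((\<Sigma> \<otimes>\<^sub>o M) \<otimes>\<^sub>o (\<Sigma> \<otimes>\<^sub>o A)) ((\<Sigma> \<otimes>\<^sub>o A) \<otimes>\<^sub>o A)"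
    and "b \<in> Hom C ((\<Sigma> \<otimes>\<^sub>o M) \<otimes>\<^sub>o (\<Sigma> \<otimes>\<^sub>o M)) (\<Sigma> \<otimes>\<^sub>o brk_sum C A M)"
    and d: "und d = M" "lact d = l" "ract d = r" "anchor d = \<rho>" "bracket d = b"
  shows "Sigma_dlr d \<longleftrightarrow> unit_dlr (shift d)"
proof -
  obtain l' r' p' bl' br' where
    c: "dlr_charts C (atom \<Sigma>) (atom M) (atom A) \<Sigma> M A \<mu> l r \<rho> b m' l' r' p' bl' br'"
    by (rule standard_charts[OF Sigma_obj A_obj assms(1) repr_mult assms(2-5)])
  obtain p0 where p0: "sarr p0" "sdom p0 = \<Sigma> # wires (atom M) @ [A]" "scod p0 = [A, A]"
      "p' = (sone [\<Sigma>] \<box> p0) \<star> (ssw (\<Sigma> # wires (atom M)) [\<Sigma>] \<box> sone [A])"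
    by (rule anchor_shift[OF c])
  show ?thesis
    by (rule double_lie_rinehart_shift[OF c p0 d])
qed

abbreviation (input) shift_l where
  "shift_l X l' \<equiv> (sone [\<Sigma>] \<box> l') \<star> (ssw [A] [\<Sigma>] \<box> sone [X])"
abbreviation (input) shift_r where "shift_r r' \<equiv> sone [\<Sigma>] \<box> r'"
abbreviation (input) shift_br where "shift_br X br' \<equiv> (ssw [\<Sigma>] [A] \<box> sone [X]) \<star> br'"
abbreviation (input) shifted_charts where
  "shifted_charts d l' r' p0 bl' br' \<equiv> dlr_charts C unit_chart (atom \<Sigma> ## atom (und d)) (atom A)
     \<I> (\<Sigma> \<otimes>\<^sub>o und d) A \<mu> (lact (shift d)) (ract (shift d)) (anchor (shift d)) (bracket (shift d))
     m' (shift_l (und d) l') (shift_r r') p0 bl' (shift_br (und d) br')"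

lemma obtain_charts:
  assumes "Sigma_dlr d"
  obtains l' r' p' bl' br' p0 where
    "object_charts \<Sigma> A \<mu> m' d l' r' p' bl' br'"
    "shifted_charts d l' r' p0 bl' br'"
proof -
  obtain l' r' p' bl' br' where c: "object_charts \<Sigma> A \<mu> m' d l' r' p' bl' br'"
    by (rule dlr_obtain_charts[OF assms Sigma_obj monoid repr_mult])
  obtain p0 where p0: "sarr p0" "sdom p0 = \<Sigma> # wires (atom (und d)) @ [A]" "scod p0 = [A, A]"
      "p' = (sone [\<Sigma>] \<box> p0) \<star> (ssw (\<Sigma> # wires (atom (und d))) [\<Sigma>] \<box> sone [A])"
    by (rule anchor_shift[OF c])
  show thesis
    by (rule that[OF c]) (use shift_charts[OF c p0] in simp)
qed

text \<open>In the charts of the shifted objects, \<Sigma> \<otimes> \<phi> is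
  \<open>sone [\<Sigma>] \<box> f\<close>, so this is \<open>hom_axioms_shift\<close> between two
  translations. Read from right to left it gives fullness.\<close>

lemma dlr_hom_shift:
  assumes d: "Sigma_dlr d" and e: "Sigma_dlr e"
    and "repr (atom (und d)) \<phi> (atom (und e)) f"
  shows "dlr_hom C \<Sigma> A d e \<phi> \<longleftrightarrow> dlr_hom C \<I> A (shift d) (shift e) (\<langle>\<Sigma>\<rangle> \<otimes>\<^sub>m \<phi>)"
proof -
  obtain l r p bl br p0 where cd:
    "object_charts \<Sigma> A \<mu> m' d l r p bl br"
    "shifted_charts d l r p0 bl br"
    by (rule obtain_charts[OF d])
  obtain l2 r2 p2 bl2 br2 q0 where ce:
    "object_charts \<Sigma> A \<mu> m' e l2 r2 p2 bl2 br2"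
    "shifted_charts e l2 r2 q0 bl2 br2"
    by (rule obtain_charts[OF e])
  note [simp] = dlr_charts.typing[OF cd(1)] dlr_charts.typing[OF ce(1)]
  note f = assms(3)
  have Sf: "repr (atom \<Sigma> ## atom (und d)) (\<langle>\<Sigma>\<rangle> \<otimes>\<^sub>m \<phi>) (atom \<Sigma> ## atom (und e)) (sone [\<Sigma>] \<box> f)"
    by (rule repr_cong, (rule f repr_rules | simp)+)
  have "dlr_hom C \<Sigma> A d e \<phi> \<longleftrightarrow> strict.hom_axioms [\<Sigma>] [A] l r bl br l2 r2 bl2 br2 f"
    using dlr_hom_iff[OF cd(1) ce(1) refl refl refl refl refl refl refl refl f] by simp
  also have "\<dots> \<longleftrightarrow> strict.hom_axioms [] [A]
      (shift_l (und d) l) (shift_r r) bl (shift_br (und d) br)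
      (shift_l (und e) l2) (shift_r r2) bl2 (shift_br (und e) br2)
      (sone [\<Sigma>] \<box> f)"
    by (rule inv.hom_axioms_shift) (use repr_arr(1-3)[OF f] in simp_all)
  also have "\<dots> \<longleftrightarrow> dlr_hom C \<I> A (shift d) (shift e) (\<langle>\<Sigma>\<rangle> \<otimes>\<^sub>m \<phi>)"
    using dlr_hom_iff[OF cd(2) ce(2) shift_sel(1) refl refl refl shift_sel(1) refl refl refl Sf] by simp
  finally show ?thesis .
qed

lemma und_obj: "double_lie_rinehart C \<Sigma>' A \<mu> d \<Longrightarrow> und d \<in> Obj C"
  by (simp add: double_lie_rinehart_def Let_def bimodule_def)

lemma hom_chart:
  assumes "X \<in> Obj C" "Y \<in> Obj C" "\<phi> \<in> Hom C X Y"
  obtains f where "repr (atom X) \<phi> (atom Y) f"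
proof -
  have "\<exists>f. repr (atom X) \<phi> (atom Y) f"
    using assms by (intro repr_exists) simp_all
  then show thesis
    using that by blast
qed

lemma Sigma_ten_chart:
  assumes "repr (atom X) \<phi> (atom Y) f"
  shows "repr (atom \<Sigma> ## atom X) (\<langle>\<Sigma>\<rangle> \<otimes>\<^sub>m \<phi>) (atom \<Sigma> ## atom Y) (sone [\<Sigma>] \<box> f)"
  using repr_ten[OF repr_ident[of "atom \<Sigma>" \<Sigma>] assms] by simp

lemma Sigma_ten_faithful:
  assumes "X \<in> Obj C" "Y \<in> Obj C" "\<phi> \<in> Hom C X Y" "\<psi> \<in> Hom C X Y" "\<langle>\<Sigma>\<rangle> \<otimes>\<^sub>m \<phi> = \<langle>\<Sigma>\<rangle> \<otimes>\<^sub>m \<psi>"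
  shows "\<phi> = \<psi>"
proof -
  obtain f where f: "repr (atom X) \<phi> (atom Y) f"
    by (rule hom_chart[OF assms(1-3)])
  obtain g where g: "repr (atom X) \<psi> (atom Y) g"
    by (rule hom_chart[OF assms(1,2,4)])
  have "sone [\<Sigma>] \<box> f = sone [\<Sigma>] \<box> g"
    using repr_iff[OF Sigma_ten_chart[OF f] Sigma_ten_chart[OF g]] assms(5) by simp
  then have "f = g"
    using inv.faithful(1)[unfolded strict.faithful_def, rule_format, of f g] repr_arr(1-3)[OF f] repr_arr(1-3)[OF g]
    by simp
  then show ?thesis
    using repr_iff[OF f g] by simp
qed

text \<open>Division by \<Sigma> takes place in the strict category; \<open>repr_surj\<close> brings
  the quotient back to \<open>C\<close>.\<close>

lemma Sigma_ten_full:
  assumes "X \<in> Obj C" "Y \<in> Obj C" "\<psi> \<in> Hom C (\<Sigma> \<otimes>\<^sub>o X) (\<Sigma> \<otimes>\<^sub>o Y)"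
  obtains \<phi> f where "repr (atom X) \<phi> (atom Y) f" "\<psi> = \<langle>\<Sigma>\<rangle> \<otimes>\<^sub>m \<phi>"
proof -
  have "\<exists>h. repr (atom \<Sigma> ## atom X) \<psi> (atom \<Sigma> ## atom Y) h"
    using assms by (intro repr_exists) simp_all
  then obtain h where h: "repr (atom \<Sigma> ## atom X) \<psi> (atom \<Sigma> ## atom Y) h"
    by blast
  obtain f where f: "sarr f" "sdom f = [X]" "scod f = [Y]" "h = sone [\<Sigma>] \<box> f"
    by (rule inv.full[of h "[X]" "[Y]"]) (use repr_arr(1-3)[OF h] in simp_all)
  obtain \<phi> where \<phi>: "repr (atom X) \<phi> (atom Y) f"
    using repr_surj[of "atom X" "atom Y" f] f assms by auto
  show thesis
    using that[OF \<phi>] repr_iff[OF h Sigma_ten_chart[OF \<phi>]] f(4) by simp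
qed

lemma shift_functor:
  "category_functor (DLR C \<Sigma> A \<mu>) (DLR C \<I> A \<mu>) shift (\<lambda>_ _ \<phi>. \<langle>\<Sigma>\<rangle> \<otimes>\<^sub>m \<phi>)"
proof (intro category_functor.intro category_functor_axioms.intro)
  show "category (DLR C \<Sigma> A \<mu>)" "category (DLR C \<I> A \<mu>)"
    by (simp_all add: DLR_category monoid)
next
  fix d assume "d \<in> Obj (DLR C \<Sigma> A \<mu>)"
  then have d: "Sigma_dlr d"
    by (simp add: DLR_simps)
  then show "shift d \<in> Obj (DLR C \<I> A \<mu>)"
    using shift_object_iff[of "und d" "lact d" "ract d" "anchor d" "bracket d" d]
    by (simp add: DLR_simps double_lie_rinehart_def[of C \<Sigma>] Let_def bimodule_def[of C A \<mu> "und d"])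
  show "\<langle>\<Sigma>\<rangle> \<otimes>\<^sub>m \<langle>d\<rangle>\<^bsub>DLR C \<Sigma> A \<mu>\<^esub> = \<langle>shift d\<rangle>\<^bsub>DLR C \<I> A \<mu>\<^esub>"
    using und_obj[OF d] by (simp add: DLR_simps tensor_ident)
next
  fix d e \<phi> assume "d \<in> Obj (DLR C \<Sigma> A \<mu>)" "e \<in> Obj (DLR C \<Sigma> A \<mu>)" "\<phi> \<in> Hom (DLR C \<Sigma> A \<mu>) d e"
  then have a: "Sigma_dlr d" "Sigma_dlr e" "dlr_hom C \<Sigma> A d e \<phi>"
    by (simp_all add: DLR_simps)
  obtain f where f: "repr (atom (und d)) \<phi> (atom (und e)) f"
    by (rule hom_chart[OF und_obj[OF a(1)] und_obj[OF a(2)] dlr_hom_in[OF a(3)]])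
  show "\<langle>\<Sigma>\<rangle> \<otimes>\<^sub>m \<phi> \<in> Hom (DLR C \<I> A \<mu>) (shift d) (shift e)"
    using dlr_hom_shift[OF a(1,2) f] a(3) by (simp add: DLR_simps)
next
  fix d1 d2 d3 g f
  assume "d1 \<in> Obj (DLR C \<Sigma> A \<mu>)" "d2 \<in> Obj (DLR C \<Sigma> A \<mu>)" "d3 \<in> Obj (DLR C \<Sigma> A \<mu>)"
    "g \<in> Hom (DLR C \<Sigma> A \<mu>) d2 d3" "f \<in> Hom (DLR C \<Sigma> A \<mu>) d1 d2"
  then have "und d1 \<in> Obj C" "und d2 \<in> Obj C" "und d3 \<in> Obj C"
      "g \<in> Hom C (und d2) (und d3)" "f \<in> Hom C (und d1) (und d2)"
    by (auto simp: DLR_simps dest: und_obj dlr_hom_in)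
  then show "\<langle>\<Sigma>\<rangle> \<otimes>\<^sub>m (g \<cdot>\<^bsub>DLR C \<Sigma> A \<mu>\<^esub> f) = (\<langle>\<Sigma>\<rangle> \<otimes>\<^sub>m g) \<cdot>\<^bsub>DLR C \<I> A \<mu>\<^esub> (\<langle>\<Sigma>\<rangle> \<otimes>\<^sub>m f)"
    using tensor_comp[of \<Sigma> \<Sigma> \<Sigma> "und d1" "und d2" "und d3" "\<langle>\<Sigma>\<rangle>" "\<langle>\<Sigma>\<rangle>" g f]
    by (simp add: DLR_simps ident_in ident_comp[of \<Sigma> \<Sigma>])
qed

lemma shift_surj:
  assumes "unit_dlr e"
  shows "\<exists>d. Sigma_dlr d \<and> (\<exists>\<kappa>. iso_arrow (DLR C \<I> A \<mu>) (shift d) e \<kappa>)"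
proof -
  let ?N = "und e" and ?S = "atom \<Sigma>" and ?A = "atom A"
  \<comment> \<open>Up to isomorphism the only candidate, since \<Sigma> \<otimes> M has to be
    isomorphic to the given object.\<close>
  define M where "M = T \<otimes>\<^sub>o ?N"
  let ?M = "atom M"
  have N [simp]: "?N \<in> Obj C"
    by (rule und_obj[OF assms])
  have M [simp]: "M \<in> Obj C"
    by (simp add: M_def)
  \<comment> \<open>Here M is cut into its two factors so that \<epsilon>, with its arguments
    exchanged, can contract \<Sigma> and T. Below, M is a single wire.\<close>
  have "\<exists>\<kappa>. repr (?S ## (atom T ## atom ?N)) \<kappa> (atom ?N) ((E \<star> ssw [\<Sigma>] [T]) \<box> sone [?N])"
    by (rule repr_surj) simp_all
  then obtain \<kappa> where \<kappa>: "repr (?S ## (atom T ## atom ?N)) \<kappa> (atom ?N) ((E \<star> ssw [\<Sigma>] [T]) \<box> sone [?N])"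
    by blast
  have "\<exists>\<kappa>'. repr (atom ?N) \<kappa>' (?S ## (atom T ## atom ?N)) ((ssw [T] [\<Sigma>] \<star> E') \<box> sone [?N])"
    by (rule repr_surj) simp_all
  then obtain \<kappa>' where \<kappa>': "repr (atom ?N) \<kappa>' (?S ## (atom T ## atom ?N)) ((ssw [T] [\<Sigma>] \<star> E') \<box> sone [?N])"
    by blast
  have in_Hom: "\<kappa> \<in> Hom C (\<Sigma> \<otimes>\<^sub>o M) ?N" "\<kappa>' \<in> Hom C ?N (\<Sigma> \<otimes>\<^sub>o M)"
    using repr_arr(4)[OF \<kappa>] repr_arr(4)[OF \<kappa>'] by (simp_all add: M_def)
  have \<kappa>\<kappa>': "\<kappa> \<cdot> \<kappa>' = \<langle>?N\<rangle>"
    using repr_iff[OF repr_comp[OF \<kappa>' \<kappa>] repr_ident[of "atom ?N" ?N]] inv.E_swap(1)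
    by (simp add: strict.ten_one_cmp)
  have \<kappa>'\<kappa>: "\<kappa>' \<cdot> \<kappa> = \<langle>\<Sigma> \<otimes>\<^sub>o M\<rangle>"
    using repr_iff[OF repr_comp[OF \<kappa> \<kappa>'] repr_ident[of "?S ## (atom T ## atom ?N)" "\<Sigma> \<otimes>\<^sub>o M"]] inv.E_swap(2)
    by (simp add: M_def strict.ten_one_cmp)
  define K where "K = (\<Sigma> \<otimes>\<^sub>o M, \<kappa>, ?N)"
  define K' where "K' = (?N, \<kappa>', \<Sigma> \<otimes>\<^sub>o M)"
  have K [simp]: "tarr K" "src K = \<Sigma> \<otimes>\<^sub>o M" "trg K = ?N" "tarr K'" "src K' = ?N" "trg K' = \<Sigma> \<otimes>\<^sub>o M"
      "K \<bullet> K' = id0 ?N" "K' \<bullet> K = id0 (\<Sigma> \<otimes>\<^sub>o M)" "mor K = \<kappa>" "mor K' = \<kappa>'"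
    using in_Hom \<kappa>\<kappa>' \<kappa>'\<kappa> by (simp_all add: K_def K'_def tarr_def cmp0_def id0_def)
  let ?SM = "?S ## ?M"
  \<comment> \<open>Transporting the chart of \<Sigma> \<otimes> M along \<kappa> makes \<kappa>
    itself an identity between charts.\<close>
  define eN where "eN = Chart ?N (wires ?SM) (chart_to ?SM \<bullet> K') (K \<bullet> chart_from ?SM)"
  have eN_simps: "ob eN = ?N" "wires eN = [\<Sigma>, M]" "chart_to eN = chart_to ?SM \<bullet> K'" "chart_from eN = K \<bullet> chart_from ?SM"
    by (simp_all add: eN_def)
  have wf_eN: "chart eN"
    unfolding chart_def eN_simps
    by (simp add: cmp0_cancel[OF chartD(9)] cmp0_cancel[OF K(8)] chartD(10)[of ?SM, simplified])
  have R_\<kappa>: "repr ?SM \<kappa> eN (sone [\<Sigma>, M])"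
    by (rule reprI[where G = K])
      (auto simp: wf_eN eN_simps ty_simps cmp0_cancel[OF K(8)] chartD(10)[of ?SM, simplified] intro!: strict_eqI)
  have R_\<kappa>': "repr eN \<kappa>' ?SM (sone [\<Sigma>, M])"
    by (rule reprI[where G = K'])
      (auto simp: wf_eN eN_simps ty_simps cmp0_cancel[OF K(8)] chartD(10)[of ?SM, simplified] intro!: strict_eqI)
  have e_in: "lact e \<in> Hom C (A \<otimes>\<^sub>o ?N) ?N" "ract e \<in> Hom C (?N \<otimes>\<^sub>o A) ?N"
      "anchor e \<in> Hom C ((\<I> \<otimes>\<^sub>o ?N) \<otimes>\<^sub>o (\<I> \<otimes>\<^sub>o A)) ((\<I> \<otimes>\<^sub>o A) \<otimes>\<^sub>o A)"
      "bracket e \<in> Hom C ((\<I> \<otimes>\<^sub>o ?N) \<otimes>\<^sub>o (\<I> \<otimes>\<^sub>o ?N)) (\<I> \<otimes>\<^sub>o brk_sum C A ?N)"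
    using assms by (simp_all add: double_lie_rinehart_def Let_def bimodule_def)
  obtain lN rN pN blN brN where ce: "dlr_charts C unit_chart eN ?A \<I> ?N A \<mu> (lact e) (ract e) (anchor e) (bracket e) m' lN rN pN blN brN"
    by (rule obtain_charts_for[OF valid_unit_chart wf_eN valid_atom[OF A_obj] chart_simps(3) eN_simps(1) chart_simps(1) repr_mult e_in])
  interpret e: dlr_charts C unit_chart eN ?A \<I> ?N A \<mu> "lact e" "ract e" "anchor e" "bracket e" m' lN rN pN blN brN
    by (rule ce)
  have axioms: "strict.dlr_axioms [] [\<Sigma>, M] [A] m' lN rN pN blN brN"
    using e.double_lie_rinehart_iff[of e] assms by (simp add: eN_simps)
  note [simp] = e.doms_cods[unfolded eN_simps, simplified]
  \<comment> \<open>The left action has its \<Sigma> between A and M. Brought to the front, it can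
    be divided off by fullness; for the right action it stands in front already.\<close>
  obtain l0 where l0: "sarr l0" "sdom l0 = [A, M]" "scod l0 = [M]" "lN \<star> (ssw [\<Sigma>] [A] \<box> sone [M]) = sone [\<Sigma>] \<box> l0"
    by (rule inv.full[of "lN \<star> (ssw [\<Sigma>] [A] \<box> sone [M])" "[A, M]" "[M]"]) simp_all
  have "lN = (lN \<star> (ssw [\<Sigma>] [A] \<box> sone [M])) \<star> (ssw [A] [\<Sigma>] \<box> sone [M])"
    by (simp add: strict.interchange)
  then have lN: "(sone [\<Sigma>] \<box> l0) \<star> (ssw [A] [\<Sigma>] \<box> sone [M]) = lN"
    by (simp only: l0(4))
  obtain r0 where r0: "sarr r0" "sdom r0 = [M, A]" "scod r0 = [M]" "rN = sone [\<Sigma>] \<box> r0"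
    by (rule inv.full[of rN "[M, A]" "[M]"]) simp_all
  \<comment> \<open>Anchor and bracket are obtained without division: \<open>pN\<close> already has
    the shape of a shifted anchor, and the crossing in the right component is undone by its
    inverse.\<close>
  define p' where "p' = (sone [\<Sigma>] \<box> pN) \<star> (ssw [\<Sigma>, M] [\<Sigma>] \<box> sone [A])"
  define br where "br = (ssw [A] [\<Sigma>] \<box> sone [M]) \<star> brN"
  have br_N: "(ssw [\<Sigma>] [A] \<box> sone [M]) \<star> br = brN"
    unfolding br_def by (simp add: strict.sw_one_cancel)
  have [simp]: "sarr p'" "sdom p' = [\<Sigma>, M, \<Sigma>, A]" "scod p' = [\<Sigma>, A, A]"
      "sarr br" "sdom br = [\<Sigma>, M, \<Sigma>, M]" "scod br = [\<Sigma>, A, M]"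
    by (simp_all add: p'_def br_def)
  obtain l where l: "repr (?A ## ?M) l ?M l0"
    using repr_surj[of "?A ## ?M" ?M l0] l0 by auto
  obtain r where r: "repr (?M ## ?A) r ?M r0"
    using repr_surj[of "?M ## ?A" ?M r0] r0 by auto
  obtain \<rho> where \<rho>: "repr ((?S ## ?M) ## (?S ## ?A)) \<rho> ((?S ## ?A) ## ?A) p'"
    using repr_surj[of "(?S ## ?M) ## (?S ## ?A)" "(?S ## ?A) ## ?A" p'] by auto
  have *: "chart (?M ## ?A)" "chart (?A ## ?M)" "obj_list [\<Sigma>]" "ob (?M ## ?A) = M \<otimes>\<^sub>o A" "ob (?A ## ?M) = A \<otimes>\<^sub>o M"
    by simp_all
  let ?P = "brk_sum C A M"
  have [simp]: "?P \<in> Obj C"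
    unfolding brk_sum_def by (simp add: dsum_obj)
  obtain i1 i2 p1 p2 where "charted_biproduct [\<Sigma>] (M \<otimes>\<^sub>o A) (A \<otimes>\<^sub>o M) (?M ## ?A) (?A ## ?M) i1 i2 p1 p2"
    by (rule biproduct_charts[OF *])
  note P = charted_biproductD(3-5)[OF this, folded brk_sum_def]
  interpret P: strict_biproduct obj_list sarr sdom scod "(\<star>)" "(\<box>)" sone ssw "(\<boxplus>)" sneg szero
      "[\<Sigma>]" "wires (?M ## ?A)" "wires (?A ## ?M)" "[?P]" i1 i2 p1 p2
    by (rule P(3))
  \<comment> \<open>The bracket is assembled from prescribed components; the biproduct relations
    return \<open>blN\<close> and \<open>br\<close> as its projections.\<close>
  let ?B = "((sone [\<Sigma>] \<box> i1) \<star> blN) \<boxplus> ((sone [\<Sigma>] \<box> i2) \<star> br)"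
  obtain b where b: "repr ((?S ## ?M) ## (?S ## ?M)) b (?S ## atom ?P) ?B"
    using repr_surj[of "(?S ## ?M) ## (?S ## ?M)" "?S ## atom ?P" ?B] by auto
  have bl: "repr ((?S ## ?M) ## (?S ## ?M)) (proj_l C \<Sigma> A M \<cdot> b) ((?S ## ?M) ## ?A) blN"
    unfolding proj_l_def by (rule repr_cong, (rule b P(1,2) repr_rules | simp add: strict.cmp_add)+)
  have br: "repr ((?S ## ?M) ## (?S ## ?M)) (proj_r C \<Sigma> A M \<cdot> b) ((?S ## ?A) ## ?M) br"
    unfolding proj_r_def by (rule repr_cong, (rule b P(1,2) repr_rules | simp add: strict.cmp_add)+)
  have cd: "dlr_charts C ?S ?M ?A \<Sigma> M A \<mu> l r \<rho> b m' l0 r0 p' blN br"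
    by unfold_locales (use repr_mult l r \<rho> bl br repr_arr(4)[OF b] in simp_all)
  have pN: "sarr pN" "sdom pN = \<Sigma> # wires ?M @ [A]" "scod pN = [A, A]"
      "p' = (sone [\<Sigma>] \<box> pN) \<star> (ssw (\<Sigma> # wires ?M) [\<Sigma>] \<box> sone [A])"
    by (simp_all add: p'_def)
  define d where "d = \<lparr>und = M, lact = l, ract = r, anchor = \<rho>, bracket = b\<rparr>"
  have d: "und d = M" "lact d = l" "ract d = r" "anchor d = \<rho>" "bracket d = b"
    by (simp_all add: d_def)
  have cs: "dlr_charts C unit_chart ?SM ?A \<I> (\<Sigma> \<otimes>\<^sub>o M) A \<mu> (lact (shift d)) (ract (shift d))
      (anchor (shift d)) (bracket (shift d)) m' lN rN pN blN brN"
    using shift_charts[OF cd pN] by (simp add: d lN br_N flip: r0(4))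
  have "unit_dlr (shift d)"
    using dlr_charts.double_lie_rinehart_iff[OF cs _ refl refl refl refl] axioms d by simp
  then have "Sigma_dlr d"
    using double_lie_rinehart_shift[OF cd pN d] by simp
  \<comment> \<open>Both structures now have the same strict data and \<kappa> and its inverse are
    represented by identities, so the morphism conditions are those of an identity.\<close>
  moreover have "strict.hom_axioms [] [A] lN rN blN brN lN rN blN brN (sone [\<Sigma>, M])"
    by (rule strict.hom_axioms_one) simp_all
  then have "dlr_hom C \<I> A (shift d) e \<kappa>" "dlr_hom C \<I> A e (shift d) \<kappa>'"
    using dlr_hom_iff[OF cs ce _ refl refl refl refl refl refl refl R_\<kappa>]
      dlr_hom_iff[OF ce cs refl refl refl refl _ refl refl refl R_\<kappa>'] d by simp_all
  then have "iso_arrow (DLR C \<I> A \<mu>) (shift d) e \<kappa>"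
    unfolding iso_arrow_def inverse_arrows_def DLR_simps using \<kappa>\<kappa>' \<kappa>'\<kappa> d by auto
  ultimately show ?thesis
    by blast
qed

lemma shift_equivalence:
  "equivalence_of_categories (DLR C \<Sigma> A \<mu>) (DLR C \<I> A \<mu>) shift (\<lambda>_ _ \<phi>. \<langle>\<Sigma>\<rangle> \<otimes>\<^sub>m \<phi>)"
proof (rule equivalence_of_categoriesI[OF shift_functor])
  fix d e f g
  assume "d \<in> Obj (DLR C \<Sigma> A \<mu>)" "e \<in> Obj (DLR C \<Sigma> A \<mu>)" "f \<in> Hom (DLR C \<Sigma> A \<mu>) d e"
    "g \<in> Hom (DLR C \<Sigma> A \<mu>) d e" "\<langle>\<Sigma>\<rangle> \<otimes>\<^sub>m f = \<langle>\<Sigma>\<rangle> \<otimes>\<^sub>m g"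
  then show "f = g"
    using Sigma_ten_faithful[of "und d" "und e" f g] by (auto simp: DLR_simps dest: und_obj dlr_hom_in)
next
  fix d e h
  assume "d \<in> Obj (DLR C \<Sigma> A \<mu>)" "e \<in> Obj (DLR C \<Sigma> A \<mu>)" "h \<in> Hom (DLR C \<I> A \<mu>) (shift d) (shift e)"
  then have a: "Sigma_dlr d" "Sigma_dlr e" "dlr_hom C \<I> A (shift d) (shift e) h"
    by (simp_all add: DLR_simps)
  obtain \<phi> f where f: "repr (atom (und d)) \<phi> (atom (und e)) f" "h = \<langle>\<Sigma>\<rangle> \<otimes>\<^sub>m \<phi>"
    by (rule Sigma_ten_full[OF und_obj[OF a(1)] und_obj[OF a(2)] dlr_hom_in[OF a(3), simplified]])
  then have "dlr_hom C \<Sigma> A d e \<phi>"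
    using dlr_hom_shift[OF a(1,2) f(1)] a(3) by simp
  then show "\<exists>\<phi> \<in> Hom (DLR C \<Sigma> A \<mu>) d e. \<langle>\<Sigma>\<rangle> \<otimes>\<^sub>m \<phi> = h"
    using f(2) by (auto simp: DLR_simps)
next
  fix e assume "e \<in> Obj (DLR C \<I> A \<mu>)"
  then show "\<exists>d \<in> Obj (DLR C \<Sigma> A \<mu>). \<exists>\<kappa>. iso_arrow (DLR C \<I> A \<mu>) (shift d) e \<kappa>"
    using shift_surj by (auto simp: DLR_simps)
qed

end

theorem theorem5p1p1:
  fixes C :: "('o, 'm, 'z) asm_category_scheme" (structure)
    and \<Sigma> \<Sigma>' A :: 'o and \<epsilon> \<mu> :: 'm
  assumes "additive_symmetric_monoidal_category C"
    and "\<Sigma> \<in> Obj C" and "\<Sigma>' \<in> Obj C"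
    and "iso_arrow C (\<Sigma>' \<otimes>\<^sub>o \<Sigma>) \<I> \<epsilon>"
    and "assoc_monoid C A \<mu>"
  shows "(\<forall>M l r \<rho> b.
            bimodule C A \<mu> M l r \<longrightarrow>
            \<rho> \<in> Hom C ((\<Sigma> \<otimes>\<^sub>o M) \<otimes>\<^sub>o (\<Sigma> \<otimes>\<^sub>o A)) ((\<Sigma> \<otimes>\<^sub>o A) \<otimes>\<^sub>o A) \<longrightarrow>
            b \<in> Hom C ((\<Sigma> \<otimes>\<^sub>o M) \<otimes>\<^sub>o (\<Sigma> \<otimes>\<^sub>o M)) (\<Sigma> \<otimes>\<^sub>o ((M \<otimes>\<^sub>o A) \<oplus>\<^sub>o (A \<otimes>\<^sub>o M))) \<longrightarrow>
            (double_lie_rinehart C \<Sigma> A \<mu>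
               \<lparr>und = M, lact = l, ract = r, anchor = \<rho>, bracket = b\<rparr> \<longleftrightarrow>
             double_lie_rinehart C \<I> A \<mu>
               \<lparr>und = \<Sigma> \<otimes>\<^sub>o M,
                lact = susp_lact C \<Sigma> A M l,
                ract = susp_ract C \<Sigma> A M r,
                anchor = unit_anchor C A (\<Sigma> \<otimes>\<^sub>o M) (shift_anchor C \<Sigma> \<Sigma>' \<epsilon> A M \<rho>),
                bracket = unit_bracket C A (\<Sigma> \<otimes>\<^sub>o M) (shift_bracket C \<Sigma> A M b)\<rparr>)) \<and>
         equivalence_of_categories (DLR C \<Sigma> A \<mu>) (DLR C \<I> A \<mu>)
           (shift_dlr C \<Sigma> \<Sigma>' \<epsilon> A) (\<lambda>_ _ \<phi>. \<langle>\<Sigma>\<rangle> \<otimes>\<^sub>m \<phi>)"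
proof -
  interpret shift_setup C \<Sigma> \<Sigma>' A \<epsilon> \<mu>
    using assms by (intro shift_setup.intro shift_setup_axioms.intro)
  show ?thesis
  proof (intro conjI allI impI)
    fix M l r \<rho> b
    assume M: "bimodule C A \<mu> M l r"
      and \<rho>: "\<rho> \<in> Hom C ((\<Sigma> \<otimes>\<^sub>o M) \<otimes>\<^sub>o (\<Sigma> \<otimes>\<^sub>o A)) ((\<Sigma> \<otimes>\<^sub>o A) \<otimes>\<^sub>o A)"
      and b: "b \<in> Hom C ((\<Sigma> \<otimes>\<^sub>o M) \<otimes>\<^sub>o (\<Sigma> \<otimes>\<^sub>o M)) (\<Sigma> \<otimes>\<^sub>o ((M \<otimes>\<^sub>o A) \<oplus>\<^sub>o (A \<otimes>\<^sub>o M)))"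
    let ?d = "\<lparr>und = M, lact = l, ract = r, anchor = \<rho>, bracket = b\<rparr>"
    have "double_lie_rinehart C \<Sigma> A \<mu> ?d \<longleftrightarrow> double_lie_rinehart C \<I> A \<mu> (shift_dlr C \<Sigma> \<Sigma>' \<epsilon> A ?d)"
      using M \<rho> b by (intro shift_object_iff) (simp_all add: bimodule_def brk_sum_def)
    then show "double_lie_rinehart C \<Sigma> A \<mu> ?d \<longleftrightarrow> double_lie_rinehart C \<I> A \<mu>
               \<lparr>und = \<Sigma> \<otimes>\<^sub>o M,
                lact = susp_lact C \<Sigma> A M l,
                ract = susp_ract C \<Sigma> A M r,
                anchor = unit_anchor C A (\<Sigma> \<otimes>\<^sub>o M) (shift_anchor C \<Sigma> \<Sigma>' \<epsilon> A M \<rho>),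
                bracket = unit_bracket C A (\<Sigma> \<otimes>\<^sub>o M) (shift_bracket C \<Sigma> A M b)\<rparr>"
      by (simp add: shift_dlr_def)
  qed (rule shift_equivalence)
qed

end
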